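(* For $s\ge t\ge 0$, $z\ge 0$ and $\mathbf j=(j,\tilde j)\in E$, $$\bar p_{\mathbf j}(t,s,z)=\sum_{n\in\mathbb N_0}1_{[T_n,T_{n+1})}(t)\,\tilde p_{\mathbf j}(t,s,z;S_n),$$ where for a realization $s_n=(0,1,t_1,y_1,\ldots,t_n,y_n)$ with $t_n\le t$, $\tilde p_{\mathbf j}(t,s,z;s_n)=0$ if $t_n\ge s-z$, and if $t_n<s-z$, $$\tilde p_{\mathbf j}(t,s,z;s_n)=\frac{\alpha(s_n)\prod_{t_n}^{t}\big(I+M_{y_ny_n}(x)\,dx\big)E_{y_n}'}{\alpha(s_n)\prod_{t_n}^{t}\big(I+M_{y_ny_n}(x)\,dx\big)\mathbf 1_{d_{y_n}}}\prod_{t}^{(s-z)\vee t}\big(I+M(x)\,dx\big)E_j\prod_{(s-z)\vee t}^{s}\big(I+M_{jj}(x)\,dx\big)e_{\tilde j}.$$ In particular, when $t_n<s-z\le t$ this reduces to $$\tilde p_{\mathbf j}(t,s,z;s_n)=1_{(y_n=j)}\frac{\alpha(s_n)\prod_{t_n}^{s}\big(I+M_{y_ny_n}(x)\,dx\big)e_{\tilde j}}{\alpha(s_n)\prod_{t_n}^{t}\big(I+M_{y_ny_n}(x)\,dx\big)\mathbf 1_{d_{y_n}}}.$$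
   Context: Product integral: for a square matrix function $A$, $\prod_t^s(I+A(x)\,dx)$ denotes the solution $F(t,s)$ of $\partial_s F(t,s)=F(t,s)A(s)$, $F(t,t)=I$. $\mathbf 1_d$ is the $d$-dimensional column vector of ones; primes denote transposition. Aggregate Markov model: macrostates $\mathcal J=\{1,\ldots,J\}$, each $j$ with $d_j\ge1$ microstates; state space $E=\{(j,\tilde j): j\in\mathcal J,\tilde j\in\{1,\dots,d_j\}\}$, ordered lexicographically, $\bar d=\sum_jd_j$. $X=(X_1,X_2)$ is a time-inhomogeneous Markov jump process on $E$ with (suitably regular) $\bar d\times\bar d$ transition intensity matrix function $M(t)$ in block form with $d_j\times d_k$ blocks $M_{jk}(t)$; $M_{jj}$ sub-intensity, $M_{jk}\ge0$ for $j\ne k$. Initial distribution $(\pi_1(0),\mathbf 0)$, so $X_1(0)=1$; the macrostate process is $Z=X_1$ with natural filtration $\mathbb F^Z=(\mathcal F^Z(t))_t$. $T_n$ are the jump times of $Z$ ($T_0=0$), $Y_n=Z(T_n)$, $S_n=(T_0,Y_0,\ldots,T_n,Y_n)$. For a realization $s_n$, $\alpha(s_n)=\pi_1(0)\prod_{\ell=0}^{n-1}\prod_{t_\ell}^{t_{\ell+1}}(I+M_{y_\ell y_\ell}(x)\,dx)M_{y_\ell y_{\ell+1}}(t_{\ell+1})$ ($t_0=0,y_0=1$). Duration process: $U(t)=\sup\{s\in[0,t]: Z(v)=Z(t)\ \forall v\in[t-s,t]\}$. $\bar p_{\mathbf j}(t,s,z)=\mathbb P(X(s)=\mathbf j,\,U(s)>z\mid\mathcal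 F^Z(t))$. $e_{\tilde j}$ is the $d_j$-dimensional unit column vector with a one in entry $\tilde j$; $E_j$ is the $\bar d\times d_j$ matrix whose $j$-th block row (rows $d_1+\dots+d_{j-1}+1,\ldots,d_1+\dots+d_j$) is the $d_j\times d_j$ identity and whose other entries are zero. *)

theory Defs
  imports "HOL-Probability.Probability" "Jordan_Normal_Form.Matrix"
begin

definition prodint_sol :: "nat \<Rightarrow> (real \<Rightarrow> real mat) \<Rightarrow> real \<Rightarrow> (real \<Rightarrow> real mat) \<Rightarrow> bool" where
  "prodint_sol n A t F \<longleftrightarrow> F t = 1\<^sub>m n \<and>
     (\<forall>u\<ge>t. F u \<in> carrier_mat n n \<and>
        (\<forall>a<n. \<forall>b<n. ((\<lambda>v. F v $$ (a,b)) has_real_derivative (F u * A u) $$ (a,b))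
                        (at u within {t..})))"

definition prodint :: "nat \<Rightarrow> (real \<Rightarrow> real mat) \<Rightarrow> real \<Rightarrow> real \<Rightarrow> real mat" where
  "prodint n A t s = (THE P. \<exists>F. prodint_sol n A t F \<and> P = F s)"

text \<open>Macrostates are 0,...,J-1, microstates of macrostate j are 0,...,d j - 1.
  Macrostate 0 corresponds to the paper's macrostate 1.\<close>

definition dbar :: "nat \<Rightarrow> (nat \<Rightarrow> nat) \<Rightarrow> nat" where
  "dbar J d = (\<Sum>k<J. d k)"

definition off :: "(nat \<Rightarrow> nat) \<Rightarrow> nat \<Rightarrow> nat" where
  "off d j = (\<Sum>k<j. d k)"

definition idx :: "(nat \<Rightarrow> nat) \<Rightarrow> nat \<times> nat \<Rightarrow> nat" where
  "idx d st = off d (fst st) + snd st"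

definition stE :: "nat \<Rightarrow> (nat \<Rightarrow> nat) \<Rightarrow> (nat \<times> nat) set" where
  "stE J d = {(j, jt). j < J \<and> jt < d j}"

definition blk :: "(nat \<Rightarrow> nat) \<Rightarrow> real mat \<Rightarrow> nat \<Rightarrow> nat \<Rightarrow> real mat" where
  "blk d A j k = mat (d j) (d k) (\<lambda>(a,b). A $$ (off d j + a, off d k + b))"

definition Emat :: "nat \<Rightarrow> (nat \<Rightarrow> nat) \<Rightarrow> nat \<Rightarrow> real mat" where
  "Emat J d j = mat (dbar J d) (d j) (\<lambda>(r,c). if r = off d j + c then 1 else 0)"

definition ones :: "nat \<Rightarrow> real mat" where
  "ones n = mat n 1 (\<lambda>_. 1)"

definition intensity_matrix_fun :: "nat \<Rightarrow> (real \<Rightarrow> real mat) \<Rightarrow> bool" where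
  "intensity_matrix_fun n M \<longleftrightarrow>
     (\<forall>x\<ge>0. M x \<in> carrier_mat n n \<and>
        (\<forall>a<n. \<forall>b<n. a \<noteq> b \<longrightarrow> M x $$ (a,b) \<ge> 0) \<and>
        (\<forall>a<n. (\<Sum>b<n. M x $$ (a,b)) = 0)) \<and>
     (\<forall>a<n. \<forall>b<n. continuous_on {0..} (\<lambda>x. M x $$ (a,b)))"

definition step_path :: "(real \<Rightarrow> 'b) \<Rightarrow> bool" where
  "step_path f \<longleftrightarrow>
     (\<forall>u\<ge>0. \<exists>e>0. \<forall>v\<in>{u..<u+e}. f v = f u) \<and>
     (\<forall>b. finite {u\<in>{0..b}. \<not> (\<exists>e>0. \<forall>v\<in>{u-e<..<u+e}. f v = f u)})"

definition init_dist :: "(nat \<Rightarrow> nat) \<Rightarrow> real mat \<Rightarrow> nat \<times> nat \<Rightarrow> real" where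
  "init_dist d pi0 st = (if fst st = 0 \<and> snd st < d 0 then pi0 $$ (0, snd st) else 0)"

definition aggregate_markov ::
  "'w measure \<Rightarrow> nat \<Rightarrow> (nat \<Rightarrow> nat) \<Rightarrow> (real \<Rightarrow> real mat) \<Rightarrow> real mat
     \<Rightarrow> (real \<Rightarrow> 'w \<Rightarrow> nat \<times> nat) \<Rightarrow> bool" where
  "aggregate_markov P J d M pi0 X \<longleftrightarrow>
     prob_space P \<and> J \<ge> 1 \<and> (\<forall>j<J. d j \<ge> 1) \<and>
     intensity_matrix_fun (dbar J d) M \<and>
     pi0 \<in> carrier_mat 1 (d 0) \<and> (\<forall>k<d 0. pi0 $$ (0,k) \<ge> 0) \<and> (\<Sum>k<d 0. pi0 $$ (0,k)) = 1 \<and>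
     (\<forall>t\<ge>0. X t \<in> measurable P (count_space UNIV)) \<and>
     (\<forall>\<omega>\<in>space P. step_path (\<lambda>t. X t \<omega>) \<and> (\<forall>t\<ge>0. X t \<omega> \<in> stE J d)) \<and>
     (\<forall>n (u :: nat \<Rightarrow> real) (i :: nat \<Rightarrow> nat \<times> nat).
        u 0 = 0 \<and> (\<forall>m<n. u m \<le> u (Suc m)) \<and> (\<forall>m\<le>n. i m \<in> stE J d) \<longrightarrow>
        measure P {\<omega>\<in>space P. \<forall>m\<le>n. X (u m) \<omega> = i m} =
          init_dist d pi0 (i 0) *
          (\<Prod>m<n. prodint (dbar J d) M (u m) (u (Suc m)) $$ (idx d (i m), idx d (i (Suc m)))))"

definition macro :: "(real \<Rightarrow> 'w \<Rightarrow> nat \<times> nat) \<Rightarrow> real \<Rightarrow> 'w \<Rightarrow> nat" where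
  "macro X t \<omega> = fst (X t \<omega>)"

fun jump_time :: "(real \<Rightarrow> 'b) \<Rightarrow> nat \<Rightarrow> ereal" where
  "jump_time f 0 = 0"
| "jump_time f (Suc n) =
     (case jump_time f n of
        ereal r \<Rightarrow> (if \<exists>u>r. f u \<noteq> f r then ereal (Inf {u. u > r \<and> f u \<noteq> f r}) else \<infinity>)
      | _ \<Rightarrow> \<infinity>)"

definition jump_seq :: "(real \<Rightarrow> 'b) \<Rightarrow> nat \<Rightarrow> (real \<times> 'b) list" where
  "jump_seq f n = map (\<lambda>l. (real_of_ereal (jump_time f l), f (real_of_ereal (jump_time f l)))) [0..<Suc n]"

definition duration :: "(real \<Rightarrow> 'w \<Rightarrow> nat) \<Rightarrow> real \<Rightarrow> 'w \<Rightarrow> real" where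
  "duration Z t \<omega> = Sup {s\<in>{0..t}. \<forall>v\<in>{t-s..t}. Z v \<omega> = Z t \<omega>}"

definition natfilt :: "'w measure \<Rightarrow> (real \<Rightarrow> 'w \<Rightarrow> nat) \<Rightarrow> real \<Rightarrow> 'w measure" where
  "natfilt P Z t = sigma (space P) {Z u -` {i} \<inter> space P | u i. u \<in> {0..t}}"

definition pbar :: "'w measure \<Rightarrow> (real \<Rightarrow> 'w \<Rightarrow> nat \<times> nat) \<Rightarrow> nat \<times> nat \<Rightarrow> real \<Rightarrow> real \<Rightarrow> real \<Rightarrow> 'w \<Rightarrow> real" where
  "pbar P X st t s z = real_cond_exp P (natfilt P (macro X) t)
      (indicator {\<omega>\<in>space P. X s \<omega> = st \<and> duration (macro X) s \<omega> > z})"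

fun alpha_aux :: "(nat \<Rightarrow> nat) \<Rightarrow> (real \<Rightarrow> real mat) \<Rightarrow> real mat \<Rightarrow> (real \<times> nat) list \<Rightarrow> real mat" where
  "alpha_aux d M a ((t,y) # (t',y') # rest) =
     alpha_aux d M (a * prodint (d y) (\<lambda>x. blk d (M x) y y) t t' * blk d (M t') y y') ((t',y') # rest)"
| "alpha_aux d M a _ = a"

definition alpha :: "(nat \<Rightarrow> nat) \<Rightarrow> (real \<Rightarrow> real mat) \<Rightarrow> real mat \<Rightarrow> (real \<times> nat) list \<Rightarrow> real mat" where
  "alpha d M pi0 sn = alpha_aux d M pi0 sn"

definition ptilde :: "nat \<Rightarrow> (nat \<Rightarrow> nat) \<Rightarrow> (real \<Rightarrow> real mat) \<Rightarrow> real mat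
     \<Rightarrow> real \<Rightarrow> real \<Rightarrow> real \<Rightarrow> nat \<times> nat \<Rightarrow> (real \<times> nat) list \<Rightarrow> real" where
  "ptilde J d M pi0 t s z st sn =
     (let tn = fst (last sn); yn = snd (last sn); j = fst st; jt = snd st;
          a = alpha d M pi0 sn * prodint (d yn) (\<lambda>x. blk d (M x) yn yn) tn t;
          den = (a * ones (d yn)) $$ (0,0);
          r = max (s - z) t
      in if tn \<ge> s - z then 0
         else ((1 / den) \<cdot>\<^sub>m (a * transpose_mat (Emat J d yn))
                 * prodint (dbar J d) M t r * Emat J d j
                 * prodint (d j) (\<lambda>x. blk d (M x) j j) r s) $$ (0, jt))"

definition realization :: "nat \<Rightarrow> real \<Rightarrow> (real \<times> nat) list \<Rightarrow> bool" where
  "realization J t sn \<longleftrightarrow> sn \<noteq> [] \<and> hd sn = (0, 0) \<and> fst (last sn) \<le> t \<and>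
     (\<forall>l<length sn. snd (sn ! l) < J) \<and>
     (\<forall>l. Suc l < length sn \<longrightarrow> fst (sn ! l) < fst (sn ! Suc l) \<and> snd (sn ! l) \<noteq> snd (sn ! Suc l))"

end

theory Submission
  imports Defs
begin

text \<open>
  The conditional law is identified by discretising the observation. Given the macrostates on a
  uniform grid of \<open>[0,t]\<close>, the law of the microstate is a ratio of row vectors obtained by
  multiplying restricted blocks of the transition matrices. If every macro change is weighted by
  \<open>1/h\<close> (with \<open>h\<close> the mesh), these row vectors converge along each path to
  \<open>\<alpha>(S\<^sub>n) \<Prod>(I + M dx)\<close>: blocks on the diagonal agree with the product integral of the
  diagonal block up to \<open>O(h^2)\<close>, and off-diagonal blocks divided by \<open>h\<close> tend to the intensities.
  Dominated convergence then gives the conditional expectation on cylinder sets, which generate the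
  filtration, so no density of the jump times and no martingale convergence theorem is required.
  The normalising limit is almost surely positive because the weights \<open>h^(number of changes)\<close>,
  summed over all words, stay bounded.
\<close>

text \<open>The weight \<open>1/h\<close> per macro change cancels in the ratio, so it does not
  alter the conditional law; it only prevents numerator and denominator from both tending to 0 along
  paths that jump. What the grid argument does not cover directly is the event U(s) > z. It is not
  constancy on a closed interval: the supremum exceeds z only if the macrostate was constant already
  slightly before s - z. The discrepancy is a jump at exactly s - z, a null event, because the
  probability of a change over a short interval is at most linear in its length. Up to this null set
  the event is the intersection of a part decided by time t, present only when s - z \<le> t, and of
  staying in macrostate j on the closed interval from (s - z) \<or> t to s. The decided part lies in
  the filtration, is taken out of the conditional expectation and becomes the condition t_n < s - z;
  the remainder depends on the past only through the state at t. The analysis runs on functions of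
  states, with one block-diagonal kernel for all macrostates; matrices of varying dimension enter
  only in a separate translation layer.\<close>

section \<open>Mean value inequalities with a majorant\<close>

text \<open>Allowing a majorant \<open>g\<close> instead of a constant is what yields the later
  rates: a linear \<open>g\<close> gives O(h), a quadratic one O(h^2), an exponential one the factor
  1/2 per term of the Peano-Baker series. Derivatives are within the closed interval because the
  equations below have one-sided derivatives at their starting time.\<close>

lemma deriv_dominated_bound:
  fixes f g :: "real \<Rightarrow> real"
  assumes ab: "a \<le> b"
    and f: "\<And>x. x \<in> {a..b} \<Longrightarrow> (f has_real_derivative f' x) (at x within {a..b})"
    and g: "\<And>x. x \<in> {a..b} \<Longrightarrow> (g has_real_derivative g' x) (at x within {a..b})"
    and le: "\<And>x. x \<in> {a..b} \<Longrightarrow> \<bar>f' x\<bar> \<le> g' x"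
  shows "\<bar>f b - f a\<bar> \<le> g b - g a"
proof (cases "a = b")
  case False
  with ab have lt: "a < b" by simp
  have at: "at x within {a..b} = at x" if "a < x" "x < b" for x
    using that by (intro at_within_interior) simp
  have "norm (f b - f a) \<le> g b - g a"
  proof (rule differentiable_bound_general[OF lt, of f g f' g'])
    show "continuous_on {a..b} f" "continuous_on {a..b} g"
      using f g by (meson DERIV_continuous continuous_on_eq_continuous_within)+
    show "(f has_vector_derivative f' x) (at x)" "(g has_vector_derivative g' x) (at x)"
      "norm (f' x) \<le> g' x" if "a < x" "x < b" for x
      using f[of x] g[of x] le[of x] at[OF that] that
      by (auto simp: has_real_derivative_iff_has_vector_derivative)
  qed
  then show ?thesis by simp
qed simp

lemma deriv_nonpos_antimono:
  fixes f :: "real \<Rightarrow> real"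
  assumes ab: "a \<le> b"
    and f: "\<And>x. x \<in> {a..b} \<Longrightarrow> (f has_real_derivative f' x) (at x within {a..b})"
    and le: "\<And>x. x \<in> {a..b} \<Longrightarrow> f' x \<le> 0"
  shows "f b \<le> f a"
proof -
  \<comment> \<open>The zero function is dominated by \<open>- f\<close>, so the oscillation bound
    degenerates to monotonicity.\<close>
  have "\<bar>(0::real) - 0\<bar> \<le> - f b - (- f a)"
    by (rule deriv_dominated_bound[of a b "\<lambda>_. 0" "\<lambda>_. 0" "\<lambda>x. - f x" "\<lambda>x. - f' x"])
      (use assms in \<open>auto intro!: derivative_eq_intros\<close>)
  then show ?thesis by simp
qed

section \<open>Linear matrix differential equations over a finite index set\<close>

text \<open>The equation F' = F A decouples into rows, so a single row is the unknown. The index set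
  is arbitrary because it is instantiated both with \<open>{..<n}\<close> for matrix entries and
  with the set of states for the kernels.\<close>

definition lin_row :: "'i set \<Rightarrow> (real \<Rightarrow> 'i \<Rightarrow> 'i \<Rightarrow> real) \<Rightarrow> real \<Rightarrow> (real \<Rightarrow> 'i \<Rightarrow> real) \<Rightarrow> bool" where
  "lin_row I A a x \<longleftrightarrow> (\<forall>u\<ge>a. \<forall>k\<in>I.
     ((\<lambda>v. x v k) has_real_derivative (\<Sum>c\<in>I. x u c * A u c k)) (at u within {a..}))"

definition fund_sol :: "'i set \<Rightarrow> (real \<Rightarrow> 'i \<Rightarrow> 'i \<Rightarrow> real) \<Rightarrow> real \<Rightarrow> (real \<Rightarrow> 'i \<Rightarrow> 'i \<Rightarrow> real) \<Rightarrow> bool" where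
  "fund_sol I A a p \<longleftrightarrow> (\<forall>i\<in>I. (\<forall>k\<in>I. p a i k = of_bool (i = k)) \<and> lin_row I A a (\<lambda>u. p u i))"

definition cont_coeff :: "'i set \<Rightarrow> (real \<Rightarrow> 'i \<Rightarrow> 'i \<Rightarrow> real) \<Rightarrow> bool" where
  "cont_coeff I A \<longleftrightarrow> finite I \<and> (\<forall>i\<in>I. \<forall>k\<in>I. continuous_on {0..} (\<lambda>x. A x i k))"

lemma cont_coeff_bound:
  assumes "cont_coeff I A"
  obtains K where "K \<ge> 0" "\<And>x i k. x \<in> {0..H} \<Longrightarrow> i \<in> I \<Longrightarrow> k \<in> I \<Longrightarrow> \<bar>A x i k\<bar> \<le> K"
proof -
  have "\<exists>B. \<forall>x\<in>{0..H}. \<bar>A x i k\<bar> \<le> B" if "i \<in> I" "k \<in> I" for i k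
  proof -
    have "continuous_on {0..H} (\<lambda>x. A x i k)"
      using assms that unfolding cont_coeff_def by (meson atLeast_iff atLeastAtMost_iff continuous_on_subset subsetI)
    then have "bounded ((\<lambda>x. A x i k) ` {0..H})"
      by (intro compact_imp_bounded compact_continuous_image) auto
    then show ?thesis by (auto simp: bounded_iff)
  qed
  then obtain B where B: "\<And>i k x. i \<in> I \<Longrightarrow> k \<in> I \<Longrightarrow> x \<in> {0..H} \<Longrightarrow> \<bar>A x i k\<bar> \<le> B i k" by metis
  have fin: "finite I" using assms by (simp add: cont_coeff_def)
  show ?thesis
  proof (rule that)
    show "(\<Sum>i\<in>I. \<Sum>k\<in>I. \<bar>B i k\<bar>) \<ge> 0" by (intro sum_nonneg) auto
    fix x i k assume *: "x \<in> {0..H}" "i \<in> I" "k \<in> I"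
    have "\<bar>A x i k\<bar> \<le> \<bar>B i k\<bar>" using B[of i k x] * by linarith
    also have "\<dots> \<le> (\<Sum>k\<in>I. \<bar>B i k\<bar>)"
      using * fin by (intro member_le_sum) auto
    also have "\<dots> \<le> (\<Sum>i\<in>I. \<Sum>k\<in>I. \<bar>B i k\<bar>)"
      using * fin by (intro member_le_sum[of i I "\<lambda>i. \<Sum>k\<in>I. \<bar>B i k\<bar>"]) (auto intro: sum_nonneg)
    finally show "\<bar>A x i k\<bar> \<le> (\<Sum>i\<in>I. \<Sum>k\<in>I. \<bar>B i k\<bar>)" .
  qed
qed

lemma lin_row_subset:
  assumes "lin_row I A a x" "a \<le> u" "k \<in> I" "T \<subseteq> {a..}"
  shows "((\<lambda>v. x v k) has_real_derivative (\<Sum>c\<in>I. x u c * A u c k)) (at u within T)"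
  using assms unfolding lin_row_def by (meson DERIV_subset)

lemma lin_row_restart: "lin_row I A a x \<Longrightarrow> a \<le> b \<Longrightarrow> lin_row I A b x"
  unfolding lin_row_def by (meson DERIV_subset atLeast_subset_iff order_trans)

lemma lin_row_diff:
  "lin_row I A a x \<Longrightarrow> lin_row I A a y \<Longrightarrow> lin_row I A a (\<lambda>u k. x u k - y u k)"
  unfolding lin_row_def by (auto intro!: derivative_eq_intros simp: sum_subtractf left_diff_distrib)

lemma lin_row_comb:
  assumes "\<And>i. i \<in> I \<Longrightarrow> lin_row I A a (\<lambda>u. p u i)"
  shows "lin_row I A a (\<lambda>u k. \<Sum>i\<in>I. c i * p u i k)"
  unfolding lin_row_def
proof (intro allI impI ballI)
  fix u k assume uk: "a \<le> u" "k \<in> I"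
  have "((\<lambda>v. \<Sum>i\<in>I. c i * p v i k) has_real_derivative (\<Sum>i\<in>I. c i * (\<Sum>j\<in>I. p u i j * A u j k))) (at u within {a..})"
    using assms uk unfolding lin_row_def by (intro DERIV_sum DERIV_cmult) auto
  also have "(\<Sum>i\<in>I. c i * (\<Sum>j\<in>I. p u i j * A u j k)) = (\<Sum>j\<in>I. (\<Sum>i\<in>I. c i * p u i j) * A u j k)"
    by (simp add: sum_distrib_left sum_distrib_right mult.assoc)
      (rule sum.swap)
  finally show "((\<lambda>v. \<Sum>i\<in>I. c i * p v i k) has_real_derivative (\<Sum>j\<in>I. (\<Sum>i\<in>I. c i * p u i j) * A u j k)) (at u within {a..})" .
qed

text \<open>The squared Euclidean norm is differentiable, unlike the sum of absolute values. Each
  cross term of its derivative is bounded through 2|xy| \<le> x^2 + y^2; every square then occurs 2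
  card(I) times, which is the rate in the exponent.\<close>

lemma lin_row_gronwall:
  fixes a b K :: real
  assumes row: "lin_row I A a x" and ab: "a \<le> b" and fin: "finite I"
    and K: "\<And>u i k. u \<in> {a..b} \<Longrightarrow> i \<in> I \<Longrightarrow> k \<in> I \<Longrightarrow> \<bar>A u i k\<bar> \<le> K"
  shows "(\<Sum>k\<in>I. (x b k)\<^sup>2) \<le> (\<Sum>k\<in>I. (x a k)\<^sup>2) * exp (2 * real (card I) * K * (b - a))"
proof -
  define L where "L = 2 * real (card I) * K"
  define \<phi> where "\<phi> u = (\<Sum>k\<in>I. (x u k)\<^sup>2)" for u
  define \<phi>' where "\<phi>' u = (\<Sum>k\<in>I. 2 * x u k * (\<Sum>c\<in>I. x u c * A u c k))" for u
  have d: "(\<phi> has_real_derivative \<phi>' u) (at u within {a..b})" if "u \<in> {a..b}" for u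
    unfolding \<phi>_def \<phi>'_def
    by (rule DERIV_sum) (use lin_row_subset[OF row, of u _ "{a..b}"] that in \<open>auto intro!: derivative_eq_intros\<close>)
  have le: "\<phi>' u \<le> L * \<phi> u" if u: "u \<in> {a..b}" for u
  proof -
    have "2 * x u k * (x u c * A u c k) \<le> K * ((x u k)\<^sup>2 + (x u c)\<^sup>2)" if kc: "k \<in> I" "c \<in> I" for k c
    proof -
      have "2 * x u k * (x u c * A u c k) \<le> \<bar>A u c k\<bar> * (2 * \<bar>x u k * x u c\<bar>)"
        using abs_ge_self[of "2 * x u k * (x u c * A u c k)"] by (simp add: abs_mult ac_simps)
      also have "\<dots> \<le> \<bar>A u c k\<bar> * ((x u k)\<^sup>2 + (x u c)\<^sup>2)"
        using sum_squares_bound[of "\<bar>x u k\<bar>" "\<bar>x u c\<bar>"] by (intro mult_left_mono) (auto simp: abs_mult)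
      also have "\<dots> \<le> K * ((x u k)\<^sup>2 + (x u c)\<^sup>2)"
        using K[OF u kc(2,1)] by (intro mult_right_mono) auto
      finally show ?thesis .
    qed
    then have "\<phi>' u \<le> (\<Sum>k\<in>I. \<Sum>c\<in>I. K * ((x u k)\<^sup>2 + (x u c)\<^sup>2))"
      unfolding \<phi>'_def sum_distrib_left by (intro sum_mono) auto
    also have "\<dots> = L * \<phi> u"
      unfolding L_def \<phi>_def
      by (simp add: distrib_left sum.distrib sum_distrib_left[symmetric] algebra_simps)
    finally show ?thesis .
  qed
  \<comment> \<open>The integrating factor turns the differential inequality into monotonicity of
    the weighted norm.\<close>
  have "exp (- L * b) * \<phi> b \<le> exp (- L * a) * \<phi> a"
    by (rule deriv_nonpos_antimono[OF ab, where f = "\<lambda>u. exp (- L * u) * \<phi> u" and f' = "\<lambda>u. exp (- L * u) * (\<phi>' u - L * \<phi> u)"])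
      (use le in \<open>auto intro!: derivative_eq_intros d simp: algebra_simps\<close>)
  then have "exp (L * b) * (exp (- L * b) * \<phi> b) \<le> exp (L * b) * (exp (- L * a) * \<phi> a)"
    by (intro mult_left_mono) auto
  moreover have "exp (L * b) * exp (- L * b) = 1" "exp (L * b) * exp (- L * a) = exp (L * (b - a))"
    by (simp_all only: exp_add[symmetric]) (simp_all add: algebra_simps)
  ultimately have "\<phi> b \<le> \<phi> a * exp (L * (b - a))"
    by (metis mult.assoc mult.commute mult_1)
  then show ?thesis by (simp add: \<phi>_def L_def)
qed

lemma lin_row_unique:
  assumes x: "lin_row I A a x" and y: "lin_row I A a y" and A: "cont_coeff I A" and a: "0 \<le> a"
    and eq: "\<And>k. k \<in> I \<Longrightarrow> x a k = y a k" and b: "a \<le> b" and k: "k \<in> I"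
  shows "x b k = y b k"
proof -
  have fin: "finite I" using A by (simp add: cont_coeff_def)
  obtain K where K: "\<And>u i k. u \<in> {0..b} \<Longrightarrow> i \<in> I \<Longrightarrow> k \<in> I \<Longrightarrow> \<bar>A u i k\<bar> \<le> K"
    using cont_coeff_bound[OF A] by metis
  have "(\<Sum>k\<in>I. (x b k - y b k)\<^sup>2) \<le> (\<Sum>k\<in>I. (x a k - y a k)\<^sup>2) * exp (2 * real (card I) * K * (b - a))"
    by (rule lin_row_gronwall[OF lin_row_diff[OF x y] b fin]) (use K a in auto)
  also have "\<dots> = 0" using eq by simp
  finally have "(\<Sum>k\<in>I. (x b k - y b k)\<^sup>2) = 0" by (simp add: sum_nonneg order_antisym)
  then show ?thesis using fin k by (simp add: sum_nonneg_eq_0_iff)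
qed

text \<open>Superposition: both sides solve the same row equation and agree at \<open>a\<close>,
  where the fundamental solution is the identity. Applied to a row of \<open>p\<close> restarted at
  \<open>b\<close>, it becomes the Chapman-Kolmogorov identity.\<close>

lemma fund_sol_comb:
  assumes p: "fund_sol I A a p" and x: "lin_row I A a x" and A: "cont_coeff I A" and a: "0 \<le> a"
    and b: "a \<le> b" and k: "k \<in> I"
  shows "x b k = (\<Sum>i\<in>I. x a i * p b i k)"
proof (rule lin_row_unique[OF x _ A a _ b k])
  show "lin_row I A a (\<lambda>u k. \<Sum>i\<in>I. x a i * p u i k)"
    by (rule lin_row_comb) (use p in \<open>auto simp: fund_sol_def\<close>)
  have fin: "finite I" using A by (simp add: cont_coeff_def)
  show "x a k = (\<Sum>i\<in>I. x a i * p a i k)" if "k \<in> I" for k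
    using p that fin by (simp add: fund_sol_def)
qed

lemma fund_sol_semigroup:
  assumes "fund_sol I A a p" "fund_sol I A b q" "cont_coeff I A" "0 \<le> a" "a \<le> b" "b \<le> c" "i \<in> I" "k \<in> I"
  shows "p c i k = (\<Sum>l\<in>I. p b i l * q c l k)"
  using assms by (intro fund_sol_comb[of I A b q "\<lambda>u. p u i"]) (auto simp: fund_sol_def intro: lin_row_restart)

section \<open>Existence of the propagator by the Peano-Baker series\<close>

text \<open>Increments of Picard iteration started from the identity: the n-th term is the n-fold
  iterated integral of \<open>A\<close>, and the sum over \<open>n\<close> is the time-ordered
  exponential.\<close>

primrec peano_baker :: "'i set \<Rightarrow> (real \<Rightarrow> 'i \<Rightarrow> 'i \<Rightarrow> real) \<Rightarrow> real \<Rightarrow> nat \<Rightarrow> real \<Rightarrow> 'i \<Rightarrow> 'i \<Rightarrow> real" where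
  "peano_baker I A a 0 u i k = of_bool (i = k)"
| "peano_baker I A a (Suc n) u i k = integral {a..u} (\<lambda>x. \<Sum>c\<in>I. peano_baker I A a n x i c * A x c k)"

lemma continuous_on_atLeastI:
  fixes f :: "real \<Rightarrow> real"
  assumes "\<And>b. a \<le> b \<Longrightarrow> continuous_on {a..b} f"
  shows "continuous_on {a..} f"
  unfolding continuous_on_eq_continuous_within
proof
  fix x assume x: "x \<in> {a..}"
  have "continuous (at x within {a..x+1}) f"
    using assms[of "x+1"] x by (auto simp: continuous_on_eq_continuous_within)
  moreover have "at x within {a..x+1} = at x within {a..}"
    by (rule at_within_nhd[of _ "{..<x+1}"]) auto
  ultimately show "continuous (at x within {a..}) f" by (simp add: continuous_within)
qed

lemma peano_baker_continuous:
  assumes A: "cont_coeff I A" and a: "0 \<le> a" and k: "k \<in> I"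
  shows "continuous_on {a..} (\<lambda>u. peano_baker I A a n u i k)"
  using k
proof (induction n arbitrary: k)
  case (Suc n)
  have A': "continuous_on {a..b} (\<lambda>x. A x c k)" if "c \<in> I" for c b
    using A a that Suc.prems unfolding cont_coeff_def
    by (meson atLeast_iff atLeastAtMost_iff continuous_on_subset order_trans subsetI)
  have "continuous_on {a..b} (\<lambda>x. \<Sum>c\<in>I. peano_baker I A a n x i c * A x c k)" for b
    by (intro continuous_intros A')
      (auto intro: continuous_on_subset[OF Suc.IH])
  then have "continuous_on {a..b} (\<lambda>u. peano_baker I A a (Suc n) u i k)" for b
    by (auto intro!: indefinite_integral_continuous_1 integrable_continuous_real)
  then show ?case by (rule continuous_on_atLeastI)
qed simp

lemma peano_baker_deriv:
  assumes A: "cont_coeff I A" and a: "0 \<le> a" and k: "k \<in> I" and u: "u \<in> {a..b}"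
  shows "((\<lambda>u. peano_baker I A a (Suc n) u i k) has_real_derivative
           (\<Sum>c\<in>I. peano_baker I A a n u i c * A u c k)) (at u within {a..b})"
proof -
  have A': "continuous_on {a..b} (\<lambda>x. A x c k)" if "c \<in> I" for c
    using A a that k unfolding cont_coeff_def
    by (meson atLeast_iff atLeastAtMost_iff continuous_on_subset order_trans subsetI)
  have "continuous_on {a..b} (\<lambda>x. \<Sum>c\<in>I. peano_baker I A a n x i c * A x c k)"
    by (intro continuous_intros A') (auto intro: continuous_on_subset[OF peano_baker_continuous[OF A a]])
  from integral_has_real_derivative[OF this u] show ?thesis by simp
qed

text \<open>Measured against an exponential weight whose rate is twice card(I) * K, each integration
  gains a factor 1/2. This geometric decay takes the place of the usual factorials and works on
  intervals of any length.\<close>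

lemma peano_baker_bound:
  assumes A: "cont_coeff I A" and a: "0 \<le> a"
    and K: "\<And>u i k. u \<in> {a..b} \<Longrightarrow> i \<in> I \<Longrightarrow> k \<in> I \<Longrightarrow> \<bar>A u i k\<bar> \<le> K"
    and k: "k \<in> I" and u: "u \<in> {a..b}"
  shows "\<bar>peano_baker I A a n u i k\<bar> \<le> (1/2)^n * exp (2 * real (card I) * K * (u - a))"
  using k u
proof (induction n arbitrary: k u)
  case 0
  then have "0 \<le> K" using K[of u k k] by linarith
  then show ?case using 0 by simp
next
  case (Suc n)
  define L where "L = 2 * real (card I) * K"
  have "\<bar>peano_baker I A a (Suc n) u i k - peano_baker I A a (Suc n) a i k\<bar>
      \<le> (1/2)^Suc n * exp (L * (u - a)) - (1/2)^Suc n * exp (L * (a - a))"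
  proof (rule deriv_dominated_bound[where f = "\<lambda>u. peano_baker I A a (Suc n) u i k"
        and g = "\<lambda>u. (1/2)^Suc n * exp (L * (u - a))" and a = a and b = u, OF _ peano_baker_deriv[OF A a Suc.prems(1)]])
    show "((\<lambda>u. (1/2)^Suc n * exp (L * (u - a))) has_real_derivative (real (card I) * K) * ((1/2)^n * exp (L * (x - a))))
        (at x within {a..u})" for x
      by (auto intro!: derivative_eq_intros simp: L_def)
    fix x assume x: "x \<in> {a..u}"
    then have x': "x \<in> {a..b}" using Suc.prems by auto
    have "\<bar>\<Sum>c\<in>I. peano_baker I A a n x i c * A x c k\<bar> \<le> (\<Sum>c\<in>I. ((1/2)^n * exp (L * (x - a))) * K)"
      using Suc.IH[OF _ x'] K[OF x' _ Suc.prems(1)]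
      by (intro order_trans[OF sum_abs] sum_mono) (auto simp: abs_mult L_def intro!: mult_mono)
    then show "\<bar>\<Sum>c\<in>I. peano_baker I A a n x i c * A x c k\<bar> \<le> (real (card I) * K) * ((1/2)^n * exp (L * (x - a)))"
      by (simp add: algebra_simps)
  qed (use Suc.prems in auto)
  moreover have "0 \<le> (1/2::real)^Suc n * exp (L * (a - a))" by simp
  moreover have "peano_baker I A a (Suc n) a i k = 0" by simp
  ultimately have "\<bar>peano_baker I A a (Suc n) u i k\<bar> \<le> (1/2)^Suc n * exp (L * (u - a))" by linarith
  then show ?case by (simp only: L_def)
qed

lemma fund_sol_exists:
  assumes A: "cont_coeff I A" and a: "0 \<le> a"
  shows "\<exists>p. fund_sol I A a p"
proof -
  define g where "g = peano_baker I A a"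
  define p where "p u i k = (\<Sum>n. g n u i k)" for u i k
  have fin: "finite I" using A by (simp add: cont_coeff_def)
  have bnd: "\<exists>C. \<forall>x\<in>{a..b}. \<forall>n. \<forall>k\<in>I. \<forall>i. \<bar>g n x i k\<bar> \<le> C * (1/2)^n" if "a \<le> b" for b
  proof -
    obtain K where K: "K \<ge> 0" "\<And>u i k. u \<in> {0..b} \<Longrightarrow> i \<in> I \<Longrightarrow> k \<in> I \<Longrightarrow> \<bar>A u i k\<bar> \<le> K"
      using cont_coeff_bound[OF A] by metis
    have "\<bar>g n x i k\<bar> \<le> exp (2 * real (card I) * K * (b - a)) * (1/2)^n" if x: "x \<in> {a..b}" "k \<in> I" for x n k i
    proof -
      have "\<bar>g n x i k\<bar> \<le> (1/2)^n * exp (2 * real (card I) * K * (x - a))"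
        unfolding g_def by (rule peano_baker_bound[OF A a, of b]) (use K x a in auto)
      also have "\<dots> \<le> (1/2)^n * exp (2 * real (card I) * K * (b - a))"
        using x K by (intro mult_left_mono) (auto intro!: mult_left_mono)
      finally show ?thesis by (simp add: mult.commute)
    qed
    then show ?thesis by blast
  qed
  have summ: "summable (\<lambda>n. g n x i k)" if x: "a \<le> x" "k \<in> I" for x i k
  proof -
    obtain C where C: "\<forall>y\<in>{a..x}. \<forall>n. \<forall>k\<in>I. \<forall>i. \<bar>g n y i k\<bar> \<le> C * (1/2)^n"
      using bnd[OF x(1)] by blast
    show ?thesis
      by (rule summable_comparison_test'[of "\<lambda>n. C * (1/2)^n" 0]) (use C x in \<open>auto simp: summable_geometric\<close>)
  qed
  have "((\<lambda>v. p v i k) has_real_derivative (\<Sum>c\<in>I. p u i c * A u c k)) (at u within {a..})"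
    if u: "a \<le> u" and k: "k \<in> I" for u i k
  proof -
    \<comment> \<open>Room to the right of \<open>u\<close>, so that the derivative within
      \<open>{a..b}\<close> coincides with the one within \<open>{a..}\<close>.\<close>
    define b where "b = u + 1"
    have ab: "a \<le> b" using u by (simp add: b_def)
    obtain C where C: "\<And>y n k i. y \<in> {a..b} \<Longrightarrow> k \<in> I \<Longrightarrow> \<bar>g n y i k\<bar> \<le> C * (1/2)^n"
      using bnd[OF ab] by blast
    obtain K where K: "K \<ge> 0" "\<And>u i k. u \<in> {0..b} \<Longrightarrow> i \<in> I \<Longrightarrow> k \<in> I \<Longrightarrow> \<bar>A u i k\<bar> \<le> K"
      using cont_coeff_bound[OF A] by metis
    define D where "D n x = (\<Sum>c\<in>I. g n x i c * A x c k)" for n x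
    have Dbnd: "norm (D n x) \<le> (real (card I) * C * K) * (1/2)^n" if x: "x \<in> {a..b}" for n x
    proof -
      have "\<bar>D n x\<bar> \<le> (\<Sum>c\<in>I. (C * (1/2)^n) * K)"
        unfolding D_def using C[OF x] K(2)[of x] k x a
        by (intro order_trans[OF sum_abs] sum_mono) (auto simp: abs_mult intro!: mult_mono intro: order_trans[OF abs_ge_zero])
      then show ?thesis by (simp add: algebra_simps)
    qed
    \<comment> \<open>Termwise differentiation rests on uniform convergence of the differentiated
      series. \<open>D n\<close> is the derivative of the term \<open>Suc n\<close>; the term of
      index 0 is constant and is split off.\<close>
    have "uniform_limit {a..b} (\<lambda>n x. \<Sum>i<n. D i x) (\<lambda>x. \<Sum>n. D n x) sequentially"
      by (rule Weierstrass_m_test[of "{a..b}" D "\<lambda>n. (real (card I) * C * K) * (1/2)^n"])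
        (use Dbnd in \<open>auto simp: summable_geometric\<close>)
    moreover have "((\<lambda>x. g (Suc n) x i k) has_real_derivative D n x) (at x within {a..b})" if "x \<in> {a..b}" for n x
      unfolding g_def D_def by (rule peano_baker_deriv[OF A a k that])
    moreover have "summable (\<lambda>n. g (Suc n) a i k)" using summ[of a k i] k by (subst summable_Suc_iff) auto
    ultimately have "\<exists>G. \<forall>x\<in>{a..b}. (\<lambda>n. g (Suc n) x i k) sums G x \<and> (G has_real_derivative (\<Sum>n. D n x)) (at x within {a..b})"
      by (intro has_field_derivative_series[of _ _ _ _ a]) (use ab in auto)
    then obtain G where G: "\<And>x. x \<in> {a..b} \<Longrightarrow> (\<lambda>n. g (Suc n) x i k) sums G x"
      "\<And>x. x \<in> {a..b} \<Longrightarrow> (G has_real_derivative (\<Sum>n. D n x)) (at x within {a..b})" by blast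
    have pG: "p x i k = of_bool (i = k) + G x" if x: "x \<in> {a..b}" for x
      unfolding p_def using suminf_split_head[OF summ[of x k i]] sums_unique[OF G(1)[OF x]] x k
      by (simp add: g_def)
    have "((\<lambda>v. p v i k) has_real_derivative (\<Sum>n. D n u)) (at u within {a..b})"
    proof (rule has_field_derivative_transform_within[of _ _ _ _ 1])
      show "((\<lambda>x. of_bool (i = k) + G x) has_real_derivative (\<Sum>n. D n u)) (at u within {a..b})"
        using G(2)[of u] u by (auto simp: b_def intro!: derivative_eq_intros)
    qed (use pG u in \<open>auto simp: b_def\<close>)
    moreover have "at u within {a..b} = at u within {a..}"
      by (rule at_within_nhd[of _ "{..<b}"]) (auto simp: b_def)
    moreover have "(\<Sum>n. D n u) = (\<Sum>c\<in>I. p u i c * A u c k)"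
      unfolding D_def p_def using summ u
      by (subst suminf_sum) (auto intro!: sum.cong summable_mult2 simp: suminf_mult2)
    ultimately show ?thesis by simp
  qed
  moreover have "p a i k = of_bool (i = k)" for i k
  proof -
    have "(\<lambda>n. g n a i k) sums of_bool (i = k)"
    proof -
      have "(\<lambda>n. if n = 0 then of_bool (i = k) else (0::real)) sums of_bool (i = k)"
        using sums_single[of 0 "\<lambda>_. of_bool (i = k) :: real"] by simp
      moreover have "g n a i k = (if n = 0 then of_bool (i = k) else 0)" for n
        by (cases n) (auto simp: g_def)
      ultimately show ?thesis by simp
    qed
    then show ?thesis unfolding p_def by (rule sums_unique[symmetric])
  qed
  ultimately show ?thesis unfolding fund_sol_def lin_row_def by blast
qed

section \<open>Transition kernels over short intervals\<close>

lemma abs_mult_le: "\<bar>x\<bar> \<le> a \<Longrightarrow> \<bar>y\<bar> \<le> b \<Longrightarrow> \<bar>x * y\<bar> \<le> a * b" for x y a b :: real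
  by (simp add: abs_mult mult_mono')

text \<open>\<open>cl\<close> is the macrostate of a state. \<open>p\<close> is the propagator of
  the whole matrix and \<open>q\<close> that of its block-diagonal part, so the single kernel
  \<open>q\<close> carries the product integrals of all diagonal blocks at once.\<close>

locale block_kernel =
  fixes S :: "'i set" and cl :: "'i \<Rightarrow> nat" and A :: "real \<Rightarrow> 'i \<Rightarrow> 'i \<Rightarrow> real"
    and p q :: "real \<Rightarrow> real \<Rightarrow> 'i \<Rightarrow> 'i \<Rightarrow> real"
  assumes A: "cont_coeff S A"
    and p: "0 \<le> a \<Longrightarrow> fund_sol S A a (p a)"
    and q: "0 \<le> a \<Longrightarrow> fund_sol S (\<lambda>x i k. if cl i = cl k then A x i k else 0) a (q a)"

text \<open>Gronwall bounds the propagator up to time \<open>H\<close>, hence also its derivative,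
  and integration gives a Lipschitz bound. The constant serves all starting times \<open>a\<close>,
  as summation over grid steps demands.\<close>

lemma fund_sol_near_id:
  assumes A: "cont_coeff S A" and p: "\<And>a. 0 \<le> a \<Longrightarrow> fund_sol S A a (p a)"
  obtains C where "C \<ge> 0"
    "\<And>a x i k. 0 \<le> a \<Longrightarrow> a \<le> x \<Longrightarrow> x \<le> H \<Longrightarrow> i \<in> S \<Longrightarrow> k \<in> S \<Longrightarrow> \<bar>p a x i k - of_bool (i = k)\<bar> \<le> C * (x - a)"
proof -
  obtain K where K: "K \<ge> 0" "\<And>u i k. u \<in> {0..H} \<Longrightarrow> i \<in> S \<Longrightarrow> k \<in> S \<Longrightarrow> \<bar>A u i k\<bar> \<le> K"
    by (rule cont_coeff_bound[OF A, of H]; blast)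
  have fin: "finite S" using A by (simp add: cont_coeff_def)
  define B where "B = 1 + exp (2 * real (card S) * K * H)"
  have B: "\<bar>p a x i k\<bar> \<le> B" if "0 \<le> a" "a \<le> x" "x \<le> H" "i \<in> S" "k \<in> S" for a x i k
  proof -
    \<comment> \<open>Passing through |x| \<le> 1 + x^2 avoids a square root of the Gronwall
      bound.\<close>
    have "\<bar>p a x i k\<bar> \<le> 1 + (p a x i k)\<^sup>2"
      using sum_squares_bound[of 1 "\<bar>p a x i k\<bar>"] by simp
    also have "(p a x i k)\<^sup>2 \<le> (\<Sum>k\<in>S. (p a x i k)\<^sup>2)"
      using fin that by (intro member_le_sum) auto
    also have "\<dots> \<le> (\<Sum>k\<in>S. (p a a i k)\<^sup>2) * exp (2 * real (card S) * K * (x - a))"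
      by (rule lin_row_gronwall) (use p that K fin in \<open>auto simp: fund_sol_def\<close>)
    also have "(\<Sum>k\<in>S. (p a a i k)\<^sup>2) = (\<Sum>k\<in>S. of_bool (i = k))"
      using p[OF that(1)] that by (intro sum.cong) (auto simp: fund_sol_def)
    also have "\<dots> = 1" using fin that by simp
    also have "1 * exp (2 * real (card S) * K * (x - a)) \<le> exp (2 * real (card S) * K * H)"
      using that K by (auto intro!: mult_left_mono)
    finally show ?thesis by (simp add: B_def)
  qed
  have B0: "B \<ge> 0" by (simp add: B_def add_nonneg_nonneg)
  show ?thesis
  proof (rule that)
    show "real (card S) * B * K \<ge> 0" using B0 K by simp
    fix a x i k assume *: "0 \<le> a" "a \<le> x" "x \<le> H" "i \<in> S" "k \<in> S"
    have "\<bar>p a x i k - p a a i k\<bar> \<le> (real (card S) * B * K) * x - (real (card S) * B * K) * a"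
    proof (rule deriv_dominated_bound[where g' = "\<lambda>_. real (card S) * B * K"])
      show "((\<lambda>u. p a u i k) has_real_derivative (\<Sum>c\<in>S. p a u i c * A u c k)) (at u within {a..x})"
        if "u \<in> {a..x}" for u
        using p[OF *(1)] * that by (intro lin_row_subset[of S A a "\<lambda>u. p a u i"]) (auto simp: fund_sol_def)
      show "((*) (real (card S) * B * K) has_real_derivative real (card S) * B * K) (at u within {a..x})" for u
        by (auto intro!: derivative_eq_intros)
      fix u assume u: "u \<in> {a..x}"
      have "\<bar>\<Sum>c\<in>S. p a u i c * A u c k\<bar> \<le> (\<Sum>c\<in>S. B * K)"
        using u * by (intro order_trans[OF sum_abs] sum_mono abs_mult_le B K) auto
      then show "\<bar>\<Sum>c\<in>S. p a u i c * A u c k\<bar> \<le> real (card S) * B * K" by simp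
    qed (use * in auto)
    then show "\<bar>p a x i k - of_bool (i = k)\<bar> \<le> (real (card S) * B * K) * (x - a)"
      using p[OF *(1)] * by (simp add: fund_sol_def right_diff_distrib)
  qed
qed

text \<open>Closeness to the identity inserted into the equation itself; one integration of this
  estimate gives second-order information on the propagator.\<close>

lemma fund_sol_deriv_near:
  assumes A: "cont_coeff S A" and p: "\<And>a. 0 \<le> a \<Longrightarrow> fund_sol S A a (p a)"
  obtains C where "C \<ge> 0"
    "\<And>a x i k. 0 \<le> a \<Longrightarrow> a \<le> x \<Longrightarrow> x \<le> H \<Longrightarrow> i \<in> S \<Longrightarrow> k \<in> S \<Longrightarrow>
       \<bar>(\<Sum>c\<in>S. p a x i c * A x c k) - A x i k\<bar> \<le> C * (x - a)"
proof -
  obtain K where K: "K \<ge> 0" "\<And>u i k. u \<in> {0..H} \<Longrightarrow> i \<in> S \<Longrightarrow> k \<in> S \<Longrightarrow> \<bar>A u i k\<bar> \<le> K"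
    by (rule cont_coeff_bound[OF A, of H]; blast)
  obtain C where C: "C \<ge> 0"
    "\<And>a x i k. 0 \<le> a \<Longrightarrow> a \<le> x \<Longrightarrow> x \<le> H \<Longrightarrow> i \<in> S \<Longrightarrow> k \<in> S \<Longrightarrow> \<bar>p a x i k - of_bool (i = k)\<bar> \<le> C * (x - a)"
    by (rule fund_sol_near_id[of S A p H, OF A p]; blast)
  have fin: "finite S" using A by (simp add: cont_coeff_def)
  show ?thesis
  proof (rule that)
    show "real (card S) * C * K \<ge> 0" using C K by simp
    fix a x i k assume *: "0 \<le> a" "a \<le> x" "x \<le> H" "i \<in> S" "k \<in> S"
    have "A x i k = (\<Sum>c\<in>S. of_bool (i = c) * A x c k)"
      using * fin by (simp add: of_bool_def if_distrib[of "\<lambda>y. y * _"] cong: if_cong)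
    then have "\<bar>(\<Sum>c\<in>S. p a x i c * A x c k) - A x i k\<bar> = \<bar>\<Sum>c\<in>S. (p a x i c - of_bool (i = c)) * A x c k\<bar>"
      by (simp add: left_diff_distrib sum_subtractf)
    also have "\<dots> \<le> (\<Sum>c\<in>S. (C * (x - a)) * K)"
      using * by (intro order_trans[OF sum_abs] sum_mono abs_mult_le C K) auto
    finally show "\<bar>(\<Sum>c\<in>S. p a x i c * A x c k) - A x i k\<bar> \<le> (real (card S) * C * K) * (x - a)"
      by (simp add: algebra_simps)
  qed
qed

section \<open>Expansion of both propagators over one short step\<close>

context block_kernel
begin

lemma fin: "finite S" using A by (simp add: cont_coeff_def)

lemma A_diag: "cont_coeff S (\<lambda>x i k. if cl i = cl k then A x i k else 0)"
  unfolding cont_coeff_def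
proof (intro conjI ballI)
  fix i k assume "i \<in> S" "k \<in> S"
  then show "continuous_on {0..} (\<lambda>x. if cl i = cl k then A x i k else 0)"
    using A by (cases "cl i = cl k") (auto simp: cont_coeff_def)
qed (use A in \<open>simp add: cont_coeff_def\<close>)

lemma p_refl: "0 \<le> a \<Longrightarrow> i \<in> S \<Longrightarrow> k \<in> S \<Longrightarrow> p a a i k = of_bool (i = k)"
  using p by (simp add: fund_sol_def)

lemma q_refl: "0 \<le> a \<Longrightarrow> i \<in> S \<Longrightarrow> k \<in> S \<Longrightarrow> q a a i k = of_bool (i = k)"
  using q by (simp add: fund_sol_def)

lemma q_semigroup:
  "0 \<le> a \<Longrightarrow> a \<le> b \<Longrightarrow> b \<le> c \<Longrightarrow> i \<in> S \<Longrightarrow> k \<in> S \<Longrightarrow> q a c i k = (\<Sum>l\<in>S. q a b i l * q b c l k)"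
  by (rule fund_sol_semigroup[OF q q A_diag]) auto

text \<open>Cutting a row of \<open>q\<close> down to the class of its starting state leaves a
  solution, since the coefficients do not couple classes. The cut row has the same initial value,
  and uniqueness identifies the two.\<close>

lemma q_off_diag:
  assumes "0 \<le> a" "a \<le> u" "i \<in> S" "k \<in> S" "cl i \<noteq> cl k"
  shows "q a u i k = 0"
proof -
  let ?y = "\<lambda>u k. if cl i = cl k then q a u i k else 0"
  have row: "lin_row S (\<lambda>x i k. if cl i = cl k then A x i k else 0) a (\<lambda>u. q a u i)"
    using q assms by (auto simp: fund_sol_def)
  have "lin_row S (\<lambda>x i k. if cl i = cl k then A x i k else 0) a ?y"
    unfolding lin_row_def
  proof (intro allI impI ballI)
    fix u k assume u: "a \<le> u" "k \<in> S"
    let ?D = "\<Sum>c\<in>S. ?y u c * (if cl c = cl k then A u c k else 0)"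
    show "((\<lambda>v. ?y v k) has_real_derivative ?D) (at u within {a..})"
    proof (cases "cl i = cl k")
      case True
      have "?D = (\<Sum>c\<in>S. q a u i c * (if cl c = cl k then A u c k else 0))"
        using True by (intro sum.cong) auto
      then show ?thesis using row u True by (auto simp: lin_row_def)
    next
      case False
      then have "?D = 0" by (intro sum.neutral) auto
      then show ?thesis using False by simp
    qed
  qed
  have "q a u i k = ?y u k"
    by (rule lin_row_unique[OF row \<open>lin_row S _ a ?y\<close> A_diag assms(1) _ assms(2,4)])
      (use assms q_refl in auto)
  then show ?thesis using assms by simp
qed

text \<open>Within one class both derivatives are first-order close to the same entry of
  \<open>A\<close>. Probabilistically, leaving a class and returning within one step takes two
  jumps. Summed over about 1/h steps, the local error h^2 leaves a global error of order h.\<close>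

lemma diag_block_error:
  obtains C where "C \<ge> 0"
    "\<And>a b i k. 0 \<le> a \<Longrightarrow> a \<le> b \<Longrightarrow> b \<le> H \<Longrightarrow> i \<in> S \<Longrightarrow> k \<in> S \<Longrightarrow> cl i = cl k \<Longrightarrow>
       \<bar>p a b i k - q a b i k\<bar> \<le> C * (b - a)\<^sup>2"
proof -
  obtain C where C: "C \<ge> 0"
    "\<And>a x i k. 0 \<le> a \<Longrightarrow> a \<le> x \<Longrightarrow> x \<le> H \<Longrightarrow> i \<in> S \<Longrightarrow> k \<in> S \<Longrightarrow>
       \<bar>(\<Sum>c\<in>S. p a x i c * A x c k) - A x i k\<bar> \<le> C * (x - a)"
    by (rule fund_sol_deriv_near[of S A p H, OF A p]; blast)
  let ?A' = "\<lambda>x i k. if cl i = cl k then A x i k else 0"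
  obtain C' where C': "C' \<ge> 0"
    "\<And>a x i k. 0 \<le> a \<Longrightarrow> a \<le> x \<Longrightarrow> x \<le> H \<Longrightarrow> i \<in> S \<Longrightarrow> k \<in> S \<Longrightarrow>
       \<bar>(\<Sum>c\<in>S. q a x i c * ?A' x c k) - ?A' x i k\<bar> \<le> C' * (x - a)"
    by (rule fund_sol_deriv_near[of S _ q H, OF A_diag q]; blast)
  show ?thesis
  proof (rule that)
    show "(C + C') / 2 \<ge> 0" using C C' by simp
    fix a b i k assume *: "0 \<le> a" "a \<le> b" "b \<le> H" "i \<in> S" "k \<in> S" "cl i = cl k"
    have "\<bar>(p a b i k - q a b i k) - (p a a i k - q a a i k)\<bar> \<le> (C + C') / 2 * (b - a)\<^sup>2 - (C + C') / 2 * (a - a)\<^sup>2"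
    proof (rule deriv_dominated_bound[where f = "\<lambda>u. p a u i k - q a u i k" and g = "\<lambda>u. (C + C') / 2 * (u - a)\<^sup>2"
          and g' = "\<lambda>u. (C + C') * (u - a)"])
      show "((\<lambda>u. p a u i k - q a u i k) has_real_derivative
          (\<Sum>c\<in>S. p a u i c * A u c k) - (\<Sum>c\<in>S. q a u i c * ?A' u c k)) (at u within {a..b})"
        if "u \<in> {a..b}" for u
        using p[OF *(1)] q[OF *(1)] * that
        by (intro DERIV_diff lin_row_subset[of S _ a "\<lambda>u. p a u i"] lin_row_subset[of S _ a "\<lambda>u. q a u i"])
          (auto simp: fund_sol_def)
      show "((\<lambda>u. (C + C') / 2 * (u - a)\<^sup>2) has_real_derivative (C + C') * (x - a)) (at x within {a..b})" for x
        by (auto intro!: derivative_eq_intros)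
      fix x assume "x \<in> {a..b}"
      then show "\<bar>(\<Sum>c\<in>S. p a x i c * A x c k) - (\<Sum>c\<in>S. q a x i c * ?A' x c k)\<bar> \<le> (C + C') * (x - a)"
        using C(2)[of a x i k] C'(2)[of a x i k] * by (simp add: distrib_right)
    qed (use * in auto)
    then show "\<bar>p a b i k - q a b i k\<bar> \<le> (C + C') / 2 * (b - a)\<^sup>2"
      using * p_refl q_refl by simp
  qed
qed

lemma coeff_unif_cont:
  assumes \<epsilon>: "0 < \<epsilon>"
  obtains \<delta> where "\<delta> > 0"
    "\<And>x y i k. x \<in> {0..H} \<Longrightarrow> y \<in> {0..H} \<Longrightarrow> \<bar>x - y\<bar> < \<delta> \<Longrightarrow> i \<in> S \<Longrightarrow> k \<in> S \<Longrightarrow> \<bar>A x i k - A y i k\<bar> \<le> \<epsilon>"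
proof -
  have "\<forall>\<^sub>F \<delta> in at_right 0. \<forall>x\<in>{0..H}. \<forall>y\<in>{0..H}. \<bar>x - y\<bar> < \<delta> \<longrightarrow> \<bar>A x i k - A y i k\<bar> \<le> \<epsilon>"
    if ik: "i \<in> S" "k \<in> S" for i k
  proof -
    have "continuous_on {0..H} (\<lambda>x. A x i k)"
      using A that unfolding cont_coeff_def by (meson atLeast_iff atLeastAtMost_iff continuous_on_subset subsetI)
    then have "uniformly_continuous_on {0..H} (\<lambda>x. A x i k)"
      by (intro compact_uniformly_continuous) auto
    then obtain d where d: "d > 0" "\<And>x y. x \<in> {0..H} \<Longrightarrow> y \<in> {0..H} \<Longrightarrow> dist x y < d \<Longrightarrow> dist (A x i k) (A y i k) < \<epsilon>"
      using \<epsilon> unfolding uniformly_continuous_on_def by metis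
    have "\<forall>\<delta>. 0 < \<delta> \<longrightarrow> \<delta> < d \<longrightarrow> (\<forall>x\<in>{0..H}. \<forall>y\<in>{0..H}. \<bar>x - y\<bar> < \<delta> \<longrightarrow> \<bar>A x i k - A y i k\<bar> \<le> \<epsilon>)"
      using d(2) by (force simp: dist_real_def less_imp_le)
    then show ?thesis unfolding eventually_at_right_field using d(1) by blast
  qed
  then have "\<forall>\<^sub>F \<delta> in at_right 0. \<forall>i\<in>S. \<forall>k\<in>S. \<forall>x\<in>{0..H}. \<forall>y\<in>{0..H}. \<bar>x - y\<bar> < \<delta> \<longrightarrow> \<bar>A x i k - A y i k\<bar> \<le> \<epsilon>"
    using fin by (simp add: eventually_ball_finite_distrib)
  then obtain d where d: "d > 0" "\<And>\<delta>. 0 < \<delta> \<Longrightarrow> \<delta> < d \<Longrightarrow>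
      \<forall>i\<in>S. \<forall>k\<in>S. \<forall>x\<in>{0..H}. \<forall>y\<in>{0..H}. \<bar>x - y\<bar> < \<delta> \<longrightarrow> \<bar>A x i k - A y i k\<bar> \<le> \<epsilon>"
    unfolding eventually_at_right_field by blast
  show ?thesis by (rule that[of "d / 2"]) (use d(1) d(2)[of "d / 2"] in auto)
qed

text \<open>\<open>T\<close> is an arbitrary point of the step because a jump time may fall anywhere
  between two grid points; uniform continuity of the coefficients absorbs the choice. The error
  carries \<epsilon> rather than a power of the step because the coefficients are merely
  continuous.\<close>

lemma off_diag_rate:
  assumes \<epsilon>: "0 < \<epsilon>"
  obtains \<delta> where "\<delta> > 0"
    "\<And>a T b i k. 0 \<le> a \<Longrightarrow> a \<le> T \<Longrightarrow> T \<le> b \<Longrightarrow> b \<le> H \<Longrightarrow> b - a < \<delta> \<Longrightarrow> i \<in> S \<Longrightarrow> k \<in> S \<Longrightarrow> i \<noteq> k \<Longrightarrow>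
       \<bar>p a b i k - (b - a) * A T i k\<bar> \<le> \<epsilon> * (b - a)"
proof -
  obtain C where C: "C \<ge> 0"
    "\<And>a x i k. 0 \<le> a \<Longrightarrow> a \<le> x \<Longrightarrow> x \<le> H \<Longrightarrow> i \<in> S \<Longrightarrow> k \<in> S \<Longrightarrow>
       \<bar>(\<Sum>c\<in>S. p a x i c * A x c k) - A x i k\<bar> \<le> C * (x - a)"
    by (rule fund_sol_deriv_near[of S A p H, OF A p]; blast)
  obtain d where d: "d > 0"
    "\<And>x y i k. x \<in> {0..H} \<Longrightarrow> y \<in> {0..H} \<Longrightarrow> \<bar>x - y\<bar> < d \<Longrightarrow> i \<in> S \<Longrightarrow> k \<in> S \<Longrightarrow> \<bar>A x i k - A y i k\<bar> \<le> \<epsilon> / 2"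
    by (rule coeff_unif_cont[of "\<epsilon> / 2" H, OF half_gt_zero[OF \<epsilon>]]; blast)
  \<comment> \<open>Half of \<epsilon> pays for replacing \<open>A x\<close> by \<open>A T\<close>,
    half for the propagator not being the identity; \<open>C + 1\<close> keeps the denominator
    positive.\<close>
  define \<delta> where "\<delta> = min d (\<epsilon> / (2 * (C + 1)))"
  show ?thesis
  proof (rule that)
    show "\<delta> > 0" using d \<epsilon> C by (simp add: \<delta>_def)
    fix a T b i k
    assume *: "0 \<le> a" "a \<le> T" "T \<le> b" "b \<le> H" "b - a < \<delta>" "i \<in> S" "k \<in> S" "i \<noteq> k"
    have "\<bar>(p a b i k - (b - a) * A T i k) - (p a a i k - (a - a) * A T i k)\<bar> \<le> \<epsilon> * b - \<epsilon> * a"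
    proof (rule deriv_dominated_bound[where f = "\<lambda>u. p a u i k - (u - a) * A T i k" and g = "\<lambda>u. \<epsilon> * u"
          and g' = "\<lambda>u. \<epsilon>"])
      show "((\<lambda>u. p a u i k - (u - a) * A T i k) has_real_derivative
          (\<Sum>c\<in>S. p a u i c * A u c k) - A T i k) (at u within {a..b})"
        if "u \<in> {a..b}" for u
      proof (rule DERIV_diff)
        show "((\<lambda>u. p a u i k) has_real_derivative (\<Sum>c\<in>S. p a u i c * A u c k)) (at u within {a..b})"
          using p[OF *(1)] * that
          by (intro lin_row_subset[of S _ a "\<lambda>u. p a u i"]) (auto simp: fund_sol_def)
      qed (auto intro!: derivative_eq_intros)
      show "((*) \<epsilon> has_real_derivative \<epsilon>) (at x within {a..b})" for x
        by (auto intro!: derivative_eq_intros)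
      fix x assume x: "x \<in> {a..b}"
      have "(C + 1) * (x - a) \<le> (C + 1) * (\<epsilon> / (2 * (C + 1)))"
        using C * x by (intro mult_left_mono) (auto simp: \<delta>_def)
      also have "\<dots> = \<epsilon> / 2" using C by (simp add: field_simps)
      finally have "C * (x - a) \<le> \<epsilon> / 2" using x by (simp add: distrib_right)
      moreover have "\<bar>A x i k - A T i k\<bar> \<le> \<epsilon> / 2"
        using * x by (intro d) (auto simp: \<delta>_def)
      moreover have "\<bar>(\<Sum>c\<in>S. p a x i c * A x c k) - A x i k\<bar> \<le> C * (x - a)"
        using x * by (intro C) auto
      ultimately show "\<bar>(\<Sum>c\<in>S. p a x i c * A x c k) - A T i k\<bar> \<le> \<epsilon>"
        by linarith
    qed (use * in auto)
    then show "\<bar>p a b i k - (b - a) * A T i k\<bar> \<le> \<epsilon> * (b - a)"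
      using * p_refl by (simp add: right_diff_distrib)
  qed
qed

text \<open>Density of following the block-diagonal dynamics up to \<open>T\<close>, jumping at
  \<open>T\<close> into the class of the target and staying there until \<open>b\<close>: the exact
  increment of the limiting filter over a step whose only jump is at \<open>T\<close>.\<close>

definition jump_kernel :: "real \<Rightarrow> real \<Rightarrow> real \<Rightarrow> 'i \<Rightarrow> 'i \<Rightarrow> real" where
  "jump_kernel a T b i k = (\<Sum>j\<in>S. \<Sum>l\<in>S. q a T i j * (A T j l * of_bool (cl l = cl k)) * q T b l k)"

lemma jump_kernel_near:
  obtains C where "C \<ge> 0"
    "\<And>a T b i k. 0 \<le> a \<Longrightarrow> a \<le> T \<Longrightarrow> T \<le> b \<Longrightarrow> b \<le> H \<Longrightarrow> i \<in> S \<Longrightarrow> k \<in> S \<Longrightarrow>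
       \<bar>jump_kernel a T b i k - A T i k\<bar> \<le> C * (b - a)"
proof (cases "H \<ge> 0")
  case False
  then show ?thesis by (intro that[of 0]) auto
next
  case H: True
  obtain K where K: "K \<ge> 0" "\<And>u i k. u \<in> {0..H} \<Longrightarrow> i \<in> S \<Longrightarrow> k \<in> S \<Longrightarrow> \<bar>A u i k\<bar> \<le> K"
    by (rule cont_coeff_bound[OF A, of H]; blast)
  obtain C where C: "C \<ge> 0"
    "\<And>a x i k. 0 \<le> a \<Longrightarrow> a \<le> x \<Longrightarrow> x \<le> H \<Longrightarrow> i \<in> S \<Longrightarrow> k \<in> S \<Longrightarrow> \<bar>q a x i k - of_bool (i = k)\<bar> \<le> C * (x - a)"
    by (rule fund_sol_near_id[of S _ q H, OF A_diag q]; blast)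
  define D where "D = C * (1 + C * H) + C"
  show ?thesis
  proof (rule that)
    show "real (card S) * (real (card S) * (K * D)) \<ge> 0" using K C H by (simp add: D_def)
    fix a T b i k assume *: "0 \<le> a" "a \<le> T" "T \<le> b" "b \<le> H" "i \<in> S" "k \<in> S"
    let ?A = "\<lambda>j l. A T j l * of_bool (cl l = cl k)"
    have "A T i k = (\<Sum>j\<in>S. \<Sum>l\<in>S. of_bool (i = j) * ?A j l * of_bool (l = k))"
    proof -
      have "(\<Sum>j\<in>S. \<Sum>l\<in>S. of_bool (i = j) * ?A j l * of_bool (l = k)) = (\<Sum>j\<in>S. of_bool (i = j) * A T j k)"
        using fin * by (intro sum.cong refl) (simp add: of_bool_def if_distrib[of "\<lambda>y. _ * y"] cong: if_cong)
      also have "\<dots> = A T i k"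
        using fin * by (simp add: of_bool_def if_distrib[of "\<lambda>y. y * _"] cong: if_cong)
      finally show ?thesis by simp
    qed
    then have "\<bar>jump_kernel a T b i k - A T i k\<bar>
      = \<bar>\<Sum>j\<in>S. \<Sum>l\<in>S. ?A j l * (q a T i j * q T b l k - of_bool (i = j) * of_bool (l = k))\<bar>"
      unfolding jump_kernel_def by (simp only: sum_subtractf[symmetric]) (simp add: algebra_simps)
    also have "\<dots> \<le> (\<Sum>j\<in>S. \<Sum>l\<in>S. K * (D * (b - a)))"
    proof (intro order_trans[OF sum_abs] sum_mono)
      fix j l assume jl: "j \<in> S" "l \<in> S"
      have 1: "\<bar>q a T i j - of_bool (i = j)\<bar> \<le> C * (b - a)"
        using C(2)[of a T i j] * jl mult_left_mono[of "T - a" "b - a" C] C(1) by linarith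
      have 2: "\<bar>q T b l k - of_bool (l = k)\<bar> \<le> C * (b - a)"
        using C(2)[of T b l k] * jl mult_left_mono[of "b - T" "b - a" C] C(1) by linarith
      have "C * (b - a) \<le> C * H" using * C(1) by (intro mult_left_mono) auto
      then have 3: "\<bar>q T b l k\<bar> \<le> 1 + C * H" using 2 by (auto split: if_splits simp: of_bool_def)
      \<comment> \<open>A difference of products, changed one factor at a time.\<close>
      have "q a T i j * q T b l k - of_bool (i = j) * of_bool (l = k)
        = (q a T i j - of_bool (i = j)) * q T b l k + of_bool (i = j) * (q T b l k - of_bool (l = k))"
        by (simp add: algebra_simps)
      also have "\<bar>\<dots>\<bar> \<le> (C * (b - a)) * (1 + C * H) + 1 * (C * (b - a))"
        using 1 2 3 * C H by (intro order_trans[OF abs_triangle_ineq] add_mono) (auto simp: abs_mult intro!: mult_mono)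
      finally have "\<bar>q a T i j * q T b l k - of_bool (i = j) * of_bool (l = k)\<bar> \<le> D * (b - a)"
        by (simp add: D_def algebra_simps)
      moreover have "\<bar>?A j l\<bar> \<le> K" using K(1) K(2)[of T j l] * jl by (auto simp: of_bool_def)
      ultimately show "\<bar>?A j l * (q a T i j * q T b l k - of_bool (i = j) * of_bool (l = k))\<bar> \<le> K * (D * (b - a))"
        by (intro abs_mult_le)
    qed
    finally show "\<bar>jump_kernel a T b i k - A T i k\<bar> \<le> real (card S) * (real (card S) * (K * D)) * (b - a)"
      by (simp add: algebra_simps)
  qed
qed

text \<open>Both quantities are compared with the intensity \<open>A T i k\<close>. This is the
  source of the weight 1/h per macro change.\<close>

lemma jump_kernel_limit:
  assumes \<epsilon>: "0 < \<epsilon>"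
  obtains \<delta> where "\<delta> > 0"
    "\<And>a T b i k. 0 \<le> a \<Longrightarrow> a \<le> T \<Longrightarrow> T \<le> b \<Longrightarrow> a < b \<Longrightarrow> b \<le> H \<Longrightarrow> b - a < \<delta> \<Longrightarrow> i \<in> S \<Longrightarrow> k \<in> S \<Longrightarrow> i \<noteq> k \<Longrightarrow>
       \<bar>p a b i k / (b - a) - jump_kernel a T b i k\<bar> \<le> \<epsilon>"
proof -
  obtain d where d: "d > 0"
    "\<And>a T b i k. 0 \<le> a \<Longrightarrow> a \<le> T \<Longrightarrow> T \<le> b \<Longrightarrow> b \<le> H \<Longrightarrow> b - a < d \<Longrightarrow> i \<in> S \<Longrightarrow> k \<in> S \<Longrightarrow> i \<noteq> k \<Longrightarrow>
       \<bar>p a b i k - (b - a) * A T i k\<bar> \<le> \<epsilon> / 2 * (b - a)"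
    by (rule off_diag_rate[of "\<epsilon> / 2" H, OF half_gt_zero[OF \<epsilon>]]; blast)
  obtain C where C: "C \<ge> 0"
    "\<And>a T b i k. 0 \<le> a \<Longrightarrow> a \<le> T \<Longrightarrow> T \<le> b \<Longrightarrow> b \<le> H \<Longrightarrow> i \<in> S \<Longrightarrow> k \<in> S \<Longrightarrow>
       \<bar>jump_kernel a T b i k - A T i k\<bar> \<le> C * (b - a)"
    by (rule jump_kernel_near[of H]; blast)
  define \<delta> where "\<delta> = min d (\<epsilon> / (2 * (C + 1)))"
  show ?thesis
  proof (rule that)
    show "\<delta> > 0" using d \<epsilon> C by (simp add: \<delta>_def)
    fix a T b i k
    assume *: "0 \<le> a" "a \<le> T" "T \<le> b" "a < b" "b \<le> H" "b - a < \<delta>" "i \<in> S" "k \<in> S" "i \<noteq> k"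
    have "(C + 1) * (b - a) \<le> (C + 1) * (\<epsilon> / (2 * (C + 1)))"
      using C * by (intro mult_left_mono) (auto simp: \<delta>_def)
    also have "\<dots> = \<epsilon> / 2" using C by (simp add: field_simps)
    finally have 1: "C * (b - a) \<le> \<epsilon> / 2" using * by (simp add: distrib_right)
    have "\<bar>p a b i k - (b - a) * A T i k\<bar> \<le> \<epsilon> / 2 * (b - a)"
      using * by (intro d) (auto simp: \<delta>_def)
    moreover have "p a b i k / (b - a) - A T i k = (p a b i k - (b - a) * A T i k) / (b - a)"
      using * by (simp add: field_simps)
    ultimately have "\<bar>p a b i k / (b - a) - A T i k\<bar> \<le> \<epsilon> / 2"
      using * by (simp add: abs_divide pos_divide_le_eq)
    then show "\<bar>p a b i k / (b - a) - jump_kernel a T b i k\<bar> \<le> \<epsilon>"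
      using C(2)[of a T b i k] 1 * by linarith
  qed
qed

end

section \<open>Discretised forward recursion along a path\<close>

context block_kernel
begin

text \<open>The forward recursion of hidden Markov models: if \<open>x\<close> is the initial law
  and \<open>p\<close> the transition kernel, it is the probability of being in \<open>B 0\<close>,
  ..., \<open>B l\<close> at the times \<open>u 0\<close>, ..., \<open>u l\<close> and in state
  \<open>k\<close> at the last one. Its limits are studied algebraically, before any probability
  enters.\<close>

primrec fwd :: "(nat \<Rightarrow> real) \<Rightarrow> (nat \<Rightarrow> 'i set) \<Rightarrow> ('i \<Rightarrow> real) \<Rightarrow> nat \<Rightarrow> 'i \<Rightarrow> real" where
  "fwd u B x 0 k = of_bool (k \<in> B 0) * x k"
| "fwd u B x (Suc l) k = of_bool (k \<in> B (Suc l)) * (\<Sum>i\<in>S. fwd u B x l i * p (u l) (u (Suc l)) i k)"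

lemma fwd_cong:
  "(\<And>j. j \<le> l \<Longrightarrow> u j = u' j) \<Longrightarrow> (\<And>j. j \<le> l \<Longrightarrow> B j = B' j) \<Longrightarrow> fwd u B x l k = fwd u' B' x l k"
  by (induction l arbitrary: k) auto

lemma fwd_supp: "k \<notin> B l \<Longrightarrow> fwd u B x l k = 0"
  by (cases l) auto

text \<open>The off-diagonal row sum is of order b - a and so survives division by the step width;
  this keeps the error finite at a jump.\<close>

lemma p_row_sum_bound:
  obtains D where "D \<ge> 0"
    "\<And>a b i. 0 \<le> a \<Longrightarrow> a \<le> b \<Longrightarrow> b \<le> H \<Longrightarrow> i \<in> S \<Longrightarrow> (\<Sum>k\<in>S. \<bar>p a b i k\<bar>) \<le> 1 + D * (b - a)"
    "\<And>a b i. 0 \<le> a \<Longrightarrow> a \<le> b \<Longrightarrow> b \<le> H \<Longrightarrow> i \<in> S \<Longrightarrow> (\<Sum>k\<in>S - {i}. \<bar>p a b i k\<bar>) \<le> D * (b - a)"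
proof -
  obtain C where C: "C \<ge> 0"
    "\<And>a x i k. 0 \<le> a \<Longrightarrow> a \<le> x \<Longrightarrow> x \<le> H \<Longrightarrow> i \<in> S \<Longrightarrow> k \<in> S \<Longrightarrow> \<bar>p a x i k - of_bool (i = k)\<bar> \<le> C * (x - a)"
    by (rule fund_sol_near_id[of S A p H, OF A p]; blast)
  show ?thesis
  proof (rule that)
    show "real (card S) * C \<ge> 0" using C by simp
    fix a b i assume *: "0 \<le> a" "a \<le> b" "b \<le> H" "i \<in> S"
    have "(\<Sum>k\<in>S. \<bar>p a b i k - of_bool (i = k)\<bar>) \<le> (\<Sum>k\<in>S. C * (b - a))"
      using * C by (intro sum_mono) auto
    then have le: "(\<Sum>k\<in>S. \<bar>p a b i k - of_bool (i = k)\<bar>) \<le> real (card S) * C * (b - a)" by simp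
    have "(\<Sum>k\<in>S. \<bar>p a b i k\<bar>) \<le> (\<Sum>k\<in>S. of_bool (i = k) + \<bar>p a b i k - of_bool (i = k)\<bar>)"
      by (intro sum_mono) auto
    also have "\<dots> = 1 + (\<Sum>k\<in>S. \<bar>p a b i k - of_bool (i = k)\<bar>)"
      using fin * by (simp add: sum.distrib)
    finally show "(\<Sum>k\<in>S. \<bar>p a b i k\<bar>) \<le> 1 + real (card S) * C * (b - a)"
      using le by linarith
    have "(\<Sum>k\<in>S - {i}. \<bar>p a b i k\<bar>) = (\<Sum>k\<in>S - {i}. \<bar>p a b i k - of_bool (i = k)\<bar>)"
      by (intro sum.cong) auto
    also have "\<dots> \<le> (\<Sum>k\<in>S. \<bar>p a b i k - of_bool (i = k)\<bar>)"
      using fin by (intro sum_mono2) auto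
    finally show "(\<Sum>k\<in>S - {i}. \<bar>p a b i k\<bar>) \<le> real (card S) * C * (b - a)"
      using le by linarith
  qed
qed

text \<open>The old error is propagated with factor 1 + O(h), harmless over a whole grid, and
  replacing \<open>p\<close> by \<open>q\<close> costs O(h^2) by the diagonal block estimate. The
  support condition removes all entries between different classes.\<close>

lemma step_error_diag:
  obtains D where "D \<ge> 0"
    "\<And>a b x v y. 0 \<le> a \<Longrightarrow> a \<le> b \<Longrightarrow> b \<le> H \<Longrightarrow> (\<And>i. i \<in> S \<Longrightarrow> cl i \<noteq> y \<Longrightarrow> x i = 0 \<and> v i = 0) \<Longrightarrow>
      (\<Sum>k\<in>S. \<bar>of_bool (cl k = y) * (\<Sum>i\<in>S. x i * p a b i k) - (\<Sum>i\<in>S. v i * q a b i k)\<bar>)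
      \<le> (1 + D * (b - a)) * (\<Sum>i\<in>S. \<bar>x i - v i\<bar>) + D * (b - a)\<^sup>2 * (\<Sum>i\<in>S. \<bar>v i\<bar>)"
proof -
  obtain C where C: "C \<ge> 0"
    "\<And>a b i k. 0 \<le> a \<Longrightarrow> a \<le> b \<Longrightarrow> b \<le> H \<Longrightarrow> i \<in> S \<Longrightarrow> k \<in> S \<Longrightarrow> cl i = cl k \<Longrightarrow>
       \<bar>p a b i k - q a b i k\<bar> \<le> C * (b - a)\<^sup>2"
    by (rule diag_block_error[of H]; blast)
  obtain D where D: "D \<ge> 0"
    "\<And>a b i. 0 \<le> a \<Longrightarrow> a \<le> b \<Longrightarrow> b \<le> H \<Longrightarrow> i \<in> S \<Longrightarrow> (\<Sum>k\<in>S. \<bar>p a b i k\<bar>) \<le> 1 + D * (b - a)"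
    by (rule p_row_sum_bound[of H]; blast)
  define E where "E = D + real (card S) * C"
  show ?thesis
  proof (rule that)
    show E0: "E \<ge> 0" using C D by (simp add: E_def)
    fix a b :: real and x v :: "'i \<Rightarrow> real" and y assume *: "0 \<le> a" "a \<le> b" "b \<le> H"
      and supp: "\<And>i. i \<in> S \<Longrightarrow> cl i \<noteq> y \<Longrightarrow> x i = 0 \<and> v i = 0"
    have "\<bar>of_bool (cl k = y) * (\<Sum>i\<in>S. x i * p a b i k) - (\<Sum>i\<in>S. v i * q a b i k)\<bar>
      \<le> (\<Sum>i\<in>S. \<bar>x i - v i\<bar> * \<bar>p a b i k\<bar> + C * (b - a)\<^sup>2 * \<bar>v i\<bar>)" if k: "k \<in> S" for k
    proof (cases "cl k = y")
      case True
      have eq: "of_bool (cl k = y) * (\<Sum>i\<in>S. x i * p a b i k) - (\<Sum>i\<in>S. v i * q a b i k)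
        = (\<Sum>i\<in>S. (x i - v i) * p a b i k + (p a b i k - q a b i k) * v i)"
        using True by (simp add: sum_subtractf[symmetric] algebra_simps)
      have "\<bar>\<Sum>i\<in>S. (x i - v i) * p a b i k + (p a b i k - q a b i k) * v i\<bar> \<le> (\<Sum>i\<in>S. \<bar>x i - v i\<bar> * \<bar>p a b i k\<bar> + C * (b - a)\<^sup>2 * \<bar>v i\<bar>)"
      proof (intro order_trans[OF sum_abs] sum_mono order_trans[OF abs_triangle_ineq] add_mono)
        fix i assume i: "i \<in> S"
        show "\<bar>(p a b i k - q a b i k) * v i\<bar> \<le> C * (b - a)\<^sup>2 * \<bar>v i\<bar>"
        proof (cases "cl i = y")
          case True
          then show ?thesis using C(2)[OF * i k] \<open>cl k = y\<close> by (intro abs_mult_le) auto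
        qed (use supp i in simp)
      qed (simp add: abs_mult)
      then show ?thesis by (simp only: eq)
    next
      case False
      have "v i * q a b i k = 0" if i: "i \<in> S" for i
      proof (cases "cl i = y")
        case True
        with False have "cl i \<noteq> cl k" by simp
        then show ?thesis using q_off_diag[OF *(1,2) i k] by simp
      qed (use supp[OF i] in simp)
      then have "of_bool (cl k = y) * (\<Sum>i\<in>S. x i * p a b i k) - (\<Sum>i\<in>S. v i * q a b i k) = 0"
        using False sum.neutral[of S "\<lambda>i. v i * q a b i k"] by simp
      moreover have "0 \<le> (\<Sum>i\<in>S. \<bar>x i - v i\<bar> * \<bar>p a b i k\<bar> + C * (b - a)\<^sup>2 * \<bar>v i\<bar>)"
        using C(1) by (intro sum_nonneg add_nonneg_nonneg mult_nonneg_nonneg) auto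
      ultimately show ?thesis by simp
    qed
    then have "(\<Sum>k\<in>S. \<bar>of_bool (cl k = y) * (\<Sum>i\<in>S. x i * p a b i k) - (\<Sum>i\<in>S. v i * q a b i k)\<bar>)
      \<le> (\<Sum>k\<in>S. \<Sum>i\<in>S. \<bar>x i - v i\<bar> * \<bar>p a b i k\<bar> + C * (b - a)\<^sup>2 * \<bar>v i\<bar>)"
      by (intro sum_mono)
    also have "\<dots> = (\<Sum>i\<in>S. \<bar>x i - v i\<bar> * (\<Sum>k\<in>S. \<bar>p a b i k\<bar>)) + real (card S) * C * (b - a)\<^sup>2 * (\<Sum>i\<in>S. \<bar>v i\<bar>)"
      by (simp only: sum.distrib, subst sum.swap) (simp add: sum_distrib_left mult.assoc)
    also have "\<dots> \<le> (\<Sum>i\<in>S. \<bar>x i - v i\<bar> * (1 + E * (b - a))) + E * (b - a)\<^sup>2 * (\<Sum>i\<in>S. \<bar>v i\<bar>)"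
    proof (intro add_mono sum_mono mult_left_mono mult_right_mono)
      fix i assume i: "i \<in> S"
      have "D * (b - a) \<le> E * (b - a)" using * C by (intro mult_right_mono) (auto simp: E_def)
      then show "(\<Sum>k\<in>S. \<bar>p a b i k\<bar>) \<le> 1 + E * (b - a)" using D(2)[OF * i] by linarith
    qed (use C D in \<open>auto simp: E_def intro: sum_nonneg\<close>)
    finally show "(\<Sum>k\<in>S. \<bar>of_bool (cl k = y) * (\<Sum>i\<in>S. x i * p a b i k) - (\<Sum>i\<in>S. v i * q a b i k)\<bar>)
      \<le> (1 + E * (b - a)) * (\<Sum>i\<in>S. \<bar>x i - v i\<bar>) + E * (b - a)\<^sup>2 * (\<Sum>i\<in>S. \<bar>v i\<bar>)"
      by (simp add: sum_distrib_right[symmetric] mult.commute)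
  qed
qed

text \<open>After division by the step width the old error is multiplied by a constant, since only
  off-diagonal entries, of order h, take part. \<open>D\<close> is fixed before \<epsilon>, so that
  \<epsilon> can later be chosen in terms of \<open>D\<close>, and \<delta> is uniform in the
  vectors.\<close>

lemma step_error_jump:
  obtains D where "D \<ge> 0"
    "\<And>\<epsilon>. \<epsilon> > 0 \<Longrightarrow> \<exists>\<delta>>0. \<forall>a T b x v y y'. 0 \<le> a \<longrightarrow> a \<le> T \<longrightarrow> T \<le> b \<longrightarrow> a < b \<longrightarrow> b \<le> H \<longrightarrow> b - a < \<delta> \<longrightarrow> y \<noteq> y' \<longrightarrow>
      (\<forall>i\<in>S. cl i \<noteq> y \<longrightarrow> x i = 0 \<and> v i = 0) \<longrightarrow>
      (\<Sum>k\<in>S. \<bar>of_bool (cl k = y') * (\<Sum>i\<in>S. x i * p a b i k) / (b - a) - of_bool (cl k = y') * (\<Sum>i\<in>S. v i * jump_kernel a T b i k)\<bar>)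
      \<le> D * (\<Sum>i\<in>S. \<bar>x i - v i\<bar>) + D * \<epsilon> * (\<Sum>i\<in>S. \<bar>v i\<bar>)"
proof -
  obtain D where D: "D \<ge> 0"
    "\<And>a b i. 0 \<le> a \<Longrightarrow> a \<le> b \<Longrightarrow> b \<le> H \<Longrightarrow> i \<in> S \<Longrightarrow> (\<Sum>k\<in>S - {i}. \<bar>p a b i k\<bar>) \<le> D * (b - a)"
    by (rule p_row_sum_bound[of H]; blast)
  define E where "E = D + real (card S)"
  show ?thesis
  proof (rule that)
    show E0: "E \<ge> 0" using D by (simp add: E_def)
    fix \<epsilon> :: real assume \<epsilon>: "\<epsilon> > 0"
    obtain \<delta> where \<delta>: "\<delta> > 0"
      "\<And>a T b i k. 0 \<le> a \<Longrightarrow> a \<le> T \<Longrightarrow> T \<le> b \<Longrightarrow> a < b \<Longrightarrow> b \<le> H \<Longrightarrow> b - a < \<delta> \<Longrightarrow> i \<in> S \<Longrightarrow> k \<in> S \<Longrightarrow> i \<noteq> k \<Longrightarrow>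
         \<bar>p a b i k / (b - a) - jump_kernel a T b i k\<bar> \<le> \<epsilon>"
      by (rule jump_kernel_limit[OF \<epsilon>, of H]; blast)
    show "\<exists>\<delta>>0. \<forall>a T b x v y y'. 0 \<le> a \<longrightarrow> a \<le> T \<longrightarrow> T \<le> b \<longrightarrow> a < b \<longrightarrow> b \<le> H \<longrightarrow> b - a < \<delta> \<longrightarrow> y \<noteq> y' \<longrightarrow>
      (\<forall>i\<in>S. cl i \<noteq> y \<longrightarrow> x i = 0 \<and> v i = 0) \<longrightarrow>
      (\<Sum>k\<in>S. \<bar>of_bool (cl k = y') * (\<Sum>i\<in>S. x i * p a b i k) / (b - a) - of_bool (cl k = y') * (\<Sum>i\<in>S. v i * jump_kernel a T b i k)\<bar>)
      \<le> E * (\<Sum>i\<in>S. \<bar>x i - v i\<bar>) + E * \<epsilon> * (\<Sum>i\<in>S. \<bar>v i\<bar>)"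
    proof (intro exI[of _ \<delta>] conjI allI impI \<delta>(1))
      fix a T b :: real and x v :: "'i \<Rightarrow> real" and y y' :: nat
      assume *: "0 \<le> a" "a \<le> T" "T \<le> b" "a < b" "b \<le> H" "b - a < \<delta>" and y: "y \<noteq> y'"
        and supp: "\<forall>i\<in>S. cl i \<noteq> y \<longrightarrow> x i = 0 \<and> v i = 0"
      have ab: "a \<le> b" using * by simp
      let ?h = "\<lambda>i k. of_bool (i \<noteq> k) * \<bar>p a b i k\<bar> / (b - a)"
      have "\<bar>of_bool (cl k = y') * (\<Sum>i\<in>S. x i * p a b i k) / (b - a) - of_bool (cl k = y') * (\<Sum>i\<in>S. v i * jump_kernel a T b i k)\<bar>
        \<le> (\<Sum>i\<in>S. \<bar>x i - v i\<bar> * ?h i k + \<epsilon> * \<bar>v i\<bar>)" if k: "k \<in> S" for k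
      proof (cases "cl k = y'")
        case True
        have eq: "of_bool (cl k = y') * (\<Sum>i\<in>S. x i * p a b i k) / (b - a) - of_bool (cl k = y') * (\<Sum>i\<in>S. v i * jump_kernel a T b i k)
          = (\<Sum>i\<in>S. (x i - v i) * (p a b i k / (b - a)) + (p a b i k / (b - a) - jump_kernel a T b i k) * v i)"
          using True by (simp add: sum_subtractf[symmetric] sum_divide_distrib)
            (intro sum.cong refl, simp add: diff_divide_distrib algebra_simps)
        have "\<bar>\<Sum>i\<in>S. (x i - v i) * (p a b i k / (b - a)) + (p a b i k / (b - a) - jump_kernel a T b i k) * v i\<bar> \<le> (\<Sum>i\<in>S. \<bar>x i - v i\<bar> * ?h i k + \<epsilon> * \<bar>v i\<bar>)"
        proof (intro order_trans[OF sum_abs] sum_mono order_trans[OF abs_triangle_ineq] add_mono)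
          fix i assume i: "i \<in> S"
          show "\<bar>(x i - v i) * (p a b i k / (b - a))\<bar> \<le> \<bar>x i - v i\<bar> * ?h i k"
            using supp i True y ab by (cases "cl i = y") (auto simp: abs_mult abs_divide)
          show "\<bar>(p a b i k / (b - a) - jump_kernel a T b i k) * v i\<bar> \<le> \<epsilon> * \<bar>v i\<bar>"
          proof (cases "cl i = y")
            case cli: True
            with True y have "i \<noteq> k" by auto
            then show ?thesis using \<delta>(2)[OF * i k] by (intro abs_mult_le) auto
          qed (use supp i in simp)
        qed
        then show ?thesis by (simp only: eq)
      next
        case False
        have "0 \<le> (\<Sum>i\<in>S. \<bar>x i - v i\<bar> * ?h i k + \<epsilon> * \<bar>v i\<bar>)"
          using \<epsilon> ab by (intro sum_nonneg add_nonneg_nonneg mult_nonneg_nonneg divide_nonneg_nonneg) auto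
        then show ?thesis using False by simp
      qed
      then have "(\<Sum>k\<in>S. \<bar>of_bool (cl k = y') * (\<Sum>i\<in>S. x i * p a b i k) / (b - a) - of_bool (cl k = y') * (\<Sum>i\<in>S. v i * jump_kernel a T b i k)\<bar>)
        \<le> (\<Sum>k\<in>S. \<Sum>i\<in>S. \<bar>x i - v i\<bar> * ?h i k + \<epsilon> * \<bar>v i\<bar>)"
        by (intro sum_mono)
      also have "\<dots> = (\<Sum>i\<in>S. \<bar>x i - v i\<bar> * (\<Sum>k\<in>S. ?h i k)) + real (card S) * \<epsilon> * (\<Sum>i\<in>S. \<bar>v i\<bar>)"
        by (simp only: sum.distrib, subst sum.swap) (simp add: sum_distrib_left mult.assoc)
      also have "\<dots> \<le> (\<Sum>i\<in>S. \<bar>x i - v i\<bar> * E) + E * \<epsilon> * (\<Sum>i\<in>S. \<bar>v i\<bar>)"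
      proof (intro add_mono sum_mono mult_left_mono mult_right_mono)
        fix i assume i: "i \<in> S"
        have "(\<Sum>k\<in>S. ?h i k) = (\<Sum>k\<in>S - {i}. \<bar>p a b i k\<bar>) / (b - a)"
          using fin i by (auto simp: sum.remove[of S i] sum_divide_distrib intro!: sum.cong)
        also have "\<dots> \<le> D" using D(2)[OF *(1) ab *(5) i] * by (simp add: pos_divide_le_eq)
        finally show "(\<Sum>k\<in>S. ?h i k) \<le> E" by (simp add: E_def)
      qed (use D \<epsilon> in \<open>auto simp: E_def intro: sum_nonneg\<close>)
      finally show "(\<Sum>k\<in>S. \<bar>of_bool (cl k = y') * (\<Sum>i\<in>S. x i * p a b i k) / (b - a) - of_bool (cl k = y') * (\<Sum>i\<in>S. v i * jump_kernel a T b i k)\<bar>)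
        \<le> E * (\<Sum>i\<in>S. \<bar>x i - v i\<bar>) + E * \<epsilon> * (\<Sum>i\<in>S. \<bar>v i\<bar>)"
        by (simp only: sum_distrib_left mult.commute[of _ E])
    qed
  qed
qed

end

text \<open>There are \<open>Suc N\<close> steps, so the mesh is defined for every
  \<open>N\<close>.\<close>

definition unif_grid :: "real \<Rightarrow> real \<Rightarrow> nat \<Rightarrow> nat \<Rightarrow> real" where
  "unif_grid a b N l = a + real l * ((b - a) / real (Suc N))"

text \<open>Recursive rather than a power of \<open>h\<close> with a counted exponent, to match the
  forward recursion step by step.\<close>

primrec change_scale :: "real \<Rightarrow> (nat \<Rightarrow> nat) \<Rightarrow> nat \<Rightarrow> real" where
  "change_scale h w 0 = 1"
| "change_scale h w (Suc l) = change_scale h w l * (if w l = w (Suc l) then 1 else h)"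

lemma unif_grid_0 [simp]: "unif_grid a b N 0 = a"
  by (simp add: unif_grid_def)

lemma unif_grid_end [simp]: "unif_grid a b N (Suc N) = b"
  by (simp add: unif_grid_def del: of_nat_Suc)

lemma unif_grid_step: "unif_grid a b N (Suc l) - unif_grid a b N l = (b - a) / real (Suc N)"
  by (simp add: unif_grid_def field_simps del: of_nat_Suc) (simp add: algebra_simps)

lemma unif_grid_mono: "a \<le> b \<Longrightarrow> l \<le> m \<Longrightarrow> unif_grid a b N l \<le> unif_grid a b N m"
  unfolding unif_grid_def by (intro add_left_mono mult_right_mono) auto

lemma unif_grid_bounds: "a \<le> b \<Longrightarrow> l \<le> Suc N \<Longrightarrow> unif_grid a b N l \<in> {a..b}"
  using unif_grid_mono[of a b 0 l N] unif_grid_mono[of a b l "Suc N" N] by simp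

context block_kernel
begin

text \<open>The counter \<open>\<nu>\<close> stands for the number of macro jumps up to a time point. Bounding the error by
  \<open>(1 + D h)^l D^\<nu> (\<dots>)\<close> makes the amplification at the (boundedly many) jumps harmless.\<close>

lemma fwd_scaled_limit:
  fixes V :: "real \<Rightarrow> 'i \<Rightarrow> real" and z \<nu> :: "real \<Rightarrow> nat"
  assumes ab: "0 \<le> a0" "a0 \<le> b0"
    and supp: "\<And>u k. u \<in> {a0..b0} \<Longrightarrow> k \<in> S \<Longrightarrow> cl k \<noteq> z u \<Longrightarrow> V u k = 0"
    and bound: "\<And>u. u \<in> {a0..b0} \<Longrightarrow> (\<Sum>k\<in>S. \<bar>V u k\<bar>) \<le> B"
    and mono: "\<And>a b. a0 \<le> a \<Longrightarrow> a \<le> b \<Longrightarrow> b \<le> b0 \<Longrightarrow> \<nu> a \<le> \<nu> b"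
    and gap: "\<gamma> > 0" "\<And>a b. a0 \<le> a \<Longrightarrow> a \<le> b \<Longrightarrow> b \<le> b0 \<Longrightarrow> b - a < \<gamma> \<Longrightarrow> \<nu> b \<le> Suc (\<nu> a)"
    and nojump: "\<And>a b. a0 \<le> a \<Longrightarrow> a \<le> b \<Longrightarrow> b \<le> b0 \<Longrightarrow> \<nu> a = \<nu> b \<Longrightarrow>
       z a = z b \<and> (\<forall>k\<in>S. V b k = (\<Sum>i\<in>S. V a i * q a b i k))"
    and jump: "\<And>a b. a0 \<le> a \<Longrightarrow> a \<le> b \<Longrightarrow> b \<le> b0 \<Longrightarrow> \<nu> b = Suc (\<nu> a) \<Longrightarrow>
       z a \<noteq> z b \<and> (\<exists>T\<in>{a..b}. \<forall>k\<in>S. cl k = z b \<longrightarrow> V b k = (\<Sum>i\<in>S. V a i * jump_kernel a T b i k))"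
    and k: "k \<in> S"
  shows "(\<lambda>N. fwd (unif_grid a0 b0 N) (\<lambda>l. {k. cl k = z (unif_grid a0 b0 N l)}) (V a0) (Suc N) k
            / change_scale ((b0 - a0) / real (Suc N)) (\<lambda>l. z (unif_grid a0 b0 N l)) (Suc N)) \<longlonglongrightarrow> V b0 k"
proof -
  obtain D1 where D1: "D1 \<ge> 0"
    "\<And>a b x v y. 0 \<le> a \<Longrightarrow> a \<le> b \<Longrightarrow> b \<le> b0 \<Longrightarrow> (\<And>i. i \<in> S \<Longrightarrow> cl i \<noteq> y \<Longrightarrow> x i = 0 \<and> v i = 0) \<Longrightarrow>
      (\<Sum>k\<in>S. \<bar>of_bool (cl k = y) * (\<Sum>i\<in>S. x i * p a b i k) - (\<Sum>i\<in>S. v i * q a b i k)\<bar>)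
      \<le> (1 + D1 * (b - a)) * (\<Sum>i\<in>S. \<bar>x i - v i\<bar>) + D1 * (b - a)\<^sup>2 * (\<Sum>i\<in>S. \<bar>v i\<bar>)"
    by (rule step_error_diag[of b0]; blast)
  obtain D2 where D2: "D2 \<ge> 0"
    "\<And>\<epsilon>. \<epsilon> > 0 \<Longrightarrow> \<exists>\<delta>>0. \<forall>a T b x v y y'. 0 \<le> a \<longrightarrow> a \<le> T \<longrightarrow> T \<le> b \<longrightarrow> a < b \<longrightarrow> b \<le> b0 \<longrightarrow> b - a < \<delta> \<longrightarrow> y \<noteq> y' \<longrightarrow>
      (\<forall>i\<in>S. cl i \<noteq> y \<longrightarrow> x i = 0 \<and> v i = 0) \<longrightarrow>
      (\<Sum>k\<in>S. \<bar>of_bool (cl k = y') * (\<Sum>i\<in>S. x i * p a b i k) / (b - a) - of_bool (cl k = y') * (\<Sum>i\<in>S. v i * jump_kernel a T b i k)\<bar>)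
      \<le> D2 * (\<Sum>i\<in>S. \<bar>x i - v i\<bar>) + D2 * \<epsilon> * (\<Sum>i\<in>S. \<bar>v i\<bar>)"
    by (rule step_error_jump[of b0]; blast)
  have B0: "B \<ge> 0" using bound[of a0] ab by (auto intro: order_trans[OF sum_nonneg])
  \<comment> \<open>One constant for both step estimates, at least 1 so that its powers never shrink
    an accumulated error.\<close>
  define D where "D = 1 + D1 * (1 + B) + D2 * (1 + B)"
  have D: "D \<ge> 1" "D1 \<le> D" "D1 * B \<le> D" "D2 \<le> D" "D2 * B \<le> D"
    using D1(1) D2(1) B0 by (auto simp: D_def distrib_left)
  define h where "h N = (b0 - a0) / real (Suc N)" for N
  have h0: "h N \<ge> 0" for N using ab by (simp add: h_def)
  define u where "u N = unif_grid a0 b0 N" for N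
  define x where "x N l k = fwd (u N) (\<lambda>l. {k. cl k = z (u N l)}) (V a0) l k / change_scale (h N) (\<lambda>l. z (u N l)) l" for N l k
  define e where "e N l = (\<Sum>k\<in>S. \<bar>x N l k - V (u N l) k\<bar>)" for N l
  have u_in: "u N l \<in> {a0..b0}" if "l \<le> Suc N" for N l
    using unif_grid_bounds ab that by (simp add: u_def)
  have u_step: "u N (Suc l) - u N l = h N" for N l by (simp add: u_def h_def unif_grid_step)
  have x_supp: "x N l i = 0" if "cl i \<noteq> z (u N l)" for N l i
    using that by (simp add: x_def fwd_supp)
  have x_Suc: "x N (Suc l) k = of_bool (cl k = z (u N (Suc l))) * (\<Sum>i\<in>S. x N l i * p (u N l) (u N (Suc l)) i k)
      / (if z (u N l) = z (u N (Suc l)) then 1 else h N)" for N l k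
    by (simp add: x_def sum_divide_distrib)
  have diag: "e N (Suc l) \<le> (1 + D * h N) * e N l + D * (h N)\<^sup>2"
    if l: "Suc l \<le> Suc N" and eq: "\<nu> (u N (Suc l)) = \<nu> (u N l)" for N l
  proof -
    have a: "a0 \<le> u N l" "u N l \<le> u N (Suc l)" "u N (Suc l) \<le> b0"
      using u_in[of l N] u_in[of "Suc l" N] u_step[of N l] h0[of N] l by auto
    have zz: "z (u N l) = z (u N (Suc l))" and V: "\<And>k. k \<in> S \<Longrightarrow> V (u N (Suc l)) k = (\<Sum>i\<in>S. V (u N l) i * q (u N l) (u N (Suc l)) i k)"
      using nojump[OF a] eq by auto
    have "e N (Suc l) = (\<Sum>k\<in>S. \<bar>of_bool (cl k = z (u N l)) * (\<Sum>i\<in>S. x N l i * p (u N l) (u N (Suc l)) i k)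
        - (\<Sum>i\<in>S. V (u N l) i * q (u N l) (u N (Suc l)) i k)\<bar>)"
      unfolding e_def x_Suc using zz V by (intro sum.cong) auto
    also have "\<dots> \<le> (1 + D1 * (u N (Suc l) - u N l)) * e N l + D1 * (u N (Suc l) - u N l)\<^sup>2 * (\<Sum>i\<in>S. \<bar>V (u N l) i\<bar>)"
      unfolding e_def by (rule D1(2)) (use a ab l supp x_supp u_in[of l N] in auto)
    also have "\<dots> \<le> (1 + D * h N) * e N l + D1 * (h N)\<^sup>2 * B"
      unfolding u_step using D h0[of N] D1(1) bound[OF u_in[of l N]] l
      by (intro add_mono mult_right_mono mult_left_mono) (auto simp: e_def intro: sum_nonneg)
    also have "D1 * (h N)\<^sup>2 * B \<le> D * (h N)\<^sup>2"
      using mult_right_mono[OF D(3), of "(h N)\<^sup>2"] by (simp add: ac_simps)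
    finally show ?thesis by simp
  qed
  have "(\<lambda>N. e N (Suc N)) \<longlonglongrightarrow> 0"
  proof (rule LIMSEQ_I)
    fix r :: real assume r: "0 < r"
    \<comment> \<open>\<open>G\<close> bounds the total amplification: the ordinary steps contribute
      the exponential, each jump one factor \<open>D\<close>. The accumulated local errors will be
      at most \<epsilon> (1 + \<nu> D), and \<epsilon> is chosen to make \<open>G\<close> times this
      equal to r/2.\<close>
    define G where "G = exp (D * (b0 - a0)) * D ^ \<nu> b0"
    have G: "G > 0" using D by (simp add: G_def)
    define \<epsilon> where "\<epsilon> = r / (2 * G * (1 + real (\<nu> b0) * D))"
    have den: "2 * G * (1 + real (\<nu> b0) * D) > 0" using G D by (intro mult_pos_pos add_pos_nonneg) auto
    then have \<epsilon>: "\<epsilon> > 0" using r by (simp add: \<epsilon>_def)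
    obtain \<delta> where \<delta>: "\<delta> > 0" "\<And>a T b x v y y'. 0 \<le> a \<Longrightarrow> a \<le> T \<Longrightarrow> T \<le> b \<Longrightarrow> a < b \<Longrightarrow> b \<le> b0 \<Longrightarrow> b - a < \<delta> \<Longrightarrow> y \<noteq> y' \<Longrightarrow>
      (\<forall>i\<in>S. cl i \<noteq> y \<longrightarrow> x i = 0 \<and> v i = 0) \<Longrightarrow>
      (\<Sum>k\<in>S. \<bar>of_bool (cl k = y') * (\<Sum>i\<in>S. x i * p a b i k) / (b - a) - of_bool (cl k = y') * (\<Sum>i\<in>S. v i * jump_kernel a T b i k)\<bar>)
      \<le> D2 * (\<Sum>i\<in>S. \<bar>x i - v i\<bar>) + D2 * \<epsilon> * (\<Sum>i\<in>S. \<bar>v i\<bar>)"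
      using D2(2)[OF \<epsilon>] by blast
    have hlim: "h \<longlonglongrightarrow> 0"
      unfolding h_def using LIMSEQ_Suc[OF lim_const_over_n[of "b0 - a0"]] by simp
    have ev: "\<forall>\<^sub>F N in sequentially. h N < min \<delta> \<gamma> \<and> D * (b0 - a0) * h N < \<epsilon>"
    proof (intro eventually_conj)
      show "\<forall>\<^sub>F N in sequentially. h N < min \<delta> \<gamma>" using hlim \<delta>(1) gap(1) by (intro order_tendstoD) auto
      have "(\<lambda>N. D * (b0 - a0) * h N) \<longlonglongrightarrow> D * (b0 - a0) * 0" by (intro tendsto_intros hlim)
      then show "\<forall>\<^sub>F N in sequentially. D * (b0 - a0) * h N < \<epsilon>" using \<epsilon> by (intro order_tendstoD) auto
    qed
    have "e N (Suc N) < r" if N: "h N < min \<delta> \<gamma>" "D * (b0 - a0) * h N < \<epsilon>" for N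
    proof -
      let ?c = "\<lambda>l. \<nu> (u N l)"
      have step: "e N (Suc l) \<le> (1 + D * h N) * e N l + D * (h N)\<^sup>2 \<and> ?c (Suc l) = ?c l
          \<or> e N (Suc l) \<le> D * e N l + D * \<epsilon> \<and> ?c (Suc l) = Suc (?c l)" if l: "l \<le> N" for l
      proof -
        have a: "a0 \<le> u N l" "u N l \<le> u N (Suc l)" "u N (Suc l) \<le> b0"
          using u_in[of l N] u_in[of "Suc l" N] u_step[of N l] h0[of N] l by auto
        have "?c l \<le> ?c (Suc l)" "?c (Suc l) \<le> Suc (?c l)"
          using mono[OF a] gap(2)[OF a] u_step[of N l] N by auto
        then consider "?c (Suc l) = ?c l" | "?c (Suc l) = Suc (?c l)" by linarith
        then show ?thesis
        proof cases
          case 1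
          then show ?thesis using diag[of l N] l by simp
        next
          case 2
          obtain T where T: "T \<in> {u N l..u N (Suc l)}" and zz: "z (u N l) \<noteq> z (u N (Suc l))"
            and V: "\<And>k. k \<in> S \<Longrightarrow> cl k = z (u N (Suc l)) \<Longrightarrow> V (u N (Suc l)) k = (\<Sum>i\<in>S. V (u N l) i * jump_kernel (u N l) T (u N (Suc l)) i k)"
            using jump[OF a 2] by blast
          \<comment> \<open>A step of length zero cannot change the class, so dividing by the step
            width is legitimate.\<close>
          have lt: "u N l < u N (Suc l)" using zz a(2) by (cases "u N l = u N (Suc l)") auto
          have V': "V (u N (Suc l)) k = of_bool (cl k = z (u N (Suc l))) * (\<Sum>i\<in>S. V (u N l) i * jump_kernel (u N l) T (u N (Suc l)) i k)"
            if "k \<in> S" for k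
            using V[OF that] supp[of "u N (Suc l)" k] that a by (cases "cl k = z (u N (Suc l))") auto
          have "e N (Suc l) = (\<Sum>k\<in>S. \<bar>of_bool (cl k = z (u N (Suc l))) * (\<Sum>i\<in>S. x N l i * p (u N l) (u N (Suc l)) i k) / (u N (Suc l) - u N l)
             - of_bool (cl k = z (u N (Suc l))) * (\<Sum>i\<in>S. V (u N l) i * jump_kernel (u N l) T (u N (Suc l)) i k)\<bar>)"
            unfolding e_def x_Suc u_step using zz V' by (intro sum.cong) auto
          also have "\<dots> \<le> D2 * e N l + D2 * \<epsilon> * (\<Sum>i\<in>S. \<bar>V (u N l) i\<bar>)"
            unfolding e_def
            by (rule \<delta>(2)[where y = "z (u N l)"]) (use a ab l supp x_supp u_in[of l N] T lt N u_step[of N l] zz in auto)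
          also have "\<dots> \<le> D * e N l + D2 * \<epsilon> * B"
            using D D2(1) bound[OF u_in[of l N]] l \<epsilon>
            by (intro add_mono mult_right_mono mult_left_mono) (auto simp: e_def intro: sum_nonneg)
          also have "D2 * \<epsilon> * B \<le> D * \<epsilon>"
            using mult_right_mono[OF D(5), of \<epsilon>] \<epsilon> by (simp add: ac_simps)
          finally show ?thesis using 2 by simp
        qed
      qed
      \<comment> \<open>Local errors before amplification: of order h^2 for each step and of order
        \<epsilon> for each unit of the counter.\<close>
      define R where "R l = real l * (D * (h N)\<^sup>2) + real (?c l) * (D * \<epsilon>)" for l
      have R0: "R l \<ge> 0" for l using D \<epsilon> by (simp add: R_def)
      have "e N l \<le> (1 + D * h N) ^ l * D ^ ?c l * R l" if "l \<le> Suc N" for l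
        using that
      proof (induction l)
        case 0
        have "e N 0 = 0"
          unfolding e_def x_def u_def using supp[of a0] ab by (intro sum.neutral) auto
        then show ?case using R0[of 0] D h0[of N] by simp
      next
        case (Suc l)
        define F where "F = (1 + D * h N) ^ l * D ^ ?c l"
        have 1: "1 + D * h N \<ge> 1" using D h0[of N] by simp
        have F: "F \<ge> 1" unfolding F_def using 1 D by (intro mult_ge1_I one_le_power) auto
        have IH: "e N l \<le> F * R l" using Suc by (simp add: F_def)
        from step[of l] Suc.prems consider
          (a) "e N (Suc l) \<le> (1 + D * h N) * e N l + D * (h N)\<^sup>2" "?c (Suc l) = ?c l"
          | (b) "e N (Suc l) \<le> D * e N l + D * \<epsilon>" "?c (Suc l) = Suc (?c l)" by auto
        then show ?case
        proof cases
          case a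
          have G1: "(1 + D * h N) * F \<ge> 1" using 1 F by (intro mult_ge1_I) auto
          have "e N (Suc l) \<le> (1 + D * h N) * (F * R l) + 1 * (D * (h N)\<^sup>2)"
            using a(1) mult_left_mono[OF IH, of "1 + D * h N"] 1 by linarith
          also have "1 * (D * (h N)\<^sup>2) \<le> ((1 + D * h N) * F) * (D * (h N)\<^sup>2)"
            using G1 D by (intro mult_right_mono) auto
          also have "(1 + D * h N) * (F * R l) + ((1 + D * h N) * F) * (D * (h N)\<^sup>2) = ((1 + D * h N) * F) * (R l + D * (h N)\<^sup>2)"
            by (simp add: algebra_simps)
          also have "R l + D * (h N)\<^sup>2 = R (Suc l)" using a(2) by (simp add: R_def algebra_simps)
          also have "(1 + D * h N) * F = (1 + D * h N) ^ Suc l * D ^ ?c (Suc l)" using a(2) by (simp add: F_def)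
          finally show ?thesis by simp
        next
          case b
          have G1: "D * F \<ge> 1" using D F by (intro mult_ge1_I) auto
          have "e N (Suc l) \<le> D * (F * R l) + 1 * (D * \<epsilon>)"
            using b(1) mult_left_mono[OF IH, of D] D by linarith
          also have "1 * (D * \<epsilon>) \<le> (D * F) * (D * \<epsilon>)"
            using G1 D \<epsilon> by (intro mult_right_mono) auto
          also have "D * (F * R l) + (D * F) * (D * \<epsilon>) = (D * F) * (R l + D * \<epsilon>)"
            by (simp add: algebra_simps)
          also have "\<dots> \<le> ((1 + D * h N) * (D * F)) * R (Suc l)"
          proof (rule mult_mono)
            show "D * F \<le> (1 + D * h N) * (D * F)" using 1 G1 mult_right_mono[OF 1, of "D * F"] by simp
            have "0 \<le> D * (h N)\<^sup>2" using D by simp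
            then show "R l + D * \<epsilon> \<le> R (Suc l)"
              unfolding R_def b(2) of_nat_Suc distrib_right by linarith
          qed (use R0 D F 1 \<epsilon> in auto)
          also have "(1 + D * h N) * (D * F) = (1 + D * h N) ^ Suc l * D ^ ?c (Suc l)" using b(2) by (simp add: F_def)
          finally show ?thesis by simp
        qed
      qed
      from this[of "Suc N"] have "e N (Suc N) \<le> (1 + D * h N) ^ Suc N * D ^ \<nu> b0 * R (Suc N)"
        by (simp add: u_def)
      also have "\<dots> \<le> G * R (Suc N)"
      proof -
        have "(1 + D * h N) ^ Suc N \<le> exp (D * h N) ^ Suc N"
          using D h0[of N] exp_ge_add_one_self[of "D * h N"] by (intro power_mono) auto
        also have "\<dots> = exp (real (Suc N) * (D * h N))" by (simp only: exp_of_nat_mult)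
        also have "real (Suc N) * (D * h N) = D * (b0 - a0)" by (simp add: h_def del: of_nat_Suc)
        finally show ?thesis unfolding G_def using D R0 by (intro mult_right_mono) auto
      qed
      also have "R (Suc N) = D * (b0 - a0) * h N + real (\<nu> b0) * D * \<epsilon>"
      proof -
        have "real (Suc N) * h N = b0 - a0" by (simp add: h_def del: of_nat_Suc)
        then have "real (Suc N) * (D * (h N)\<^sup>2) = D * (b0 - a0) * h N"
          by (metis mult.assoc mult.commute power2_eq_square)
        then show ?thesis by (simp add: R_def u_def)
      qed
      also have "G * (D * (b0 - a0) * h N + real (\<nu> b0) * D * \<epsilon>) \<le> G * (\<epsilon> + real (\<nu> b0) * D * \<epsilon>)"
        using N G by (intro mult_left_mono) auto
      also have "\<dots> = \<epsilon> * (2 * G * (1 + real (\<nu> b0) * D)) / 2" by (simp add: algebra_simps)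
      also have "\<dots> = r / 2"
        using den by (subst iffD1[OF nonzero_eq_divide_eq \<epsilon>_def]) linarith+
      also have "\<dots> < r" using r by simp
      finally show ?thesis .
    qed
    then have "\<forall>\<^sub>F N in sequentially. e N (Suc N) < r" by (intro eventually_mono[OF ev]) auto
    then show "\<exists>no. \<forall>N\<ge>no. norm (e N (Suc N) - 0) < r"
      by (auto simp: eventually_sequentially e_def sum_nonneg)
  qed
  moreover have le: "norm (x N (Suc N) k - V b0 k) \<le> e N (Suc N)" for N
  proof -
    have "u N (Suc N) = b0" by (simp add: u_def)
    then show ?thesis
      unfolding e_def using k fin member_le_sum[of k S "\<lambda>k. \<bar>x N (Suc N) k - V b0 k\<bar>"] by simp
  qed
  ultimately have "(\<lambda>N. x N (Suc N) k - V b0 k) \<longlonglongrightarrow> 0"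
    by (intro Lim_null_comparison[OF always_eventually[OF allI[OF le]]])
  then show ?thesis
    unfolding LIM_zero_iff x_def u_def h_def .
qed

end

section \<open>Jump times of step paths\<close>

text \<open>\<open>real_of_ereal\<close> sends an infinite jump time to 0, so the value is
  meaningful only where the jump time is known to be finite.\<close>

definition jtime :: "(real \<Rightarrow> 'b) \<Rightarrow> nat \<Rightarrow> real" where
  "jtime f n = real_of_ereal (jump_time f n)"

definition jump_count :: "(real \<Rightarrow> 'b) \<Rightarrow> real \<Rightarrow> nat" where
  "jump_count f t = (LEAST n. ereal t < jump_time f (Suc n))"

text \<open>Right-continuity is used twice: the constant stretch after \<open>r\<close> pushes the
  infimum strictly beyond \<open>r\<close>, and the one after the infimum forces the infimum to be
  attained, so the path really has a new value there.\<close>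

lemma jump_time_Suc_props:
  assumes f: "step_path f" and r: "jump_time f n = ereal r" "0 \<le> r"
  shows "jump_time f n < jump_time f (Suc n)"
    and "\<And>v. r \<le> v \<Longrightarrow> ereal v < jump_time f (Suc n) \<Longrightarrow> f v = f r"
    and "\<And>r'. jump_time f (Suc n) = ereal r' \<Longrightarrow> f r' \<noteq> f r"
proof -
  define U where "U = {u. u > r \<and> f u \<noteq> f r}"
  have bdd: "bdd_below U" by (intro bdd_belowI[of _ r]) (auto simp: U_def)
  obtain e where e: "e > 0" "\<And>v. v \<in> {r..<r+e} \<Longrightarrow> f v = f r"
    using f r(2) unfolding step_path_def by metis
  have ge: "r + e \<le> Inf U" if "U \<noteq> {}"
    using that
  proof (rule cInf_greatest)
    fix u assume "u \<in> U"
    then show "r + e \<le> u" using e(2)[of u] by (force simp: U_def)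
  qed
  have J: "jump_time f (Suc n) = (if U \<noteq> {} then ereal (Inf U) else \<infinity>)"
    using r by (auto simp: U_def)
  show "jump_time f n < jump_time f (Suc n)"
  proof (cases "U = {}")
    case False
    then have "r < Inf U" using ge e(1) by linarith
    then show ?thesis using J r False by simp
  qed (use J r in simp)
  show "f v = f r" if v: "r \<le> v" "ereal v < jump_time f (Suc n)" for v
  proof (rule ccontr)
    assume "f v \<noteq> f r"
    with v have "v \<in> U" by (cases "v = r") (auto simp: U_def)
    then have "Inf U \<le> v" "U \<noteq> {}" using bdd by (auto intro: cInf_lower)
    then show False using v J by simp
  qed
  show "f r' \<noteq> f r" if r': "jump_time f (Suc n) = ereal r'" for r'
  proof
    assume eq: "f r' = f r"
    have "(if U \<noteq> {} then ereal (Inf U) else \<infinity>) = ereal r'" unfolding J[symmetric] by (rule r')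
    then have ne: "U \<noteq> {}" and inf: "r' = Inf U" by (auto split: if_splits)
    have "r' \<ge> 0" using ge[OF ne] inf e(1) r(2) by simp
    then obtain e' where e': "e' > 0" "\<And>v. v \<in> {r'..<r'+e'} \<Longrightarrow> f v = f r'"
      using f unfolding step_path_def by metis
    obtain u where u: "u \<in> U" "u < r' + e'"
      using cInf_lessD[OF ne, of "r' + e'"] inf e'(1) by auto
    have "r' \<le> u" using u inf bdd by (auto intro: cInf_lower)
    then show False using e'(2)[of u] u eq by (auto simp: U_def)
  qed
qed

lemma jump_time_cases:
  assumes f: "step_path f"
  shows "jump_time f n = \<infinity> \<or> (jump_time f n = ereal (jtime f n) \<and> 0 \<le> jtime f n)"
proof (induction n)
  case 0
  then show ?case by (simp add: jtime_def zero_ereal_def)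
next
  case (Suc n)
  show ?case
  proof (cases "jump_time f n = \<infinity>")
    case False
    with Suc have r: "jump_time f n = ereal (jtime f n)" "0 \<le> jtime f n" by auto
    have "ereal (jtime f n) < jump_time f (Suc n)" using jump_time_Suc_props(1)[OF f r] r by simp
    then show ?thesis
      using r(2) unfolding jtime_def[of f "Suc n"]
      by (cases "jump_time f (Suc n)") (auto simp del: jump_time.simps)
  qed simp
qed

lemma jump_time_mono:
  assumes f: "step_path f" and "m \<le> n"
  shows "jump_time f m \<le> jump_time f n"
  using \<open>m \<le> n\<close>
proof (induction rule: dec_induct)
  case (step n)
  have "jump_time f n \<le> jump_time f (Suc n)"
    using jump_time_cases[OF f, of n] jump_time_Suc_props(1)[OF f, of n] by (cases "jump_time f n = \<infinity>") auto
  then show ?case using step by (meson order_trans)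
qed simp

text \<open>Links jump times with the finiteness clause of \<open>step_path\<close>, which counts
  two-sided discontinuities; the ingredient for excluding an accumulation of jumps.\<close>

lemma jump_time_discontinuity:
  assumes f: "step_path f" and r: "jump_time f (Suc n) = ereal r"
  shows "\<not> (\<exists>e>0. \<forall>v\<in>{r-e<..<r+e}. f v = f r)"
proof
  assume "\<exists>e>0. \<forall>v\<in>{r-e<..<r+e}. f v = f r"
  then obtain e where e: "e > 0" "\<And>v. v \<in> {r-e<..<r+e} \<Longrightarrow> f v = f r" by blast
  have "jump_time f n \<noteq> \<infinity>" using r by auto
  then have q: "jump_time f n = ereal (jtime f n)" "0 \<le> jtime f n" using jump_time_cases[OF f, of n] by auto
  have lt: "jtime f n < r" using jump_time_Suc_props(1)[OF f q] r q by (simp del: jump_time.simps)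
  define v where "v = max (jtime f n) (r - e / 2)"
  have "f v = f (jtime f n)"
    by (rule jump_time_Suc_props(2)[OF f q]) (use lt e(1) r in \<open>auto simp: v_def simp del: jump_time.simps\<close>)
  moreover have "f v = f r" using e lt by (intro e(2)) (auto simp: v_def)
  moreover have "f r \<noteq> f (jtime f n)" by (rule jump_time_Suc_props(3)[OF f q r])
  ultimately show False by simp
qed

lemma jump_time_finite_less:
  assumes f: "step_path f" and mn: "m < n" and fin: "jump_time f n \<noteq> \<infinity>"
  shows "jump_time f m < jump_time f n"
proof -
  have le: "jump_time f (Suc m) \<le> jump_time f n" using jump_time_mono[OF f, of "Suc m" n] mn by simp
  have "jump_time f m \<noteq> \<infinity>" using jump_time_mono[OF f, of m n] mn fin by auto
  then have "jump_time f m < jump_time f (Suc m)"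
    using jump_time_cases[OF f, of m] jump_time_Suc_props(1)[OF f, of m] by auto
  with le show ?thesis by (rule less_le_trans[rotated])
qed

text \<open>Non-explosion: otherwise infinitely many distinct discontinuities would lie in
  \<open>{0..t}\<close>. This gives the \<open>LEAST\<close> in \<open>jump_count\<close> its
  meaning.\<close>

lemma jump_time_exceeds:
  assumes f: "step_path f" and t: "0 \<le> t"
  shows "\<exists>n. ereal t < jump_time f (Suc n)"
proof (rule ccontr)
  assume "\<not> ?thesis"
  then have le: "jump_time f (Suc n) \<le> ereal t" for n by (meson not_le)
  have "jump_time f (Suc n) \<noteq> \<infinity>" for n
    using le[of n] by (metis ereal_infty_less_eq(1) PInfty_neq_ereal(1))
  then have J: "jump_time f (Suc n) = ereal (jtime f (Suc n))" "0 \<le> jtime f (Suc n)" for n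
    using jump_time_cases[OF f, of "Suc n"] by blast+
  let ?D = "{u\<in>{0..t}. \<not> (\<exists>e>0. \<forall>v\<in>{u-e<..<u+e}. f v = f u)}"
  have "finite ?D" using f by (simp add: step_path_def)
  moreover have "range (\<lambda>n. jtime f (Suc n)) \<subseteq> ?D"
    using jump_time_discontinuity[OF f J(1)] J le by (auto simp del: jump_time.simps)
  moreover have "inj (\<lambda>n. jtime f (Suc n))"
  proof (rule linorder_injI)
    fix m n :: nat assume "m < n"
    then have "jump_time f (Suc m) < jump_time f (Suc n)"
      using J(1) by (intro jump_time_finite_less[OF f]) (simp_all del: jump_time.simps)
    then show "jtime f (Suc m) \<noteq> jtime f (Suc n)" using J(1) by (simp del: jump_time.simps)
  qed
  ultimately show False
    using range_inj_infinite finite_subset by blast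
qed

lemma jump_count_bounds:
  assumes f: "step_path f" and t: "0 \<le> t"
  shows "jump_time f (jump_count f t) \<le> ereal t" "ereal t < jump_time f (Suc (jump_count f t))"
    "jump_time f (jump_count f t) = ereal (jtime f (jump_count f t))"
    "0 \<le> jtime f (jump_count f t)" "jtime f (jump_count f t) \<le> t"
proof -
  show 1: "ereal t < jump_time f (Suc (jump_count f t))"
    unfolding jump_count_def by (rule LeastI_ex[OF jump_time_exceeds[OF f t]])
  show 2: "jump_time f (jump_count f t) \<le> ereal t"
  proof (cases "jump_count f t")
    case 0
    then show ?thesis using t by (simp add: zero_ereal_def)
  next
    case (Suc n)
    then have "\<not> ereal t < jump_time f (Suc n)"
      using not_less_Least[of n "\<lambda>n. ereal t < jump_time f (Suc n)"] by (simp add: jump_count_def)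
    then show ?thesis using Suc by simp
  qed
  then show 3: "jump_time f (jump_count f t) = ereal (jtime f (jump_count f t))" "0 \<le> jtime f (jump_count f t)"
    using jump_time_cases[OF f, of "jump_count f t"] by auto
  show "jtime f (jump_count f t) \<le> t" using 2 3 by simp
qed

lemma jump_count_eqI:
  assumes f: "step_path f" and t: "jump_time f n \<le> ereal t" "ereal t < jump_time f (Suc n)"
  shows "jump_count f t = n"
  unfolding jump_count_def
proof (rule Least_equality)
  show "ereal t < jump_time f (Suc n)" by fact
  fix m assume "ereal t < jump_time f (Suc m)"
  with t(1) have "jump_time f n < jump_time f (Suc m)" by (rule le_less_trans)
  then show "n \<le> m" using jump_time_mono[OF f, of "Suc m" n] by (meson not_less not_less_eq_eq)
qed

lemma jump_count_mono:
  assumes f: "step_path f" and "0 \<le> s" "s \<le> t"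
  shows "jump_count f s \<le> jump_count f t"
proof -
  have "ereal s < jump_time f (Suc (jump_count f t))"
    using jump_count_bounds(2)[OF f, of t] assms by (meson ereal_less_eq(3) le_less_trans order_trans)
  then show ?thesis unfolding jump_count_def by (rule Least_le)
qed

lemma jump_count_value:
  assumes f: "step_path f" and t: "0 \<le> t"
  shows "f t = f (jtime f (jump_count f t))"
  by (rule jump_time_Suc_props(2)[OF f]) (use jump_count_bounds[OF f t] in auto)

lemma jtime_Suc_count:
  assumes f: "step_path f" and st: "0 \<le> s" "s \<le> t" and c: "jump_count f s < jump_count f t"
  defines "n \<equiv> jump_count f s"
  shows "jump_time f (Suc n) = ereal (jtime f (Suc n))" "s < jtime f (Suc n)" "jtime f (Suc n) \<le> t"
    "f (jtime f (Suc n)) \<noteq> f s"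
proof -
  have le: "jump_time f (Suc n) \<le> ereal t"
    using jump_time_mono[OF f, of "Suc n" "jump_count f t"] c jump_count_bounds(1)[OF f, of t] st
    by (auto simp: n_def Suc_le_eq simp del: jump_time.simps intro: order_trans)
  then show 1: "jump_time f (Suc n) = ereal (jtime f (Suc n))"
    using jump_time_cases[OF f, of "Suc n"] by (auto simp del: jump_time.simps)
  then show "jtime f (Suc n) \<le> t" using le by (simp del: jump_time.simps)
  show "s < jtime f (Suc n)" using jump_count_bounds(2)[OF f st(1)] 1 by (simp add: n_def del: jump_time.simps)
  have "f (jtime f (Suc n)) \<noteq> f (jtime f n)"
    using jump_count_bounds[OF f st(1)] 1 by (intro jump_time_Suc_props(3)[OF f]) (auto simp: n_def)
  then show "f (jtime f (Suc n)) \<noteq> f s" using jump_count_value[OF f st(1)] by (simp add: n_def)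
qed

text \<open>The finitely many jumps up to \<open>H\<close> have a positive minimal spacing, so each
  step of a fine grid contains at most one of them. These are the two cases covered by the step
  estimates.\<close>

lemma jump_count_gap:
  assumes f: "step_path f" and H: "0 \<le> H"
  obtains \<delta> where "\<delta> > 0"
    "\<And>a b. 0 \<le> a \<Longrightarrow> a \<le> b \<Longrightarrow> b \<le> H \<Longrightarrow> b - a < \<delta> \<Longrightarrow> jump_count f b \<le> Suc (jump_count f a)"
proof -
  \<comment> \<open>The inserted 1 keeps the minimum defined when no jump occurs up to
    \<open>H\<close>.\<close>
  let ?G = "insert 1 ((\<lambda>n. jtime f (Suc n) - jtime f n) ` {..<jump_count f H})"
  have fin: "jump_time f n = ereal (jtime f n)" if "n \<le> jump_count f H" for n
    using jump_time_mono[OF f that] jump_count_bounds(1)[OF f H] jump_time_cases[OF f, of n]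
    by (auto simp del: jump_time.simps)
  show ?thesis
  proof (rule that)
    have "jtime f n < jtime f (Suc n)" if "n < jump_count f H" for n
      using jump_time_finite_less[OF f, of n "Suc n"] fin[of n] fin[of "Suc n"] that by (simp del: jump_time.simps)
    then show "Min ?G > 0" by (subst Min_gr_iff) auto
    fix a b assume ab: "0 \<le> a" "a \<le> b" "b \<le> H" "b - a < Min ?G"
    show "jump_count f b \<le> Suc (jump_count f a)"
    proof (rule ccontr)
      let ?n = "Suc (jump_count f a)"
      assume "\<not> ?thesis"
      then have n: "Suc ?n \<le> jump_count f b" by simp
      have nH: "Suc ?n \<le> jump_count f H" using n jump_count_mono[OF f, of b H] ab by simp
      have "jump_time f (Suc ?n) \<le> ereal b"
        using jump_time_mono[OF f n] jump_count_bounds(1)[OF f, of b] ab by (auto intro: order_trans)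
      then have 1: "jtime f (Suc ?n) \<le> b" using fin[OF nH] by (simp del: jump_time.simps)
      have 2: "a < jtime f ?n" using jump_count_bounds(2)[OF f ab(1)] fin[of ?n] nH by (simp del: jump_time.simps)
      have "Min ?G \<le> jtime f (Suc ?n) - jtime f ?n" using nH by (intro Min_le) auto
      then show False using 1 2 ab by linarith
    qed
  qed
qed

lemma jtime_0 [simp]: "jtime z 0 = 0"
  by (simp add: jtime_def)

lemma jump_count_0: "step_path z \<Longrightarrow> jump_count z 0 = 0"
  using jump_time_Suc_props(1)[of z 0 0] by (intro jump_count_eqI) (auto simp: zero_ereal_def simp del: jump_time.simps(2))

section \<open>The unnormalised filter along a path\<close>

context block_kernel
begin

text \<open>The row vector \<alpha>(s_n) in state coordinates. It grows at the latest jump, unlike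
  \<open>alpha_aux\<close>, which consumes the jump list from its head.\<close>

primrec jump_state :: "('i \<Rightarrow> real) \<Rightarrow> (real \<Rightarrow> nat) \<Rightarrow> nat \<Rightarrow> 'i \<Rightarrow> real" where
  "jump_state x z 0 l = of_bool (cl l = z 0) * x l"
| "jump_state x z (Suc n) l = of_bool (cl l = z (jtime z (Suc n))) *
     (\<Sum>j\<in>S. (\<Sum>i\<in>S. jump_state x z n i * q (jtime z n) (jtime z (Suc n)) i j) * A (jtime z (Suc n)) j l)"

definition path_state :: "('i \<Rightarrow> real) \<Rightarrow> (real \<Rightarrow> nat) \<Rightarrow> real \<Rightarrow> 'i \<Rightarrow> real" where
  "path_state x z u k = (\<Sum>i\<in>S. jump_state x z (jump_count z u) i * q (jtime z (jump_count z u)) u i k)"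

lemma jump_state_supp: "cl l \<noteq> z (jtime z n) \<Longrightarrow> jump_state x z n l = 0"
  by (cases n) auto

lemma path_state_0:
  assumes z: "step_path z" and k: "k \<in> S"
  shows "path_state x z 0 k = of_bool (cl k = z 0) * x k"
  using k fin by (simp add: path_state_def jump_count_0[OF z] q_refl)

lemma path_state_supp:
  assumes z: "step_path z" and u: "0 \<le> u" and k: "k \<in> S" "cl k \<noteq> z u"
  shows "path_state x z u k = 0"
  unfolding path_state_def
proof (intro sum.neutral ballI)
  fix i assume i: "i \<in> S"
  show "jump_state x z (jump_count z u) i * q (jtime z (jump_count z u)) u i k = 0"
  proof (cases "cl i = z u")
    case True
    with k have "cl i \<noteq> cl k" by simp
    then show ?thesis using q_off_diag[OF _ _ i k(1)] jump_count_bounds[OF z u] by simp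
  next
    case False
    then show ?thesis using jump_state_supp[of i z] jump_count_value[OF z u] by simp
  qed
qed

lemma path_state_bound:
  assumes z: "step_path z" and H: "0 \<le> H"
  obtains B where "\<And>u. u \<in> {0..H} \<Longrightarrow> (\<Sum>k\<in>S. \<bar>path_state x z u k\<bar>) \<le> B"
proof -
  obtain C where C: "C \<ge> 0"
    "\<And>a x i k. 0 \<le> a \<Longrightarrow> a \<le> x \<Longrightarrow> x \<le> H \<Longrightarrow> i \<in> S \<Longrightarrow> k \<in> S \<Longrightarrow> \<bar>q a x i k - of_bool (i = k)\<bar> \<le> C * (x - a)"
    by (rule fund_sol_near_id[of S _ q H, OF A_diag q]; blast)
  have qb: "\<bar>q a u i k\<bar> \<le> 1 + C * H" if "0 \<le> a" "a \<le> u" "u \<le> H" "i \<in> S" "k \<in> S" for a u i k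
  proof -
    have "C * (u - a) \<le> C * H" using that C(1) by (intro mult_left_mono) auto
    then show ?thesis using C(2)[OF that] by (auto simp: of_bool_def split: if_splits)
  qed
  define w where "w n = (\<Sum>k\<in>S. \<Sum>i\<in>S. \<bar>jump_state x z n i\<bar> * (1 + C * H))" for n
  have w0: "w n \<ge> 0" for n unfolding w_def using C H by (intro sum_nonneg mult_nonneg_nonneg) auto
  show ?thesis
  proof (rule that)
    fix u assume u: "u \<in> {0..H}"
    let ?n = "jump_count z u"
    have "(\<Sum>k\<in>S. \<bar>path_state x z u k\<bar>) \<le> w ?n"
      unfolding path_state_def w_def
      using jump_count_bounds[OF z, of u] u
      by (intro sum_mono order_trans[OF sum_abs] abs_mult_le qb) auto
    also have "\<dots> \<le> (\<Sum>n\<le>jump_count z H. w n)"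
      using jump_count_mono[OF z, of u H] u w0 by (intro member_le_sum) auto
    finally show "(\<Sum>k\<in>S. \<bar>path_state x z u k\<bar>) \<le> (\<Sum>n\<le>jump_count z H. w n)" .
  qed
qed

lemma path_state_diag:
  assumes z: "step_path z" and ab: "0 \<le> a" "a \<le> b" and eq: "jump_count z a = jump_count z b" and k: "k \<in> S"
  shows "path_state x z b k = (\<Sum>i\<in>S. path_state x z a i * q a b i k)"
proof -
  let ?n = "jump_count z b"
  have "path_state x z b k = (\<Sum>i\<in>S. jump_state x z ?n i * (\<Sum>c\<in>S. q (jtime z ?n) a i c * q a b c k))"
    unfolding path_state_def using jump_count_bounds[OF z ab(1)] ab eq k
    by (intro sum.cong refl arg_cong2[of _ _ _ _ "(*)"] q_semigroup) auto
  also have "\<dots> = (\<Sum>i\<in>S. path_state x z a i * q a b i k)"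
    unfolding path_state_def eq sum_distrib_left sum_distrib_right
    by (subst sum.swap) (simp add: mult.assoc)
  finally show ?thesis .
qed

text \<open>The sojourn before the jump is cut at \<open>a\<close>: what precedes \<open>a\<close>
  is the filter at \<open>a\<close>, and the remaining factors form the jump kernel. The swaps only
  bring the sum over the state at \<open>a\<close> to the outside.\<close>

lemma path_state_jump:
  assumes z: "step_path z" and ab: "0 \<le> a" "a \<le> b" and eq: "jump_count z b = Suc (jump_count z a)"
    and k: "k \<in> S" "cl k = z b"
  shows "path_state x z b k = (\<Sum>i\<in>S. path_state x z a i * jump_kernel a (jtime z (Suc (jump_count z a))) b i k)"
proof -
  let ?n = "jump_count z a"
  define T where "T = jtime z (Suc ?n)"
  have T: "a < T" "T \<le> b" using jtime_Suc_count[OF z ab] eq by (auto simp: T_def)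
  have zT: "z T = z b" using jump_count_value[OF z, of b] ab eq by (simp add: T_def)
  have pre: "(\<Sum>i\<in>S. jump_state x z ?n i * q (jtime z ?n) T i j) = (\<Sum>i\<in>S. path_state x z a i * q a T i j)"
    if j: "j \<in> S" for j
  proof -
    have "(\<Sum>i\<in>S. jump_state x z ?n i * q (jtime z ?n) T i j)
      = (\<Sum>i\<in>S. jump_state x z ?n i * (\<Sum>c\<in>S. q (jtime z ?n) a i c * q a T c j))"
      using jump_count_bounds[OF z ab(1)] T j
      by (intro sum.cong refl arg_cong2[of _ _ _ _ "(*)"] q_semigroup) auto
    also have "\<dots> = (\<Sum>i\<in>S. path_state x z a i * q a T i j)"
      unfolding path_state_def sum_distrib_left sum_distrib_right
      by (subst sum.swap) (simp add: mult.assoc)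
    finally show ?thesis .
  qed
  have "path_state x z b k = (\<Sum>l\<in>S. (of_bool (cl l = z b) * (\<Sum>j\<in>S. (\<Sum>i\<in>S. path_state x z a i * q a T i j) * A T j l)) * q T b l k)"
    unfolding path_state_def[of x z b] eq using pre zT by (simp add: T_def)
  also have "\<dots> = (\<Sum>l\<in>S. \<Sum>j\<in>S. \<Sum>i\<in>S. path_state x z a i * (q a T i j * (A T j l * of_bool (cl l = cl k)) * q T b l k))"
    using k(2) by (simp add: sum_distrib_left sum_distrib_right ac_simps)
  also have "\<dots> = (\<Sum>j\<in>S. \<Sum>l\<in>S. \<Sum>i\<in>S. path_state x z a i * (q a T i j * (A T j l * of_bool (cl l = cl k)) * q T b l k))"
    by (rule sum.swap)
  also have "\<dots> = (\<Sum>j\<in>S. \<Sum>i\<in>S. \<Sum>l\<in>S. path_state x z a i * (q a T i j * (A T j l * of_bool (cl l = cl k)) * q T b l k))"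
    by (intro sum.cong refl sum.swap)
  also have "\<dots> = (\<Sum>i\<in>S. \<Sum>j\<in>S. \<Sum>l\<in>S. path_state x z a i * (q a T i j * (A T j l * of_bool (cl l = cl k)) * q T b l k))"
    by (rule sum.swap)
  also have "\<dots> = (\<Sum>i\<in>S. path_state x z a i * jump_kernel a T b i k)"
    by (simp add: jump_kernel_def sum_distrib_left)
  finally show ?thesis by (simp add: T_def)
qed

lemma fwd_cong_init:
  assumes "\<And>k. k \<in> S \<Longrightarrow> k \<in> B 0 \<Longrightarrow> x k = y k" "k \<in> S"
  shows "fwd u B x l k = fwd u B y l k"
  using \<open>k \<in> S\<close>
proof (induction l arbitrary: k)
  case 0
  then show ?case using assms(1)[of k] by auto
next
  case (Suc l)
  then have "(\<Sum>i\<in>S. fwd u B x l i * p (u l) (u (Suc l)) i k) = (\<Sum>i\<in>S. fwd u B y l i * p (u l) (u (Suc l)) i k)"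
    by (intro sum.cong) auto
  then show ?case by simp
qed

lemma fwd_path_limit:
  assumes z: "step_path z" and H: "0 \<le> H" and k: "k \<in> S"
  shows "(\<lambda>N. fwd (unif_grid 0 H N) (\<lambda>l. {k. cl k = z (unif_grid 0 H N l)}) x (Suc N) k
            / change_scale (H / real (Suc N)) (\<lambda>l. z (unif_grid 0 H N l)) (Suc N)) \<longlonglongrightarrow> path_state x z H k"
proof -
  obtain B where B: "\<And>u. u \<in> {0..H} \<Longrightarrow> (\<Sum>k\<in>S. \<bar>path_state x z u k\<bar>) \<le> B"
    using path_state_bound[OF z H] by blast
  obtain \<delta> where \<delta>: "\<delta> > 0"
    "\<And>a b. 0 \<le> a \<Longrightarrow> a \<le> b \<Longrightarrow> b \<le> H \<Longrightarrow> b - a < \<delta> \<Longrightarrow> jump_count z b \<le> Suc (jump_count z a)"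
    using jump_count_gap[OF z H] by blast
  have "(\<lambda>N. fwd (unif_grid 0 H N) (\<lambda>l. {k. cl k = z (unif_grid 0 H N l)}) (path_state x z 0) (Suc N) k
            / change_scale ((H - 0) / real (Suc N)) (\<lambda>l. z (unif_grid 0 H N l)) (Suc N)) \<longlonglongrightarrow> path_state x z H k"
  proof (rule fwd_scaled_limit[where \<nu> = "jump_count z" and B = B and \<gamma> = \<delta>])
    show "z a = z b \<and> (\<forall>k\<in>S. path_state x z b k = (\<Sum>i\<in>S. path_state x z a i * q a b i k))"
      if "0 \<le> a" "a \<le> b" "jump_count z a = jump_count z b" for a b
      using that path_state_diag[OF z that] jump_count_value[OF z, of a] jump_count_value[OF z, of b] by simp
    show "z a \<noteq> z b \<and> (\<exists>T\<in>{a..b}. \<forall>k\<in>S. cl k = z b \<longrightarrow> path_state x z b k = (\<Sum>i\<in>S. path_state x z a i * jump_kernel a T b i k))"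
      if ab: "0 \<le> a" "a \<le> b" "jump_count z b = Suc (jump_count z a)" for a b
      using jtime_Suc_count[OF z ab(1,2)] ab path_state_jump[OF z ab] jump_count_value[OF z, of b] by force
  qed (use H z B \<delta> k in \<open>auto intro: path_state_supp jump_count_mono\<close>)
  \<comment> \<open>\<open>fwd\<close> restricts its initial row to the class of \<open>z 0\<close>,
    and \<open>path_state\<close> at time 0 is precisely that restriction of
    \<open>x\<close>.\<close>
  moreover have "fwd (unif_grid 0 H N) (\<lambda>l. {k. cl k = z (unif_grid 0 H N l)}) (path_state x z 0) (Suc N) k
     = fwd (unif_grid 0 H N) (\<lambda>l. {k. cl k = z (unif_grid 0 H N l)}) x (Suc N) k" for N
    using path_state_0[OF z] k by (intro fwd_cong_init) auto
  ultimately show ?thesis by (simp only: diff_zero)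
qed

text \<open>The jump-free instance of the same limit, with counter 0 and all scale factors 1. It
  produces the product integral of one diagonal block from staying in a class at all points of an
  ever finer grid.\<close>

lemma fwd_const_limit:
  assumes rs: "0 \<le> r" "r \<le> s" and supp: "\<And>i. i \<in> S \<Longrightarrow> cl i \<noteq> j \<Longrightarrow> x i = 0" and k: "k \<in> S"
  shows "(\<lambda>N. fwd (unif_grid r s N) (\<lambda>_. {k. cl k = j}) x (Suc N) k) \<longlonglongrightarrow> (\<Sum>i\<in>S. x i * q r s i k)"
proof -
  let ?V = "\<lambda>u k. \<Sum>i\<in>S. x i * q r u i k"
  obtain C where C: "C \<ge> 0"
    "\<And>a x i k. 0 \<le> a \<Longrightarrow> a \<le> x \<Longrightarrow> x \<le> s \<Longrightarrow> i \<in> S \<Longrightarrow> k \<in> S \<Longrightarrow> \<bar>q a x i k - of_bool (i = k)\<bar> \<le> C * (x - a)"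
    by (rule fund_sol_near_id[of S _ q s, OF A_diag q]; blast)
  have qb: "\<bar>q r u i k\<bar> \<le> 1 + C * s" if "r \<le> u" "u \<le> s" "i \<in> S" "k \<in> S" for u i k
  proof -
    have "C * (u - r) \<le> C * s" using that C(1) rs by (intro mult_left_mono) auto
    then show ?thesis using C(2)[OF rs(1) that] by (auto simp: of_bool_def split: if_splits)
  qed
  have V0: "?V r i = x i" if "i \<in> S" for i
    using that fin rs by (simp add: q_refl)
  have "(\<lambda>N. fwd (unif_grid r s N) (\<lambda>l. {k. cl k = (\<lambda>_. j) (unif_grid r s N l)}) (?V r) (Suc N) k
            / change_scale ((s - r) / real (Suc N)) (\<lambda>l. (\<lambda>_. j) (unif_grid r s N l)) (Suc N)) \<longlonglongrightarrow> ?V s k"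
  proof (rule fwd_scaled_limit[where \<nu> = "\<lambda>_. 0" and \<gamma> = 1 and B = "\<Sum>k\<in>S. \<Sum>i\<in>S. \<bar>x i\<bar> * (1 + C * s)"])
    fix u k assume u: "u \<in> {r..s}" "k \<in> S" "cl k \<noteq> j"
    have "x i * q r u i k = 0" if i: "i \<in> S" for i
    proof (cases "cl i = j")
      case True
      with u have "cl i \<noteq> cl k" by simp
      then show ?thesis using q_off_diag[OF rs(1) _ i u(2)] u by simp
    qed (use supp[OF i] in simp)
    then show "?V u k = 0" by (intro sum.neutral) auto
  next
    fix u assume "u \<in> {r..s}"
    then show "(\<Sum>k\<in>S. \<bar>?V u k\<bar>) \<le> (\<Sum>k\<in>S. \<Sum>i\<in>S. \<bar>x i\<bar> * (1 + C * s))"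
      by (intro sum_mono order_trans[OF sum_abs] abs_mult_le qb) auto
  next
    fix a b assume ab: "r \<le> a" "a \<le> b" "b \<le> s"
    have "?V b k = (\<Sum>i\<in>S. ?V a i * q a b i k)" if k: "k \<in> S" for k
    proof -
      have "?V b k = (\<Sum>i\<in>S. x i * (\<Sum>c\<in>S. q r a i c * q a b c k))"
        using ab rs k by (intro sum.cong refl arg_cong2[of _ _ _ _ "(*)"] q_semigroup) auto
      also have "\<dots> = (\<Sum>i\<in>S. ?V a i * q a b i k)"
        unfolding sum_distrib_left sum_distrib_right by (subst sum.swap) (simp add: mult.assoc)
      finally show ?thesis .
    qed
    then show "j = j \<and> (\<forall>k\<in>S. ?V b k = (\<Sum>i\<in>S. ?V a i * q a b i k))" by blast
  qed (use rs k in auto)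
  moreover have "change_scale c (\<lambda>_. j) n = 1" for c n by (induction n) auto
  moreover have "fwd (unif_grid r s N) (\<lambda>_. {k. cl k = j}) (?V r) (Suc N) k = fwd (unif_grid r s N) (\<lambda>_. {k. cl k = j}) x (Suc N) k" for N
    using V0 k by (intro fwd_cong_init) auto
  ultimately show ?thesis by (simp only: div_by_1)
qed

end

section \<open>The product integral\<close>

definition mat_cont :: "nat \<Rightarrow> (real \<Rightarrow> real mat) \<Rightarrow> bool" where
  "mat_cont n A \<longleftrightarrow> (\<forall>x\<ge>0. A x \<in> carrier_mat n n) \<and>
     (\<forall>a<n. \<forall>b<n. continuous_on {0..} (\<lambda>x. A x $$ (a,b)))"

lemma mat_cont_coeff: "mat_cont n A \<Longrightarrow> cont_coeff {..<n} (\<lambda>x i k. A x $$ (i,k))"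
  by (auto simp: mat_cont_def cont_coeff_def)

lemma index_mult_mat_sum:
  "B \<in> carrier_mat l n \<Longrightarrow> C \<in> carrier_mat n m \<Longrightarrow> i < l \<Longrightarrow> k < m \<Longrightarrow>
     (B * C) $$ (i,k) = (\<Sum>c<n. B $$ (i,c) * C $$ (c,k))"
  by (auto simp: scalar_prod_def atLeast0LessThan)

lemma prodint_sol_iff:
  assumes A: "mat_cont n A" and t: "0 \<le> t"
  shows "prodint_sol n A t F \<longleftrightarrow> F t = 1\<^sub>m n \<and> (\<forall>u\<ge>t. F u \<in> carrier_mat n n) \<and>
     fund_sol {..<n} (\<lambda>x i k. A x $$ (i,k)) t (\<lambda>u i k. F u $$ (i,k))"
proof -
  have "(F u * A u) $$ (a,b) = (\<Sum>c<n. F u $$ (a,c) * A u $$ (c,b))"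
    if "F u \<in> carrier_mat n n" "t \<le> u" "a < n" "b < n" for u a b
    using that A t by (intro index_mult_mat_sum) (auto simp: mat_cont_def)
  then show ?thesis
    unfolding prodint_sol_def fund_sol_def lin_row_def
    by (auto simp: of_bool_def)
qed

text \<open>Uniqueness gives the definite description its meaning. The description concerns the
  value at \<open>s\<close> alone, since solutions may differ before \<open>t\<close>.\<close>

lemma prodint_eqI:
  assumes A: "mat_cont n A" and t: "0 \<le> t" and F: "prodint_sol n A t F" and s: "t \<le> s"
  shows "prodint n A t s = F s"
  unfolding prodint_def
proof (rule the_equality)
  show "\<exists>F'. prodint_sol n A t F' \<and> F s = F' s" using F by blast
next
  fix P assume "\<exists>G. prodint_sol n A t G \<and> P = G s"
  then obtain G where G: "prodint_sol n A t G" and P: "P = G s" by blast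
  note sol = F[unfolded prodint_sol_iff[OF A t]] G[unfolded prodint_sol_iff[OF A t]]
  have "G s $$ (i,k) = F s $$ (i,k)" if ik: "i < n" "k < n" for i k
    by (rule lin_row_unique[of "{..<n}" "\<lambda>x i k. A x $$ (i,k)" t "\<lambda>u k. G u $$ (i,k)" "\<lambda>u k. F u $$ (i,k)"])
      (use sol ik t s mat_cont_coeff[OF A] in \<open>auto simp: fund_sol_def\<close>)
  moreover have "F s \<in> carrier_mat n n" "G s \<in> carrier_mat n n" using sol s by auto
  ultimately show "P = F s" unfolding P by (intro eq_matI) auto
qed

lemma prodint_sol_exists:
  assumes A: "mat_cont n A" and t: "0 \<le> t"
  shows "\<exists>F. prodint_sol n A t F"
proof -
  obtain p where p: "fund_sol {..<n} (\<lambda>x i k. A x $$ (i,k)) t p"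
    using fund_sol_exists[OF mat_cont_coeff[OF A] t] by blast
  define F where "F u = mat n n (\<lambda>(i,k). p u i k)" for u
  have "prodint_sol n A t F"
    unfolding prodint_sol_iff[OF A t]
  proof (intro conjI allI impI)
    show "F t = 1\<^sub>m n" using p by (intro eq_matI) (auto simp: F_def fund_sol_def)
    show "fund_sol {..<n} (\<lambda>x i k. A x $$ (i,k)) t (\<lambda>u i k. F u $$ (i,k))"
      using p by (auto simp: F_def fund_sol_def lin_row_def)
  qed (simp add: F_def)
  then show ?thesis by blast
qed

lemma prodint_sol_prodint:
  assumes A: "mat_cont n A" and t: "0 \<le> t"
  shows "prodint_sol n A t (prodint n A t)"
proof -
  obtain F where F: "prodint_sol n A t F" using prodint_sol_exists[OF A t] by blast
  have eq: "prodint n A t u = F u" if "t \<le> u" for u by (rule prodint_eqI[OF A t F that])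
  show ?thesis
    unfolding prodint_sol_def
  proof (intro conjI allI impI)
    show "prodint n A t t = 1\<^sub>m n" using eq[of t] F by (simp add: prodint_sol_def)
    fix u assume u: "t \<le> u"
    show "prodint n A t u \<in> carrier_mat n n" using eq[OF u] F u by (simp add: prodint_sol_def)
    fix a b assume ab: "a < n" "b < n"
    have "((\<lambda>v. F v $$ (a,b)) has_real_derivative (F u * A u) $$ (a,b)) (at u within {t..})"
      using F u ab by (simp add: prodint_sol_def)
    \<comment> \<open>The two functions agree from \<open>t\<close> on, which suffices for a
      derivative within \<open>{t..}\<close>.\<close>
    then show "((\<lambda>v. prodint n A t v $$ (a,b)) has_real_derivative (prodint n A t u * A u) $$ (a,b)) (at u within {t..})"
      unfolding eq[OF u]
      by (rule has_field_derivative_transform_within[of _ _ _ _ 1]) (use eq u in auto)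
  qed
qed

lemma
  assumes A: "mat_cont n A" and t: "0 \<le> t"
  shows prodint_carrier: "t \<le> u \<Longrightarrow> prodint n A t u \<in> carrier_mat n n"
    and prodint_refl: "prodint n A t t = 1\<^sub>m n"
    and prodint_fund_sol: "fund_sol {..<n} (\<lambda>x i k. A x $$ (i,k)) t (\<lambda>u i k. prodint n A t u $$ (i,k))"
  using prodint_sol_prodint[OF A t] unfolding prodint_sol_iff[OF A t] by auto

lemma prodint_trans:
  assumes A: "mat_cont n A" and t: "0 \<le> t" "t \<le> s" "s \<le> u"
  shows "prodint n A t s * prodint n A s u = prodint n A t u"
proof (rule eq_matI)
  have s: "0 \<le> s" using t by simp
  note car = prodint_carrier[OF A t(1,2)] prodint_carrier[OF A s t(3)] prodint_carrier[OF A t(1), of u]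
  fix i k assume "i < dim_row (prodint n A t u)" "k < dim_col (prodint n A t u)"
  then have ik: "i < n" "k < n" using car t by auto
  show "(prodint n A t s * prodint n A s u) $$ (i,k) = prodint n A t u $$ (i,k)"
    using fund_sol_semigroup[OF prodint_fund_sol[OF A t(1)] prodint_fund_sol[OF A s] mat_cont_coeff[OF A], of u i k]
      index_mult_mat_sum[OF car(1,2) ik] ik t by simp
qed (use prodint_carrier[OF A t(1,2)] prodint_carrier[OF A t(1), of u] prodint_carrier[OF A _ t(3)] t in auto)

section \<open>Enumeration of the state space\<close>

lemma off_eq_dbar: "off d j = dbar j d"
  by (simp add: off_def dbar_def)

text \<open>A new macrostate appends the interval of indices that starts at the number of earlier
  states, so the lexicographic enumeration grows by one interval per induction step.\<close>

lemma idx_bij: "bij_betw (idx d) (stE J d) {..<dbar J d}"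
proof (induction J)
  case 0
  then show ?case by (simp add: stE_def dbar_def bij_betw_def)
next
  case (Suc J)
  have "bij_betw (idx d) ({J} \<times> {..<d J}) {dbar J d..<dbar (Suc J) d}"
    by (intro bij_betw_byWitness[where f' = "\<lambda>m. (J, m - dbar J d)"])
      (auto simp: idx_def off_eq_dbar dbar_def)
  then have "bij_betw (idx d) (stE J d \<union> {J} \<times> {..<d J}) ({..<dbar J d} \<union> {dbar J d..<dbar (Suc J) d})"
    by (rule bij_betw_combine[OF Suc]) auto
  moreover have "stE (Suc J) d = stE J d \<union> {J} \<times> {..<d J}"
    by (auto simp: stE_def less_Suc_eq)
  moreover have "{..<dbar (Suc J) d} = {..<dbar J d} \<union> {dbar J d..<dbar (Suc J) d}"
    by (auto simp: dbar_def)
  ultimately show ?case by simp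
qed

lemma idx_less: "i \<in> stE J d \<Longrightarrow> idx d i < dbar J d"
  using idx_bij[of d J] by (auto simp: bij_betw_def)

lemma idx_eq_iff: "i \<in> stE J d \<Longrightarrow> k \<in> stE J d \<Longrightarrow> idx d i = idx d k \<longleftrightarrow> i = k"
  using idx_bij[of d J] by (auto simp: bij_betw_def inj_on_def)

lemma mem_stE: "i \<in> stE J d \<longleftrightarrow> fst i < J \<and> snd i < d (fst i)"
  by (auto simp: stE_def)

lemma finite_stE [simp]: "finite (stE J d)"
  using bij_betw_finite[OF idx_bij] by blast

lemma sum_idx: "(\<Sum>c<dbar J d. g c) = (\<Sum>c\<in>stE J d. g (idx d c))"
  using sum.reindex_bij_betw[OF idx_bij[of d J], of g] by simp

lemma sum_macro:
  assumes "j < J"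
  shows "(\<Sum>c\<in>stE J d. if fst c = j then g c else 0) = (\<Sum>b<d j. g (j, b))"
proof -
  have "(\<Sum>c\<in>stE J d. if fst c = j then g c else 0) = (\<Sum>c\<in>{c\<in>stE J d. fst c = j}. g c)"
    by (simp add: sum.inter_filter)
  also have "{c\<in>stE J d. fst c = j} = Pair j ` {..<d j}"
    using assms by (auto simp: stE_def)
  also have "(\<Sum>c\<in>Pair j ` {..<d j}. g c) = (\<Sum>b<d j. g (j, b))"
    by (subst sum.reindex) (auto simp: inj_on_def)
  finally show ?thesis .
qed

definition full_kernel :: "nat \<Rightarrow> (nat \<Rightarrow> nat) \<Rightarrow> (real \<Rightarrow> real mat) \<Rightarrow> real \<Rightarrow> real \<Rightarrow> nat \<times> nat \<Rightarrow> nat \<times> nat \<Rightarrow> real" where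
  "full_kernel J d M a b i k = prodint (dbar J d) M a b $$ (idx d i, idx d k)"

definition diag_prodint :: "(nat \<Rightarrow> nat) \<Rightarrow> (real \<Rightarrow> real mat) \<Rightarrow> nat \<Rightarrow> real \<Rightarrow> real \<Rightarrow> real mat" where
  "diag_prodint d M y a b = prodint (d y) (\<lambda>x. blk d (M x) y y) a b"

definition diag_kernel :: "(nat \<Rightarrow> nat) \<Rightarrow> (real \<Rightarrow> real mat) \<Rightarrow> real \<Rightarrow> real \<Rightarrow> nat \<times> nat \<Rightarrow> nat \<times> nat \<Rightarrow> real" where
  "diag_kernel d M a b i k = (if fst i = fst k then diag_prodint d M (fst i) a b $$ (snd i, snd k) else 0)"

definition rate :: "(nat \<Rightarrow> nat) \<Rightarrow> (real \<Rightarrow> real mat) \<Rightarrow> real \<Rightarrow> nat \<times> nat \<Rightarrow> nat \<times> nat \<Rightarrow> real" where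
  "rate d M x i k = M x $$ (idx d i, idx d k)"

text \<open>\<open>alpha_aux\<close> accumulates from the front, whereas a path acquires its newest
  jump at the back; this reverses the direction for inductions along jump times.\<close>

lemma alpha_aux_snoc:
  assumes "sn \<noteq> []"
  shows "alpha_aux d M a (sn @ [(t', y')]) = alpha_aux d M a sn
     * diag_prodint d M (snd (last sn)) (fst (last sn)) t' * blk d (M t') (snd (last sn)) y'"
  using assms
proof (induction d M a sn rule: alpha_aux.induct)
  case ("2_2" d M a v)
  then show ?case by (cases v) (auto simp: diag_prodint_def)
qed (auto simp: diag_prodint_def)

lemma jump_seq_Suc:
  "jump_seq f (Suc n) = jump_seq f n @ [(jtime f (Suc n), f (jtime f (Suc n)))]"
  by (simp add: jump_seq_def jtime_def del: jump_time.simps)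

lemma last_jump_seq: "last (jump_seq f n) = (jtime f n, f (jtime f n))"
  by (simp add: jump_seq_def jtime_def)

lemma jump_seq_nonempty: "jump_seq f n \<noteq> []"
  by (simp add: jump_seq_def)

locale block_matrix =
  fixes J :: nat and d :: "nat \<Rightarrow> nat" and M :: "real \<Rightarrow> real mat"
  assumes M: "mat_cont (dbar J d) M"
begin

lemma blk_carrier: "blk d A y y' \<in> carrier_mat (d y) (d y')"
  by (simp add: blk_def)

lemma blk_rate:
  "b < d y \<Longrightarrow> b' < d y' \<Longrightarrow> blk d (M x) y y' $$ (b, b') = rate d M x (y, b) (y', b')"
  by (simp add: blk_def rate_def idx_def)

lemma blk_cont:
  assumes "y < J"
  shows "mat_cont (d y) (\<lambda>x. blk d (M x) y y)"
  unfolding mat_cont_def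
proof (intro conjI allI impI)
  fix a b assume ab: "a < d y" "b < d y"
  have "continuous_on {0..} (\<lambda>x. M x $$ (idx d (y,a), idx d (y,b)))"
    using M ab assms idx_less[of "(y,a)" J d] idx_less[of "(y,b)" J d] by (auto simp: mat_cont_def stE_def)
  then show "continuous_on {0..} (\<lambda>x. blk d (M x) y y $$ (a,b))"
    using ab by (simp add: blk_def idx_def)
qed (simp add: blk_def)

lemma diag_prodint_carrier: "y < J \<Longrightarrow> 0 \<le> a \<Longrightarrow> a \<le> b \<Longrightarrow> diag_prodint d M y a b \<in> carrier_mat (d y) (d y)"
  unfolding diag_prodint_def by (rule prodint_carrier[OF blk_cont])

lemma diag_prodint_trans:
  "y < J \<Longrightarrow> 0 \<le> a \<Longrightarrow> a \<le> b \<Longrightarrow> b \<le> c \<Longrightarrow> diag_prodint d M y a b * diag_prodint d M y b c = diag_prodint d M y a c"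
  unfolding diag_prodint_def by (rule prodint_trans[OF blk_cont])

lemma full_kernel_fund_sol:
  assumes a: "0 \<le> a"
  shows "fund_sol (stE J d) (rate d M) a (full_kernel J d M a)"
  unfolding fund_sol_def lin_row_def
proof (intro ballI conjI allI impI)
  note sol = prodint_fund_sol[OF M a]
  fix i k assume ik: "i \<in> stE J d" "k \<in> stE J d"
  show "full_kernel J d M a a i k = of_bool (i = k)"
    using ik idx_less idx_eq_iff[OF ik] by (simp add: full_kernel_def prodint_refl[OF M a])
  fix u assume u: "a \<le> u"
  show "((\<lambda>v. full_kernel J d M a v i k) has_real_derivative
      (\<Sum>c\<in>stE J d. full_kernel J d M a u i c * rate d M u c k)) (at u within {a..})"
    using sol idx_less[OF ik(1)] idx_less[OF ik(2)] u
    unfolding fund_sol_def lin_row_def full_kernel_def rate_def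
    by (simp add: sum_idx)
qed

lemma diag_kernel_fund_sol:
  assumes a: "0 \<le> a"
  shows "fund_sol (stE J d) (\<lambda>x i k. if fst i = fst k then rate d M x i k else 0) a (diag_kernel d M a)"
  unfolding fund_sol_def lin_row_def
proof (intro ballI conjI allI impI)
  fix i k assume ik: "i \<in> stE J d" "k \<in> stE J d"
  obtain y b where i: "i = (y, b)" by (cases i)
  obtain y' b' where k: "k = (y', b')" by (cases k)
  have yb: "y < J" "b < d y" "y' < J" "b' < d y'" using ik by (auto simp: i k stE_def)
  note sol = prodint_fund_sol[OF blk_cont[OF yb(1)] a]
  show "diag_kernel d M a a i k = of_bool (i = k)"
    using yb by (auto simp: diag_kernel_def diag_prodint_def i k prodint_refl[OF blk_cont a])
  fix u assume u: "a \<le> u"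
  let ?D = "\<Sum>c\<in>stE J d. diag_kernel d M a u i c * (if fst c = fst k then rate d M u c k else 0)"
  show "((\<lambda>v. diag_kernel d M a v i k) has_real_derivative ?D) (at u within {a..})"
  proof (cases "y = y'")
    case True
    \<comment> \<open>The sum collapses to the macrostate of the starting state, where it is an
      entry of a product with a single diagonal block.\<close>
    have "?D = (\<Sum>c\<in>stE J d. if fst c = y then diag_prodint d M y a u $$ (b, snd c) * rate d M u c k else 0)"
      using True by (intro sum.cong) (auto simp: diag_kernel_def i k)
    also have "\<dots> = (\<Sum>c<d y. diag_prodint d M y a u $$ (b, c) * blk d (M u) y y $$ (c, b'))"
      using yb True by (simp add: sum_macro blk_rate k)
    finally show ?thesis
      using sol yb True u
      unfolding fund_sol_def lin_row_def by (simp add: diag_kernel_def diag_prodint_def i k)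
  next
    case False
    have "?D = 0" using False by (intro sum.neutral) (auto simp: diag_kernel_def i k)
    then show ?thesis using False by (simp add: diag_kernel_def i k)
  qed
qed

sublocale bk: block_kernel "stE J d" fst "rate d M" "full_kernel J d M" "diag_kernel d M"
proof
  show "cont_coeff (stE J d) (rate d M)"
    using M idx_less by (auto simp: mat_cont_def cont_coeff_def rate_def)
qed (auto intro: full_kernel_fund_sol diag_kernel_fund_sol)

section \<open>Matrix expressions as sums over states\<close>

text \<open>\<open>state_row y a\<close> is the row vector \<open>a E\<^sub>y'\<close> read as a function of the state.\<close>

definition state_row :: "nat \<Rightarrow> real mat \<Rightarrow> nat \<times> nat \<Rightarrow> real" where
  "state_row y a k = (if fst k = y then a $$ (0, snd k) else 0)"

lemma state_row_diag_kernel: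
  assumes a: "a \<in> carrier_mat 1 (d y)" and y: "y < J" and k: "k \<in> stE J d" and t: "0 \<le> t" "t \<le> u"
  shows "(\<Sum>i\<in>stE J d. state_row y a i * diag_kernel d M t u i k) = state_row y (a * diag_prodint d M y t u) k"
proof -
  have "(\<Sum>i\<in>stE J d. state_row y a i * diag_kernel d M t u i k)
    = (\<Sum>i\<in>stE J d. if fst i = y then a $$ (0, snd i) * diag_kernel d M t u i k else 0)"
    by (intro sum.cong) (auto simp: state_row_def)
  also have "\<dots> = (\<Sum>b<d y. a $$ (0, b) * diag_kernel d M t u (y, b) k)"
    by (simp add: sum_macro[OF y])
  also have "\<dots> = state_row y (a * diag_prodint d M y t u) k"
    using k index_mult_mat_sum[OF a diag_prodint_carrier[OF y t], of 0 "snd k"]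
    by (auto simp: state_row_def diag_kernel_def stE_def)
  finally show ?thesis .
qed

lemma state_row_rate:
  assumes a: "a \<in> carrier_mat 1 (d y)" and y: "y < J" and k: "k \<in> stE J d" "fst k = y'"
  shows "(\<Sum>i\<in>stE J d. state_row y a i * rate d M x i k) = (a * blk d (M x) y y') $$ (0, snd k)"
proof -
  have "(\<Sum>i\<in>stE J d. state_row y a i * rate d M x i k)
    = (\<Sum>i\<in>stE J d. if fst i = y then a $$ (0, snd i) * rate d M x i k else 0)"
    by (intro sum.cong) (auto simp: state_row_def)
  also have "\<dots> = (\<Sum>b<d y. a $$ (0, b) * rate d M x (y, b) k)"
    by (simp add: sum_macro[OF y])
  also have "\<dots> = (a * blk d (M x) y y') $$ (0, snd k)"
    using k index_mult_mat_sum[OF a blk_carrier[of "M x" y y'], of 0 "snd k"] blk_rate[of _ y "snd k" y' x]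
    by (auto simp: mem_stE)
  finally show ?thesis .
qed

text \<open>Multiplication by E_y' pads a row over the microstates of \<open>y\<close> with zeros to
  a row over all states, which is exactly the case distinction in \<open>state_row\<close>.\<close>

lemma state_row_Emat:
  assumes a: "a \<in> carrier_mat 1 (d y)" and y: "y < J" and k: "k \<in> stE J d"
  shows "(a * transpose_mat (Emat J d y)) $$ (0, idx d k) = state_row y a k"
proof -
  have "(a * transpose_mat (Emat J d y)) $$ (0, idx d k) = (\<Sum>c<d y. a $$ (0,c) * Emat J d y $$ (idx d k, c))"
    using index_mult_mat_sum[OF a, of "transpose_mat (Emat J d y)" "dbar J d" 0 "idx d k"] idx_less[OF k]
    by (simp add: Emat_def)
  also have "\<dots> = (\<Sum>c<d y. if k = (y, c) then a $$ (0,c) else 0)"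
  proof (intro sum.cong refl)
    fix c assume "c \<in> {..<d y}"
    then have "(y, c) \<in> stE J d" using y by (simp add: stE_def)
    from idx_eq_iff[OF k this] show "a $$ (0,c) * Emat J d y $$ (idx d k, c) = (if k = (y, c) then a $$ (0,c) else 0)"
      using idx_less[OF k] \<open>c \<in> {..<d y}\<close> by (simp add: Emat_def idx_def)
  qed
  also have "\<dots> = state_row y a k"
    using k by (cases k) (auto simp: state_row_def stE_def)
  finally show ?thesis .
qed

lemma mult_Emat:
  assumes A: "A \<in> carrier_mat 1 (dbar J d)" and j: "j < J" and c: "c < d j"
  shows "(A * Emat J d j) $$ (0, c) = A $$ (0, idx d (j, c))"
proof -
  have "(A * Emat J d j) $$ (0, c) = (\<Sum>r<dbar J d. A $$ (0,r) * Emat J d j $$ (r, c))"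
    using c by (intro index_mult_mat_sum[OF A]) (auto simp: Emat_def)
  also have "\<dots> = (\<Sum>r<dbar J d. if r = idx d (j, c) then A $$ (0,r) else 0)"
    using c by (intro sum.cong) (auto simp: Emat_def idx_def)
  also have "\<dots> = A $$ (0, idx d (j, c))"
    using idx_less[of "(j, c)" J d] j c by (simp add: stE_def)
  finally show ?thesis .
qed

lemma state_row_ones:
  assumes a: "a \<in> carrier_mat 1 (d y)" and y: "y < J"
  shows "(a * ones (d y)) $$ (0,0) = (\<Sum>k\<in>stE J d. state_row y a k)"
proof -
  have "(a * ones (d y)) $$ (0,0) = (\<Sum>c<d y. a $$ (0,c) * ones (d y) $$ (c,0))"
    by (intro index_mult_mat_sum[OF a]) (auto simp: ones_def)
  also have "\<dots> = (\<Sum>c<d y. a $$ (0,c))" by (intro sum.cong) (auto simp: ones_def)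
  also have "\<dots> = (\<Sum>k\<in>stE J d. state_row y a k)"
    by (simp add: state_row_def sum_macro[OF y])
  finally show ?thesis .
qed

text \<open>The part of the formula after time \<open>t\<close>, read as a column: free motion from
  \<open>t\<close> to \<open>r\<close>, then a sojourn in the macrostate of \<open>st\<close> until
  \<open>s\<close>. The factor E_j is absorbed, since \<open>diag_kernel\<close> vanishes between
  macrostates.\<close>

definition future :: "real \<Rightarrow> real \<Rightarrow> real \<Rightarrow> nat \<times> nat \<Rightarrow> nat \<times> nat \<Rightarrow> real" where
  "future t r s st k = (\<Sum>i\<in>stE J d. full_kernel J d M t r k i * diag_kernel d M r s i st)"

lemma forward_matrix_sum:
  assumes a: "a \<in> carrier_mat 1 (d y)" and y: "y < J" and st: "st \<in> stE J d" and t: "0 \<le> t" "t \<le> r" "r \<le> s"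
  shows "((c \<cdot>\<^sub>m (a * transpose_mat (Emat J d y))) * prodint (dbar J d) M t r * Emat J d (fst st)
      * diag_prodint d M (fst st) r s) $$ (0, snd st) = c * (\<Sum>k\<in>stE J d. state_row y a k * future t r s st k)"
proof -
  let ?S = "stE J d"
  obtain j jt where stj: "st = (j, jt)" by (cases st)
  have j: "j < J" "jt < d j" using st by (auto simp: stj stE_def)
  let ?R = "c \<cdot>\<^sub>m (a * transpose_mat (Emat J d y))"
  let ?P = "prodint (dbar J d) M t r"
  have R: "?R \<in> carrier_mat 1 (dbar J d)" using a by (simp add: Emat_def)
  have P: "?P \<in> carrier_mat (dbar J d) (dbar J d)" by (rule prodint_carrier[OF M t(1,2)])
  have RP: "?R * ?P \<in> carrier_mat 1 (dbar J d)" using R P by (rule mult_carrier_mat)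
  have E: "Emat J d j \<in> carrier_mat (dbar J d) (d j)" by (simp add: Emat_def)
  have D: "diag_prodint d M j r s \<in> carrier_mat (d j) (d j)" using j t by (intro diag_prodint_carrier) auto
  have Ridx: "?R $$ (0, idx d k) = c * state_row y a k" if "k \<in> ?S" for k
    using state_row_Emat[OF a y that] idx_less[OF that] a by (simp add: Emat_def)
  have RPidx: "(?R * ?P) $$ (0, idx d i) = c * (\<Sum>k\<in>?S. state_row y a k * full_kernel J d M t r k i)" if i: "i \<in> ?S" for i
    using index_mult_mat_sum[OF R P, of 0 "idx d i"] idx_less[OF i] Ridx
    by (simp add: sum_idx full_kernel_def sum_distrib_left mult.assoc)
  have "(?R * ?P * Emat J d j * diag_prodint d M j r s) $$ (0, jt)
    = (\<Sum>b<d j. (?R * ?P * Emat J d j) $$ (0, b) * diag_prodint d M j r s $$ (b, jt))"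
    using j by (intro index_mult_mat_sum[OF mult_carrier_mat[OF RP E] D]) auto
  also have "\<dots> = (\<Sum>b<d j. (?R * ?P) $$ (0, idx d (j, b)) * diag_prodint d M j r s $$ (b, jt))"
    using j by (intro sum.cong refl) (simp add: mult_Emat[OF RP])
  also have "\<dots> = (\<Sum>i\<in>?S. if fst i = j then (?R * ?P) $$ (0, idx d i) * diag_prodint d M j r s $$ (snd i, jt) else 0)"
    by (simp add: sum_macro[OF j(1)])
  also have "\<dots> = (\<Sum>i\<in>?S. (c * (\<Sum>k\<in>?S. state_row y a k * full_kernel J d M t r k i)) * diag_kernel d M r s i st)"
    by (intro sum.cong) (auto simp: diag_kernel_def stj RPidx)
  also have "\<dots> = c * (\<Sum>k\<in>?S. state_row y a k * future t r s st k)"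
    unfolding future_def sum_distrib_left sum_distrib_right
    by (subst sum.swap) (simp add: mult.assoc)
  finally show ?thesis by (simp add: stj)
qed

text \<open>Nonnegativity of the last time is carried through the induction because the dimensions
  of the next product integral are derived for nonnegative starting times.\<close>

lemma alpha_carrier:
  assumes pi0: "pi0 \<in> carrier_mat 1 (d 0)"
    and sn: "sn \<noteq> []" "hd sn = (0, 0)" "\<And>l. l < length sn \<Longrightarrow> snd (sn ! l) < J"
      "\<And>l. Suc l < length sn \<Longrightarrow> fst (sn ! l) \<le> fst (sn ! Suc l)"
  shows "alpha d M pi0 sn \<in> carrier_mat 1 (d (snd (last sn))) \<and> 0 \<le> fst (last sn)"
  using sn
proof (induction sn rule: rev_induct)
  case (snoc x sn)
  show ?case
  proof (cases "sn = []")
    case True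
    then show ?thesis using snoc.prems pi0 by (simp add: alpha_def)
  next
    case False
    obtain t' y' where x: "x = (t', y')" by (cases x)
    have IH: "alpha d M pi0 sn \<in> carrier_mat 1 (d (snd (last sn)))" "0 \<le> fst (last sn)"
    proof -
      have "snd (sn ! l) < J" if "l < length sn" for l
        using snoc.prems(3)[of l] that by (simp add: nth_append)
      moreover have "fst (sn ! l) \<le> fst (sn ! Suc l)" if "Suc l < length sn" for l
        using snoc.prems(4)[of l] that by (simp add: nth_append)
      ultimately show "alpha d M pi0 sn \<in> carrier_mat 1 (d (snd (last sn)))" "0 \<le> fst (last sn)"
        using snoc.IH False snoc.prems(2) by auto
    qed
    have y: "snd (last sn) < J"
      using snoc.prems(3)[of "length sn - 1"] False by (simp add: nth_append last_conv_nth)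
    have t: "fst (last sn) \<le> t'"
      using snoc.prems(4)[of "length sn - 1"] False by (simp add: nth_append last_conv_nth x)
    show ?thesis
      using IH t mult_carrier_mat[OF mult_carrier_mat[OF IH(1) diag_prodint_carrier[OF y IH(2) t]] blk_carrier]
      by (simp add: alpha_def x alpha_aux_snoc[OF False])
  qed
qed simp

text \<open>Meeting point of two descriptions of the filter at jump times: a recursion on functions
  of states and a matrix product along the jump list.\<close>

lemma alpha_jump_seq:
  assumes pi0: "pi0 \<in> carrier_mat 1 (d 0)" and z: "step_path z" "z 0 = 0" "\<And>u. 0 \<le> u \<Longrightarrow> z u < J"
    and fin: "jump_time z n \<noteq> \<infinity>"
  shows "alpha d M pi0 (jump_seq z n) \<in> carrier_mat 1 (d (z (jtime z n))) \<and>
    (\<forall>l\<in>stE J d. bk.jump_state (init_dist d pi0) z n l = state_row (z (jtime z n)) (alpha d M pi0 (jump_seq z n)) l)"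
  using fin
proof (induction n)
  case 0
  then show ?case
    using pi0 z(2) by (auto simp: jump_seq_def alpha_def state_row_def init_dist_def mem_stE)
next
  case (Suc n)
  let ?r = "jtime z n" and ?r' = "jtime z (Suc n)"
  have less: "jump_time z n < jump_time z (Suc n)" using jump_time_finite_less[OF z(1) _ Suc.prems] by simp
  then have fin: "jump_time z n \<noteq> \<infinity>" by auto
  have r: "0 \<le> ?r" "?r \<le> ?r'"
    using jump_time_cases[OF z(1), of n] jump_time_cases[OF z(1), of "Suc n"] fin Suc.prems less
    by (auto simp del: jump_time.simps)
  let ?y = "z ?r" and ?y' = "z ?r'" and ?a = "alpha d M pi0 (jump_seq z n)"
  have y: "?y < J" using z(3) r by auto
  have a: "?a \<in> carrier_mat 1 (d ?y)" and
    IH: "\<And>l. l \<in> stE J d \<Longrightarrow> bk.jump_state (init_dist d pi0) z n l = state_row ?y ?a l"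
    using Suc.IH[OF fin] by auto
  have al: "alpha d M pi0 (jump_seq z (Suc n)) = ?a * diag_prodint d M ?y ?r ?r' * blk d (M ?r') ?y ?y'"
    by (simp add: jump_seq_Suc alpha_def alpha_aux_snoc[OF jump_seq_nonempty] last_jump_seq)
  have aP: "?a * diag_prodint d M ?y ?r ?r' \<in> carrier_mat 1 (d ?y)"
    using a diag_prodint_carrier[OF y r] by (rule mult_carrier_mat)
  have "bk.jump_state (init_dist d pi0) z (Suc n) l = state_row ?y' (alpha d M pi0 (jump_seq z (Suc n))) l"
    if l: "l \<in> stE J d" for l
    using l IH state_row_diag_kernel[OF a y _ r] state_row_rate[OF aP y l refl, of ?r']
    by (simp add: al state_row_def[of ?y'])
  then show ?case using mult_carrier_mat[OF aP blk_carrier] by (simp add: al)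
qed

lemma path_state_alpha:
  assumes pi0: "pi0 \<in> carrier_mat 1 (d 0)" and z: "step_path z" "z 0 = 0" "\<And>u. 0 \<le> u \<Longrightarrow> z u < J" and t: "0 \<le> t"
  defines "n \<equiv> jump_count z t"
  defines "a \<equiv> alpha d M pi0 (jump_seq z n) * diag_prodint d M (z t) (jtime z n) t"
  shows "a \<in> carrier_mat 1 (d (z t))" "k \<in> stE J d \<Longrightarrow> bk.path_state (init_dist d pi0) z t k = state_row (z t) a k"
proof -
  note n = jump_count_bounds[OF z(1) t, folded n_def]
  have zt: "z (jtime z n) = z t" using jump_count_value[OF z(1) t] by (simp add: n_def)
  have al: "alpha d M pi0 (jump_seq z n) \<in> carrier_mat 1 (d (z t))"
    "\<And>l. l \<in> stE J d \<Longrightarrow> bk.jump_state (init_dist d pi0) z n l = state_row (z t) (alpha d M pi0 (jump_seq z n)) l"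
    using alpha_jump_seq[OF pi0 z, of n] n(3) zt by auto
  show "a \<in> carrier_mat 1 (d (z t))"
    unfolding a_def using al(1) diag_prodint_carrier[OF z(3)[OF t] n(4,5)] by (rule mult_carrier_mat)
  show "bk.path_state (init_dist d pi0) z t k = state_row (z t) a k" if k: "k \<in> stE J d"
    using state_row_diag_kernel[OF al(1) z(3)[OF t] k n(4,5)] al(2)
    by (simp add: bk.path_state_def n_def a_def)
qed

text \<open>Brings \<open>ptilde\<close> into the form delivered by the probabilistic limit, a ratio
  of two linear functions of \<open>path_state\<close>. For a zero denominator both sides are 0 by
  the convention for division.\<close>

lemma ptilde_path:
  assumes pi0: "pi0 \<in> carrier_mat 1 (d 0)" and z: "step_path z" "z 0 = 0" "\<And>u. 0 \<le> u \<Longrightarrow> z u < J"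
    and t: "0 \<le> t" "t \<le> s" "0 \<le> c" and st: "st \<in> stE J d"
  defines "n \<equiv> jump_count z t" and "w \<equiv> bk.path_state (init_dist d pi0) z t"
  shows "ptilde J d M pi0 t s c st (jump_seq z n) =
    (if s - c \<le> jtime z n then 0 else
      (\<Sum>k\<in>stE J d. w k * future t (max (s - c) t) s st k) / (\<Sum>k\<in>stE J d. w k))"
proof -
  define a where "a = alpha d M pi0 (jump_seq z n) * diag_prodint d M (z t) (jtime z n) t"
  note a = path_state_alpha[OF pi0 z t(1), folded n_def, folded a_def w_def]
  have zt: "z (jtime z n) = z t" using jump_count_value[OF z(1) t(1)] by (simp add: n_def)
  have y: "z t < J" using z(3) t by simp
  have r: "t \<le> max (s - c) t" "max (s - c) t \<le> s" using t by auto
  have "(a * ones (d (z t))) $$ (0,0) = (\<Sum>k\<in>stE J d. w k)"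
    using state_row_ones[OF a(1) y] a(2) by simp
  moreover have "(\<Sum>k\<in>stE J d. state_row (z t) a k * future t (max (s - c) t) s st k)
      = (\<Sum>k\<in>stE J d. w k * future t (max (s - c) t) s st k)"
    using a(2) by simp
  ultimately show ?thesis
    using forward_matrix_sum[OF a(1) y st t(1) r, of "1 / (\<Sum>k\<in>stE J d. w k)"]
    by (simp add: ptilde_def last_jump_seq zt Let_def diag_prodint_def[symmetric] a_def[symmetric])
qed

text \<open>For s - c \<le> t the free motion has length zero and its kernel is the identity. What
  remains of E_y' E_j is the indicator of y = j, and the diagonal product integrals up to
  \<open>t\<close> and from \<open>t\<close> to \<open>s\<close> merge.\<close>

lemma ptilde_reduced:
  assumes pi0: "pi0 \<in> carrier_mat 1 (d 0)" and sn: "realization J t sn" and st: "st \<in> stE J d"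
    and t: "t \<le> s" "fst (last sn) < s - c" "s - c \<le> t"
  shows "ptilde J d M pi0 t s c st sn =
     (if snd (last sn) = fst st then 1 else 0) *
     ((alpha d M pi0 sn * diag_prodint d M (snd (last sn)) (fst (last sn)) s) $$ (0, snd st)
      / (alpha d M pi0 sn * diag_prodint d M (snd (last sn)) (fst (last sn)) t * ones (d (snd (last sn)))) $$ (0,0))"
proof -
  define r y where "r = fst (last sn)" and "y = snd (last sn)"
  have y: "y < J" using sn by (auto simp: realization_def y_def last_conv_nth)
  have al: "alpha d M pi0 sn \<in> carrier_mat 1 (d y)" and r: "0 \<le> r" "r \<le> t"
    using alpha_carrier[OF pi0, of sn] sn by (auto simp: realization_def r_def y_def less_imp_le)
  define a where "a = alpha d M pi0 sn * diag_prodint d M y r t"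
  have a: "a \<in> carrier_mat 1 (d y)" unfolding a_def using al diag_prodint_carrier[OF y r] by (rule mult_carrier_mat)
  have t0: "0 \<le> t" using r by simp
  have fut: "future t t s st k = diag_kernel d M t s k st" if "k \<in> stE J d" for k
    using that t0 by (simp add: future_def bk.p_refl)
  have "ptilde J d M pi0 t s c st sn
      = (1 / (a * ones (d y)) $$ (0,0)) * (\<Sum>k\<in>stE J d. state_row y a k * future t t s st k)"
    using forward_matrix_sum[OF a y st t0 order_refl t(1), of "1 / (a * ones (d y)) $$ (0,0)"] t
    by (simp add: ptilde_def Let_def diag_prodint_def[symmetric] r_def[symmetric] y_def[symmetric] a_def[symmetric] max_def)
  also have "(\<Sum>k\<in>stE J d. state_row y a k * future t t s st k) = state_row y (a * diag_prodint d M y t s) st"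
    using state_row_diag_kernel[OF a y st t0 t(1)] fut by simp
  also have "a * diag_prodint d M y t s = alpha d M pi0 sn * diag_prodint d M y r s"
    unfolding a_def
    using assoc_mult_mat[OF al diag_prodint_carrier[OF y r] diag_prodint_carrier[OF y t0 t(1)]]
      diag_prodint_trans[OF y r t(1)] by simp
  finally show ?thesis
    by (auto simp: state_row_def r_def[symmetric] y_def[symmetric] a_def[symmetric])
qed

end

section \<open>Finite-dimensional distributions of the aggregate model\<close>

lemma step_path_comp:
  assumes "step_path f"
  shows "step_path (\<lambda>u. g (f u))"
  unfolding step_path_def
proof (intro conjI allI impI)
  fix u :: real assume "0 \<le> u"
  then obtain e where "e > 0" "\<forall>v\<in>{u..<u+e}. f v = f u" using assms unfolding step_path_def by metis
  then show "\<exists>e>0. \<forall>v\<in>{u..<u+e}. g (f v) = g (f u)" by (metis (no_types, lifting))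
next
  fix b :: real
  have "finite {u\<in>{0..b}. \<not> (\<exists>e>0. \<forall>v\<in>{u-e<..<u+e}. f v = f u)}" using assms by (simp add: step_path_def)
  then show "finite {u\<in>{0..b}. \<not> (\<exists>e>0. \<forall>v\<in>{u-e<..<u+e}. g (f v) = g (f u))}"
    by (rule rev_finite_subset) (auto, metis)
qed

locale aggregate_model =
  fixes P :: "'w measure" and J :: nat and d :: "nat \<Rightarrow> nat" and M :: "real \<Rightarrow> real mat"
    and pi0 :: "real mat" and X :: "real \<Rightarrow> 'w \<Rightarrow> nat \<times> nat"
  assumes model: "aggregate_markov P J d M pi0 X"
begin

sublocale prob_space P
  using model by (simp add: aggregate_markov_def)

sublocale block_matrix J d M
  using model by unfold_locales (auto simp: aggregate_markov_def intensity_matrix_fun_def mat_cont_def)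

abbreviation "S \<equiv> stE J d"
abbreviation "Z \<equiv> macro X"
abbreviation "init \<equiv> init_dist d pi0"

lemma X_measurable [measurable]: "0 \<le> t \<Longrightarrow> X t \<in> measurable P (count_space UNIV)"
  using model by (simp add: aggregate_markov_def)

lemma X_step_path: "\<omega> \<in> space P \<Longrightarrow> step_path (\<lambda>t. X t \<omega>)"
  and X_in: "\<omega> \<in> space P \<Longrightarrow> 0 \<le> t \<Longrightarrow> X t \<omega> \<in> S"
  using model by (auto simp: aggregate_markov_def)

lemma pi0_carrier: "pi0 \<in> carrier_mat 1 (d 0)"
  using model by (simp add: aggregate_markov_def)

lemma Z_step_path: "\<omega> \<in> space P \<Longrightarrow> step_path (\<lambda>t. Z t \<omega>)"
  unfolding macro_def by (rule step_path_comp[OF X_step_path])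

lemma Z_less: "\<omega> \<in> space P \<Longrightarrow> 0 \<le> t \<Longrightarrow> Z t \<omega> < J"
  using X_in[of \<omega> t] by (simp add: macro_def mem_stE)

lemma Z_measurable [measurable]: "0 \<le> t \<Longrightarrow> Z t \<in> measurable P (count_space UNIV)"
  unfolding macro_def by (rule measurable_compose[OF X_measurable]) auto

lemma fdd:
  assumes "u 0 = 0" "\<And>m. m < n \<Longrightarrow> u m \<le> u (Suc m)" "\<And>m. m \<le> n \<Longrightarrow> i m \<in> S"
  shows "prob {\<omega>\<in>space P. \<forall>m\<le>n. X (u m) \<omega> = i m} =
     init (i 0) * (\<Prod>m<n. full_kernel J d M (u m) (u (Suc m)) (i m) (i (Suc m)))"
  using model assms unfolding aggregate_markov_def full_kernel_def by blast

lemma grid_nonneg: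
  assumes "u 0 = 0" "\<And>m. m < n \<Longrightarrow> u m \<le> u (Suc m)" "m \<le> n"
  shows "0 \<le> (u m :: real)"
  using assms(3)
proof (induction m)
  case (Suc m)
  then show ?case using assms(2)[of m] by simp
qed (use assms(1) in simp)

text \<open>The model prescribes probabilities of single state sequences, while the recursion
  concerns sets of states. The induction relaxes one coordinate at a time; at \<open>l\<close> both
  kinds of condition hold, which makes the right-hand side a product.\<close>

lemma forward_prob_aux:
  assumes u: "u 0 = 0" "\<And>m. m < n \<Longrightarrow> u m \<le> u (Suc m)" and i: "\<And>m. l \<le> m \<Longrightarrow> m \<le> n \<Longrightarrow> i m \<in> S"
    and l: "l \<le> n"
  shows "prob {\<omega>\<in>space P. (\<forall>m\<le>l. X (u m) \<omega> \<in> B m) \<and> (\<forall>m\<in>{l..n}. X (u m) \<omega> = i m)} =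
     bk.fwd u B init l (i l) * (\<Prod>m\<in>{l..<n}. full_kernel J d M (u m) (u (Suc m)) (i m) (i (Suc m)))"
  using l i
proof (induction l arbitrary: i)
  case 0
  show ?case
  proof (cases "i 0 \<in> B 0")
    case True
    have "{\<omega>\<in>space P. (\<forall>m\<le>0. X (u m) \<omega> \<in> B m) \<and> (\<forall>m\<in>{0..n}. X (u m) \<omega> = i m)}
      = {\<omega>\<in>space P. \<forall>m\<le>n. X (u m) \<omega> = i m}" using True by auto
    then show ?thesis using fdd[of u n i, OF u] 0 True by (simp add: atLeast0LessThan)
  next
    case False
    then have eq: "{\<omega>\<in>space P. (\<forall>m\<le>0. X (u m) \<omega> \<in> B m) \<and> (\<forall>m\<in>{0..n}. X (u m) \<omega> = i m)} = {}"
      by (force intro: bexI[of _ 0])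
    show ?thesis unfolding eq using False by simp
  qed
next
  case (Suc l)
  let ?E = "\<lambda>l i. {\<omega>\<in>space P. (\<forall>m\<le>l. X (u m) \<omega> \<in> B m) \<and> (\<forall>m\<in>{l..n}. X (u m) \<omega> = i m)}"
  have u0: "0 \<le> u m" if "m \<le> n" for m using grid_nonneg[OF u that] .
  show ?case
  proof (cases "i (Suc l) \<in> B (Suc l)")
    case True
    \<comment> \<open>Partition by the state \<open>c\<close> at time \<open>u l\<close>: that
      coordinate was prescribed before and is now free inside \<open>B l\<close>.\<close>
    have eq: "?E (Suc l) i = (\<Union>c\<in>S. ?E l (i(l := c)))"
    proof (rule subset_antisym; rule subsetI)
      fix \<omega> assume \<omega>: "\<omega> \<in> ?E (Suc l) i"
      then have "X (u l) \<omega> \<in> S" using X_in u0[of l] Suc.prems(1) by simp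
      moreover have "\<omega> \<in> ?E l (i(l := X (u l) \<omega>))" using \<omega> by auto
      ultimately show "\<omega> \<in> (\<Union>c\<in>S. ?E l (i(l := c)))" by blast
    next
      fix \<omega> assume "\<omega> \<in> (\<Union>c\<in>S. ?E l (i(l := c)))"
      then obtain c where "\<omega> \<in> ?E l (i(l := c))" by blast
      then have \<omega>: "\<omega> \<in> space P" "\<forall>m\<le>l. X (u m) \<omega> \<in> B m" "\<forall>m\<in>{l..n}. X (u m) \<omega> = (i(l := c)) m" by auto
      then have "X (u m) \<omega> = i m" if "m \<in> {Suc l..n}" for m
        using that by (auto dest!: bspec[of _ _ m])
      moreover from this have "X (u m) \<omega> \<in> B m" if "m \<le> Suc l" for m
        using that True \<omega>(2) Suc.prems(1) by (cases "m = Suc l") auto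
      ultimately show "\<omega> \<in> ?E (Suc l) i" using \<omega>(1) by auto
    qed
    have "prob (\<Union>c\<in>S. ?E l (i(l := c))) = (\<Sum>c\<in>S. prob (?E l (i(l := c))))"
    proof (rule finite_measure_finite_Union)
      show "disjoint_family_on (\<lambda>c. ?E l (i(l := c))) S"
        unfolding disjoint_family_on_def
      proof (intro ballI impI)
        fix c c' :: "nat \<times> nat" assume "c \<noteq> c'"
        have "X (u l) \<omega> = c" if "\<omega> \<in> ?E l (i(l := c))" for \<omega> c
          using that Suc.prems(1) by (auto dest!: bspec[of _ _ l])
        then show "?E l (i(l := c)) \<inter> ?E l (i(l := c')) = {}" using \<open>c \<noteq> c'\<close> by blast
      qed
      show "(\<lambda>c. ?E l (i(l := c))) ` S \<subseteq> events"
      proof safe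
        fix c
        have ev: "{\<omega>\<in>space P. X (u m) \<omega> \<in> C} \<in> events" if "m \<le> n" for m C
          using measurable_sets[OF X_measurable[OF u0[OF that]], of C]
          by (simp add: vimage_def Int_def conj_commute)
        have "{\<omega>\<in>space P. (\<forall>m\<in>{..l}. X (u m) \<omega> \<in> B m) \<and> (\<forall>m\<in>{l..n}. X (u m) \<omega> \<in> {(i(l := c)) m})} \<in> events"
          using Suc.prems(1) by (intro sets.sets_Collect_conj sets.sets_Collect_finite_All ev) auto
        then show "?E l (i(l := c)) \<in> events" by (simp only: singleton_iff Ball_def atMost_iff)
      qed
    qed simp
    moreover have "prob (?E l (i(l := c))) = bk.fwd u B init l c * (full_kernel J d M (u l) (u (Suc l)) c (i (Suc l))
        * (\<Prod>m\<in>{Suc l..<n}. full_kernel J d M (u m) (u (Suc m)) (i m) (i (Suc m))))" if c: "c \<in> S" for c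
    proof -
      have "prob (?E l (i(l := c))) = bk.fwd u B init l ((i(l := c)) l)
          * (\<Prod>m\<in>{l..<n}. full_kernel J d M (u m) (u (Suc m)) ((i(l := c)) m) ((i(l := c)) (Suc m)))"
        using Suc.prems c by (intro Suc.IH) auto
      also have "(\<Prod>m\<in>{l..<n}. full_kernel J d M (u m) (u (Suc m)) ((i(l := c)) m) ((i(l := c)) (Suc m)))
        = full_kernel J d M (u l) (u (Suc l)) c (i (Suc l)) * (\<Prod>m\<in>{Suc l..<n}. full_kernel J d M (u m) (u (Suc m)) ((i(l := c)) m) ((i(l := c)) (Suc m)))"
        using Suc.prems(1) by (subst prod.atLeast_Suc_lessThan) auto
      also have "(\<Prod>m\<in>{Suc l..<n}. full_kernel J d M (u m) (u (Suc m)) ((i(l := c)) m) ((i(l := c)) (Suc m)))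
        = (\<Prod>m\<in>{Suc l..<n}. full_kernel J d M (u m) (u (Suc m)) (i m) (i (Suc m)))"
        by (intro prod.cong) auto
      finally show ?thesis by simp
    qed
    ultimately show ?thesis unfolding eq using True by (simp add: sum_distrib_right mult.assoc)
  next
    case False
    then have eq: "?E (Suc l) i = {}" using Suc.prems(1) by (force intro: bexI[of _ "Suc l"])
    show ?thesis unfolding eq using False by simp
  qed
qed

lemma forward_prob:
  assumes u: "u 0 = 0" "\<And>m. m < n \<Longrightarrow> u m \<le> u (Suc m)" and k: "k \<in> S"
  shows "prob {\<omega>\<in>space P. (\<forall>m\<le>n. X (u m) \<omega> \<in> B m) \<and> X (u n) \<omega> = k} = bk.fwd u B init n k"
  using forward_prob_aux[where n = n, OF u, where l = n and i = "\<lambda>_. k" and B = B] k by simp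

end

text \<open>Splits a concatenated grid at its joint, turning the result of the first piece into the
  initial row of the second, so that the two meshes can be refined independently.\<close>

lemma (in block_kernel) fwd_append:
  assumes "\<And>j. j \<le> m \<Longrightarrow> u j = u1 j" "\<And>j. j \<le> m \<Longrightarrow> B j = B1 j"
    "\<And>j. u (Suc m + j) = u2 j" "\<And>j. B (Suc m + j) = B2 j"
  shows "fwd u B x (Suc m + l) k = fwd u2 B2 (\<lambda>k. \<Sum>i\<in>S. fwd u1 B1 x m i * p (u1 m) (u2 0) i k) l k"
proof (induction l arbitrary: k)
  case 0
  have "fwd u B x m i = fwd u1 B1 x m i" for i using assms(1,2) by (intro fwd_cong) auto
  then show ?case using assms(1)[of m] assms(3)[of 0] assms(4)[of 0] by simp
next
  case (Suc l)
  then show ?case using assms(3)[of l] assms(3)[of "Suc l"] assms(4)[of "Suc l"] by simp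
qed

section \<open>Rounding up to the grid\<close>

text \<open>Rounding goes upwards because step paths are constant to the right of a point, not
  necessarily to the left: the rounded time eventually shows the same value. If
  \<open>a = b\<close>, the quotient and the index are 0.\<close>

definition grid_index :: "real \<Rightarrow> real \<Rightarrow> nat \<Rightarrow> real \<Rightarrow> nat" where
  "grid_index a b N v = nat \<lceil>(v - a) / ((b - a) / real (Suc N))\<rceil>"

lemma grid_index_bounds:
  assumes v: "v \<in> {a..b}"
  shows "grid_index a b N v \<le> Suc N" "v \<le> unif_grid a b N (grid_index a b N v)"
    "unif_grid a b N (grid_index a b N v) \<le> v + (b - a) / real (Suc N)"
proof -
  define h where "h = (b - a) / real (Suc N)"
  define q where "q = (v - a) / h"
  have k: "grid_index a b N v = nat \<lceil>q\<rceil>" by (simp add: grid_index_def q_def h_def)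
  have ug: "unif_grid a b N l = a + real l * h" for l by (simp add: unif_grid_def h_def)
  have h0: "h \<ge> 0" using v by (simp add: h_def)
  have q0: "q \<ge> 0" using v h0 by (simp add: q_def)
  have n: "real (nat \<lceil>q\<rceil>) = of_int \<lceil>q\<rceil>" using q0 by simp
  have qh: "q * h = v - a"
  proof (cases "h = 0")
    case True
    then have "a = b" by (simp add: h_def del: of_nat_Suc)
    then show ?thesis using v True by simp
  qed (simp add: q_def)
  have qN: "q \<le> real (Suc N)"
  proof (cases "h = 0")
    case False
    then have "h > 0" using h0 by simp
    moreover have "real (Suc N) * h = b - a" by (simp add: h_def del: of_nat_Suc)
    ultimately show ?thesis using v by (simp add: q_def pos_divide_le_eq del: of_nat_Suc)
  qed (simp add: q_def)
  then show "grid_index a b N v \<le> Suc N" unfolding k by (simp add: nat_le_iff ceiling_le_iff)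
  have "q * h \<le> of_int \<lceil>q\<rceil> * h" by (intro mult_right_mono h0) simp
  then show "v \<le> unif_grid a b N (grid_index a b N v)" unfolding k ug n using qh by simp
  have "of_int \<lceil>q\<rceil> * h \<le> (q + 1) * h" by (intro mult_right_mono h0) linarith
  then show "unif_grid a b N (grid_index a b N v) \<le> v + (b - a) / real (Suc N)"
    unfolding k ug n h_def[symmetric] using qh by (simp add: distrib_right)
qed

lemma step_path_grid_index:
  assumes f: "step_path f" and a: "0 \<le> a" and v: "v \<in> {a..b}"
  shows "\<forall>\<^sub>F N in sequentially. f (unif_grid a b N (grid_index a b N v)) = f v"
proof -
  obtain e where e: "e > 0" "\<And>x. x \<in> {v..<v+e} \<Longrightarrow> f x = f v"
    using f a v unfolding step_path_def by (metis atLeastAtMost_iff order_trans)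
  have "(\<lambda>N. (b - a) / real (Suc N)) \<longlonglongrightarrow> 0"
    using LIMSEQ_Suc[OF lim_const_over_n[of "b - a"]] by simp
  then have "\<forall>\<^sub>F N in sequentially. (b - a) / real (Suc N) < e"
    using e(1) by (intro order_tendstoD) auto
  then show ?thesis
  proof eventually_elim
    case (elim N)
    then show ?case using grid_index_bounds(2,3)[OF v, of N] by (intro e(2)) auto
  qed
qed

text \<open>A deviation from \<open>c\<close> at \<open>v\<close> is eventually visible at
  \<open>v\<close> rounded up to the grid. This trades uncountably many conditions for conditions on
  countably many finite grids.\<close>

lemma step_path_const_iff_grid:
  assumes f: "step_path f" and a: "0 \<le> a"
  shows "(\<forall>v\<in>{a..b}. f v = c) \<or> (\<forall>\<^sub>F N in sequentially. \<exists>l\<le>Suc N. f (unif_grid a b N l) \<noteq> c)"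
proof (rule disjCI)
  assume "\<not> (\<forall>\<^sub>F N in sequentially. \<exists>l\<le>Suc N. f (unif_grid a b N l) \<noteq> c)"
  then have fr: "\<exists>\<^sub>F N in sequentially. \<not> (\<exists>l\<le>Suc N. f (unif_grid a b N l) \<noteq> c)"
    by (simp add: frequently_def)
  show "\<forall>v\<in>{a..b}. f v = c"
  proof
    fix v assume v: "v \<in> {a..b}"
    from frequently_eventually_frequently[OF fr step_path_grid_index[OF f a v]]
    obtain N where "\<not> (\<exists>l\<le>Suc N. f (unif_grid a b N l) \<noteq> c)" "f (unif_grid a b N (grid_index a b N v)) = f v"
      by (auto dest: frequently_ex)
    then show "f v = c" using grid_index_bounds(1)[OF v, of N] by metis
  qed
qed

section \<open>Conditioning on the macrostates at grid times\<close>

lemma integrable_imp_set_integrable: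
  fixes f :: "'a \<Rightarrow> real"
  shows "A \<in> sets M \<Longrightarrow> integrable M f \<Longrightarrow> set_integrable M A f"
  unfolding set_integrable_def by (rule integrable_mult_indicator)

lemma (in prob_space) prob_tendsto_eventually:
  assumes "\<And>n. A n \<in> events" "B \<in> events"
    and "\<And>\<omega>. \<omega> \<in> space M \<Longrightarrow> \<forall>\<^sub>F n in sequentially. \<omega> \<in> A n \<longleftrightarrow> \<omega> \<in> B"
  shows "(\<lambda>n. prob (A n)) \<longlonglongrightarrow> prob B"
proof -
  have "(\<lambda>n. \<integral>\<omega>. indicator (A n) \<omega> \<partial>M) \<longlonglongrightarrow> (\<integral>\<omega>. indicator B \<omega> \<partial>M :: real)"
  proof (rule integral_dominated_convergence[where w = "\<lambda>_. 1"])
    show "AE \<omega> in M. (\<lambda>n. indicator (A n) \<omega>) \<longlonglongrightarrow> (indicator B \<omega> :: real)"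
    proof (rule AE_I2)
      fix \<omega> assume "\<omega> \<in> space M"
      from assms(3)[OF this] have "\<forall>\<^sub>F n in sequentially. indicator (A n) \<omega> = (indicator B \<omega> :: real)"
        by eventually_elim (simp add: indicator_def)
      then show "(\<lambda>n. indicator (A n) \<omega>) \<longlonglongrightarrow> (indicator B \<omega> :: real)" by (rule tendsto_eventually)
    qed
  qed (use assms(1,2) in \<open>auto simp: indicator_def\<close>)
  then show ?thesis using assms(1,2) by simp
qed

lemma change_scale_cong:
  "(\<And>l. l \<le> m \<Longrightarrow> w l = w' l) \<Longrightarrow> change_scale h w m = change_scale h w' m"
  by (induction m) auto

lemma change_scale_nonneg: "0 \<le> h \<Longrightarrow> 0 \<le> change_scale h w m"
  by (induction m) auto

lemma change_scale_pos: "0 < h \<Longrightarrow> 0 < change_scale h w m"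
  by (induction m) auto

lemma change_scale_const: "(\<And>l. l \<le> m \<Longrightarrow> w l = c) \<Longrightarrow> change_scale h w m = 1"
  by (induction m) auto

text \<open>Appending a letter contributes at most 1 for repeating the last one and at most
  \<open>J * h\<close> for all changes together. With mesh t / (N + 1) and N + 1 letters appended,
  the bound is at most J exp (J t), uniformly in \<open>N\<close>.\<close>

lemma sum_change_scale:
  assumes h: "0 \<le> h"
  shows "(\<Sum>w\<in>PiE {..m} (\<lambda>_. {..<J}). change_scale h w m) \<le> real J * (1 + real J * h) ^ m"
proof (induction m)
  case 0
  have "card (PiE {..0::nat} (\<lambda>_. {..<J})) = J" by (simp add: card_PiE)
  then show ?case by simp
next
  case (Suc m)
  let ?W = "PiE {..m} (\<lambda>_. {..<J})"
  have "PiE {..Suc m} (\<lambda>_. {..<J}) = (\<lambda>(y, g). g(Suc m := y)) ` ({..<J} \<times> ?W)"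
    unfolding atMost_Suc by (rule PiE_insert_eq)
  moreover have "inj_on (\<lambda>(y, g). g(Suc m := y)) ({..<J} \<times> ?W)"
    using inj_combinator[of "Suc m" "{..m}" "\<lambda>_. {..<J}"] by simp
  ultimately have "(\<Sum>w\<in>PiE {..Suc m} (\<lambda>_. {..<J}). change_scale h w (Suc m))
    = (\<Sum>(y, g)\<in>{..<J} \<times> ?W. change_scale h (g(Suc m := y)) (Suc m))"
    by (simp only: sum.reindex o_def case_prod_unfold)
  also have "\<dots> = (\<Sum>(y, g)\<in>{..<J} \<times> ?W. change_scale h g m * (if g m = y then 1 else h))"
  proof (intro sum.cong refl, clarify)
    fix y and g :: "nat \<Rightarrow> nat"
    have "change_scale h (g(Suc m := y)) m = change_scale h g m" by (intro change_scale_cong) auto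
    then show "change_scale h (g(Suc m := y)) (Suc m) = change_scale h g m * (if g m = y then 1 else h)" by simp
  qed
  also have "\<dots> = (\<Sum>g\<in>?W. change_scale h g m * (\<Sum>y<J. if g m = y then 1 else h))"
    by (subst sum.cartesian_product[symmetric], subst sum.swap) (simp add: sum_distrib_left)
  also have "\<dots> \<le> (\<Sum>g\<in>?W. change_scale h g m * (1 + real J * h))"
  proof (intro sum_mono mult_left_mono change_scale_nonneg h)
    fix g :: "nat \<Rightarrow> nat"
    have "(\<Sum>y<J. if g m = y then 1 else h) \<le> (\<Sum>y<J. (if g m = y then 1 else 0) + h)"
      using h by (intro sum_mono) auto
    also have "\<dots> \<le> 1 + real J * h" by (simp add: sum.distrib)
    finally show "(\<Sum>y<J. if g m = y then 1 else h) \<le> 1 + real J * h" .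
  qed
  also have "\<dots> = (1 + real J * h) * (\<Sum>g\<in>?W. change_scale h g m)"
    by (simp add: sum_distrib_left mult.commute)
  also have "\<dots> \<le> (1 + real J * h) * (real J * (1 + real J * h) ^ m)"
    using h by (intro mult_left_mono Suc.IH) auto
  finally show ?case by (simp add: mult.left_commute)
qed

section \<open>Observation of the macrostates along a grid\<close>

context aggregate_model
begin

definition word_event :: "real \<Rightarrow> nat \<Rightarrow> (nat \<Rightarrow> nat) \<Rightarrow> 'w set" where
  "word_event t N w = {\<omega>\<in>space P. \<forall>l\<le>Suc N. Z (unif_grid 0 t N l) \<omega> = w l}"

definition stay_event :: "real \<Rightarrow> real \<Rightarrow> nat \<times> nat \<Rightarrow> 'w set" where
  "stay_event r s st = {\<omega>\<in>space P. X s \<omega> = st \<and> (\<forall>v\<in>{r..s}. Z v \<omega> = fst st)}"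

definition word_row :: "real \<Rightarrow> nat \<Rightarrow> (nat \<Rightarrow> nat) \<Rightarrow> nat \<times> nat \<Rightarrow> real" where
  "word_row t N w = bk.fwd (unif_grid 0 t N) (\<lambda>l. {k. fst k = w l}) init (Suc N)"

lemma X_event: "0 \<le> t \<Longrightarrow> {\<omega>\<in>space P. X t \<omega> \<in> C} \<in> events"
  using measurable_sets[OF X_measurable, of t C] by (simp add: vimage_def Int_def conj_commute)

lemma Z_event: "0 \<le> t \<Longrightarrow> {\<omega>\<in>space P. Z t \<omega> \<in> C} \<in> events"
  using measurable_sets[OF Z_measurable, of t C] by (simp add: vimage_def Int_def conj_commute)

lemma grid_events:
  assumes "0 \<le> a" "a \<le> b"
  shows "{\<omega>\<in>space P. \<forall>l\<le>Suc N. Z (unif_grid a b N l) \<omega> = w l} \<in> events"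
proof -
  have "{\<omega>\<in>space P. \<forall>l\<in>{..Suc N}. Z (unif_grid a b N l) \<omega> \<in> {w l}} \<in> events"
  proof (intro sets.sets_Collect_finite_All Z_event)
    fix l assume "l \<in> {..Suc N}"
    then show "0 \<le> unif_grid a b N l" using unif_grid_bounds[OF assms(2), of l N] assms(1) by simp
  qed simp
  then show ?thesis by (simp only: Ball_def atMost_iff singleton_iff)
qed

lemma word_event_events: "0 \<le> t \<Longrightarrow> word_event t N w \<in> events"
  unfolding word_event_def by (rule grid_events) auto

lemma word_prob:
  assumes t: "0 \<le> t"
  shows "prob (word_event t N w) = (\<Sum>k\<in>S. word_row t N w k)"
proof -
  let ?u = "unif_grid 0 t N"
  let ?E = "\<lambda>k. {\<omega>\<in>space P. (\<forall>m\<le>Suc N. X (?u m) \<omega> \<in> {k. fst k = w m}) \<and> X (?u (Suc N)) \<omega> = k}"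
  have E: "?E k = word_event t N w \<inter> {\<omega>\<in>space P. X t \<omega> \<in> {k}}" for k
    by (auto simp: word_event_def macro_def)
  have ev: "?E k \<in> events" for k
    unfolding E using t by (intro sets.Int word_event_events X_event) auto
  have eq: "word_event t N w = (\<Union>k\<in>S. ?E k)"
    unfolding E using X_in t by (auto simp: word_event_def)
  have "prob (\<Union>k\<in>S. ?E k) = (\<Sum>k\<in>S. prob (?E k))"
  proof (rule finite_measure_finite_Union)
    show "?E ` S \<subseteq> events" using ev by blast
    show "disjoint_family_on ?E S" unfolding disjoint_family_on_def by blast
  qed simp
  moreover have "prob (?E k) = word_row t N w k" if k: "k \<in> S" for k
    unfolding word_row_def using t k by (intro forward_prob) (auto intro: unif_grid_mono)
  ultimately show ?thesis unfolding eq by simp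
qed

definition entry_row :: "real \<Rightarrow> nat \<Rightarrow> (nat \<Rightarrow> nat) \<Rightarrow> real \<Rightarrow> nat \<times> nat \<Rightarrow> real" where
  "entry_row t N w r k = (\<Sum>i\<in>S. word_row t N w i * full_kernel J d M t r i k)"

definition grid_stay :: "real \<Rightarrow> real \<Rightarrow> nat \<times> nat \<Rightarrow> nat \<Rightarrow> 'w set" where
  "grid_stay r s st L = {\<omega>\<in>space P. X s \<omega> = st \<and> (\<forall>l\<le>Suc L. Z (unif_grid r s L l) \<omega> = fst st)}"

lemma grid_stay_events:
  assumes "0 \<le> r" "r \<le> s"
  shows "grid_stay r s st L \<in> events"
proof -
  have "grid_stay r s st L = {\<omega>\<in>space P. X s \<omega> \<in> {st}} \<inter> {\<omega>\<in>space P. \<forall>l\<le>Suc L. Z (unif_grid r s L l) \<omega> = (\<lambda>_. fst st) l}"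
    by (auto simp: grid_stay_def)
  also have "\<dots> \<in> events" using assms by (intro sets.Int X_event grid_events) auto
  finally show ?thesis .
qed

text \<open>The observation grid up to \<open>t\<close> and the sojourn grid from \<open>r\<close>
  are joined by one transition from \<open>t\<close> to \<open>r\<close>, a step of length zero when
  \<open>r = t\<close>.\<close>

lemma word_grid_stay_prob:
  assumes t: "0 \<le> t" "t \<le> r" "r \<le> s" and st: "st \<in> S"
  shows "prob (word_event t N w \<inter> grid_stay r s st L)
    = bk.fwd (unif_grid r s L) (\<lambda>_. {k. fst k = fst st}) (entry_row t N w r) (Suc L) st"
proof -
  \<comment> \<open>Index \<open>Suc N\<close> is time \<open>t\<close> and index
    \<open>Suc (Suc N)\<close> is time \<open>r\<close>, where the second grid starts.\<close>
  define u where "u j = (if j \<le> Suc N then unif_grid 0 t N j else unif_grid r s L (j - Suc (Suc N)))" for j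
  define B where "B j = (if j \<le> Suc N then {k :: nat \<times> nat. fst k = w j} else {k. fst k = fst st})" for j
  let ?n = "Suc (Suc N) + Suc L"
  have mono: "u m \<le> u (Suc m)" if "m < ?n" for m
  proof -
    consider "Suc m \<le> Suc N" | "m = Suc N" | "m > Suc N" by linarith
    then show ?thesis
    proof cases
      case 1
      then show ?thesis using t by (auto simp: u_def intro: unif_grid_mono)
    next
      case 2
      then show ?thesis using t by (simp add: u_def)
    next
      case 3
      then show ?thesis using t by (auto simp: u_def intro: unif_grid_mono)
    qed
  qed
  have un: "u ?n = s" by (simp add: u_def)
  have "word_event t N w \<inter> grid_stay r s st L = {\<omega>\<in>space P. (\<forall>m\<le>?n. X (u m) \<omega> \<in> B m) \<and> X (u ?n) \<omega> = st}"
  proof (rule subset_antisym; rule subsetI)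
    fix \<omega> assume \<omega>: "\<omega> \<in> word_event t N w \<inter> grid_stay r s st L"
    have "X (u m) \<omega> \<in> B m" if "m \<le> ?n" for m
    proof (cases "m \<le> Suc N")
      case True
      then show ?thesis using \<omega> by (simp add: word_event_def macro_def u_def B_def)
    next
      case False
      then have "m - Suc (Suc N) \<le> Suc L" using that by simp
      then show ?thesis using \<omega> False by (simp add: grid_stay_def macro_def u_def B_def)
    qed
    then show "\<omega> \<in> {\<omega>\<in>space P. (\<forall>m\<le>?n. X (u m) \<omega> \<in> B m) \<and> X (u ?n) \<omega> = st}"
      unfolding un using \<omega> by (simp add: grid_stay_def)
  next
    fix \<omega> assume "\<omega> \<in> {\<omega>\<in>space P. (\<forall>m\<le>?n. X (u m) \<omega> \<in> B m) \<and> X (u ?n) \<omega> = st}"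
    then have \<omega>: "\<omega> \<in> space P" "X s \<omega> = st" and X: "\<And>m. m \<le> ?n \<Longrightarrow> X (u m) \<omega> \<in> B m"
      unfolding un by auto
    have "Z (unif_grid 0 t N l) \<omega> = w l" if "l \<le> Suc N" for l
      using X[of l] that by (simp add: u_def B_def macro_def)
    moreover have "Z (unif_grid r s L l) \<omega> = fst st" if "l \<le> Suc L" for l
      using X[of "Suc (Suc N) + l"] that by (simp add: u_def B_def macro_def)
    ultimately show "\<omega> \<in> word_event t N w \<inter> grid_stay r s st L"
      using \<omega> by (simp add: word_event_def grid_stay_def)
  qed
  also have "prob \<dots> = bk.fwd u B init ?n st"
    by (rule forward_prob) (use mono st in \<open>auto simp: u_def\<close>)
  also have "\<dots> = bk.fwd (unif_grid r s L) (\<lambda>_. {k. fst k = fst st})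
      (\<lambda>k. \<Sum>i\<in>S. bk.fwd (unif_grid 0 t N) (\<lambda>l. {k. fst k = w l}) init (Suc N) i
         * full_kernel J d M (unif_grid 0 t N (Suc N)) (unif_grid r s L 0) i k) (Suc L) st"
    by (rule bk.fwd_append) (auto simp: u_def B_def)
  also have "\<dots> = bk.fwd (unif_grid r s L) (\<lambda>_. {k. fst k = fst st}) (entry_row t N w r) (Suc L) st"
    unfolding unif_grid_end unif_grid_0 entry_row_def[abs_def] word_row_def ..
  finally show ?thesis .
qed

lemma grid_stay_eventually:
  assumes \<omega>: "\<omega> \<in> space P" and r: "0 \<le> r" "r \<le> s"
  shows "\<forall>\<^sub>F L in sequentially. \<omega> \<in> grid_stay r s st L \<longleftrightarrow> \<omega> \<in> stay_event r s st"
proof (cases "\<forall>v\<in>{r..s}. Z v \<omega> = fst st")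
  case True
  then have "\<omega> \<in> grid_stay r s st L \<longleftrightarrow> \<omega> \<in> stay_event r s st" for L
    using unif_grid_bounds[OF r(2)] by (auto simp: grid_stay_def stay_event_def)
  then show ?thesis by simp
next
  case False
  then have "\<forall>\<^sub>F L in sequentially. \<exists>l\<le>Suc L. Z (unif_grid r s L l) \<omega> \<noteq> fst st"
    using step_path_const_iff_grid[OF Z_step_path[OF \<omega>] r(1), of s "fst st"] by blast
  then show ?thesis
    by eventually_elim (use False in \<open>auto simp: grid_stay_def stay_event_def\<close>)
qed

lemma stay_event_events:
  assumes rs: "0 \<le> r" "r \<le> s"
  shows "stay_event r s st \<in> events"
proof -
  have "stay_event r s st = (\<Inter>L. grid_stay r s st L)"
  proof (rule subset_antisym; rule subsetI)
    fix \<omega> assume "\<omega> \<in> stay_event r s st"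
    then show "\<omega> \<in> (\<Inter>L. grid_stay r s st L)"
      using unif_grid_bounds[OF rs(2)] by (auto simp: grid_stay_def stay_event_def)
  next
    fix \<omega> assume *: "\<omega> \<in> (\<Inter>L. grid_stay r s st L)"
    then have "\<omega> \<in> space P" by (auto simp: grid_stay_def)
    from eventually_happens'[OF sequentially_bot grid_stay_eventually[OF this rs, of st]]
    show "\<omega> \<in> stay_event r s st" using * by auto
  qed
  then show ?thesis using grid_stay_events[OF rs] by auto
qed

text \<open>The sojourn grid is refined while the observation grid stays fixed: the events converge
  pathwise, and the recursion converges to the diagonal product integral.\<close>

lemma word_stay_prob:
  assumes t: "0 \<le> t" "t \<le> r" "r \<le> s" and st: "st \<in> S"
  shows "prob (word_event t N w \<inter> stay_event r s st) = (\<Sum>k\<in>S. word_row t N w k * future t r s st k)"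
proof (rule LIMSEQ_unique)
  have r: "0 \<le> r" using t by simp
  show "(\<lambda>L. prob (word_event t N w \<inter> grid_stay r s st L)) \<longlonglongrightarrow> prob (word_event t N w \<inter> stay_event r s st)"
  proof (rule prob_tendsto_eventually)
    fix \<omega> assume "\<omega> \<in> space P"
    from grid_stay_eventually[OF this r t(3), of st]
    show "\<forall>\<^sub>F L in sequentially. \<omega> \<in> word_event t N w \<inter> grid_stay r s st L \<longleftrightarrow> \<omega> \<in> word_event t N w \<inter> stay_event r s st"
      by eventually_elim simp
  qed (use t r in \<open>auto intro!: sets.Int word_event_events grid_stay_events stay_event_events\<close>)
  \<comment> \<open>The limit lemma wants a row supported in the final macrostate. Masking changes
    neither the recursion, which masks its initial row itself, nor the limit, as
    \<open>diag_kernel\<close> vanishes elsewhere.\<close>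
  let ?v = "\<lambda>k. of_bool (fst k = fst st) * entry_row t N w r k"
  have "(\<lambda>L. bk.fwd (unif_grid r s L) (\<lambda>_. {k. fst k = fst st}) ?v (Suc L) st) \<longlonglongrightarrow> (\<Sum>i\<in>S. ?v i * diag_kernel d M r s i st)"
    by (rule bk.fwd_const_limit) (use r t st in auto)
  moreover have "bk.fwd (unif_grid r s L) (\<lambda>_. {k. fst k = fst st}) ?v (Suc L) st = prob (word_event t N w \<inter> grid_stay r s st L)" for L
    unfolding word_grid_stay_prob[OF t st] by (rule bk.fwd_cong_init) (use st in auto)
  moreover have "(\<Sum>i\<in>S. ?v i * diag_kernel d M r s i st) = (\<Sum>i\<in>S. entry_row t N w r i * diag_kernel d M r s i st)"
    by (intro sum.cong) (auto simp: diag_kernel_def)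
  moreover have "\<dots> = (\<Sum>k\<in>S. word_row t N w k * future t r s st k)"
    unfolding entry_row_def future_def sum_distrib_left sum_distrib_right
    by (subst sum.swap) (simp add: mult.assoc)
  ultimately show "(\<lambda>L. prob (word_event t N w \<inter> grid_stay r s st L)) \<longlonglongrightarrow> (\<Sum>k\<in>S. word_row t N w k * future t r s st k)"
    by simp
qed

definition words :: "nat \<Rightarrow> (nat \<Rightarrow> nat) set" where
  "words N = PiE {..Suc N} (\<lambda>_. {..<J})"

text \<open>\<open>restrict\<close> makes equal observations equal as functions, so the word lies in
  the finite set \<open>words N\<close> and agreement on the grid becomes equality.\<close>

definition path_word :: "real \<Rightarrow> nat \<Rightarrow> 'w \<Rightarrow> nat \<Rightarrow> nat" where
  "path_word t N \<omega> = restrict (\<lambda>l. Z (unif_grid 0 t N l) \<omega>) {..Suc N}"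

lemma finite_words: "finite (words N)"
  unfolding words_def by (intro finite_PiE) auto

lemma path_word_in: "\<omega> \<in> space P \<Longrightarrow> 0 \<le> t \<Longrightarrow> path_word t N \<omega> \<in> words N"
  unfolding path_word_def words_def
  using unif_grid_bounds[of 0 t _ N] by (auto intro!: Z_less)

lemma word_event_iff: "\<omega> \<in> space P \<Longrightarrow> w \<in> words N \<Longrightarrow> \<omega> \<in> word_event t N w \<longleftrightarrow> path_word t N \<omega> = w"
  unfolding word_event_def path_word_def words_def
  by (auto simp: fun_eq_iff restrict_def PiE_def extensional_def)

lemma word_fun_expand:
  assumes "\<omega> \<in> space P" "0 \<le> t"
  shows "\<phi> (path_word t N \<omega>) = (\<Sum>w\<in>words N. \<phi> w * indicator (word_event t N w) \<omega> :: real)"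
proof -
  have "(\<Sum>w\<in>words N. \<phi> w * indicator (word_event t N w) \<omega>) = (\<Sum>w\<in>words N. if path_word t N \<omega> = w then \<phi> w else 0)"
    using word_event_iff[OF assms(1)] by (intro sum.cong) (auto simp: indicator_def)
  then show ?thesis using path_word_in[OF assms] finite_words by simp
qed

lemma word_fun_measurable:
  assumes "0 \<le> t" "space F = space P" "\<And>w. word_event t N w \<in> sets F"
  shows "(\<lambda>\<omega>. \<phi> (path_word t N \<omega>) :: real) \<in> borel_measurable F"
proof -
  have "(\<lambda>\<omega>. \<Sum>w\<in>words N. \<phi> w * indicator (word_event t N w) \<omega> :: real) \<in> borel_measurable F"
    using assms(3) by (intro borel_measurable_sum borel_measurable_times) auto
  then show ?thesis
    using word_fun_expand[OF _ assms(1)] assms(2) by (subst measurable_cong) auto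
qed

lemma word_integral:
  assumes t: "0 \<le> t" and B: "B \<in> events"
  shows "(\<integral>\<omega>. \<phi> (path_word t N \<omega>) * indicator B \<omega> \<partial>P) = (\<Sum>w\<in>words N. \<phi> w * prob (word_event t N w \<inter> B))"
proof -
  have "(\<integral>\<omega>. \<phi> (path_word t N \<omega>) * indicator B \<omega> \<partial>P)
    = (\<integral>\<omega>. (\<Sum>w\<in>words N. \<phi> w * indicator (word_event t N w \<inter> B) \<omega>) \<partial>P)"
    using word_fun_expand[OF _ t, of _ \<phi> N]
    by (intro Bochner_Integration.integral_cong) (auto simp: sum_distrib_right indicator_inter_arith mult.assoc)
  also have "\<dots> = (\<Sum>w\<in>words N. \<phi> w * prob (word_event t N w \<inter> B))"
    using word_event_events[OF t] B
    by (subst Bochner_Integration.integral_sum) (auto intro!: Bochner_Integration.integrable_mult_right simp: emeasure_eq_measure)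
  finally show ?thesis .
qed

end

section \<open>Passage to the continuous-time filtration\<close>

context aggregate_model
begin

declare change_scale.simps(2) [simp del]

lemma path_row_limit:
  assumes \<omega>: "\<omega> \<in> space P" and t: "0 \<le> t" and k: "k \<in> S"
  shows "(\<lambda>N. word_row t N (path_word t N \<omega>) k / change_scale (t / real (Suc N)) (path_word t N \<omega>) (Suc N))
    \<longlonglongrightarrow> bk.path_state init (\<lambda>u. Z u \<omega>) t k"
proof -
  have w: "path_word t N \<omega> l = Z (unif_grid 0 t N l) \<omega>" if "l \<le> Suc N" for N l
    using that by (simp add: path_word_def)
  have "word_row t N (path_word t N \<omega>) k
      = bk.fwd (unif_grid 0 t N) (\<lambda>l. {k. fst k = Z (unif_grid 0 t N l) \<omega>}) init (Suc N) k" for N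
    unfolding word_row_def using w by (intro bk.fwd_cong) auto
  moreover have "change_scale (t / real (Suc N)) (path_word t N \<omega>) (Suc N)
      = change_scale (t / real (Suc N)) (\<lambda>l. Z (unif_grid 0 t N l) \<omega>) (Suc N)" for N
    using w by (intro change_scale_cong) auto
  ultimately show ?thesis
    using bk.fwd_path_limit[OF Z_step_path[OF \<omega>] t k, of init] by (simp only:)
qed

section \<open>Almost sure positivity of the limiting likelihood\<close>

text \<open>The total mass of the unnormalised filter, hence the denominator of the formula: the
  likelihood of the observed macro path, a density in its jump times.\<close>

definition path_lik :: "real \<Rightarrow> 'w \<Rightarrow> real" where
  "path_lik t \<omega> = (\<Sum>k\<in>S. bk.path_state init (\<lambda>u. Z u \<omega>) t k)"

definition scaled_lik :: "real \<Rightarrow> nat \<Rightarrow> (nat \<Rightarrow> nat) \<Rightarrow> real" where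
  "scaled_lik t N w = prob (word_event t N w) / change_scale (t / real (Suc N)) w (Suc N)"

lemma scaled_lik_limit:
  assumes "\<omega> \<in> space P" "0 \<le> t"
  shows "(\<lambda>N. scaled_lik t N (path_word t N \<omega>)) \<longlonglongrightarrow> path_lik t \<omega>"
  unfolding scaled_lik_def path_lik_def word_prob[OF assms(2)] sum_divide_distrib
  by (intro tendsto_sum path_row_limit assms)

lemma scaled_lik_nonneg: "0 \<le> t \<Longrightarrow> 0 \<le> scaled_lik t N w"
  unfolding scaled_lik_def by (intro divide_nonneg_nonneg change_scale_nonneg) auto

lemma path_lik_nonneg: "\<omega> \<in> space P \<Longrightarrow> 0 \<le> t \<Longrightarrow> 0 \<le> path_lik t \<omega>"
  by (rule LIMSEQ_le_const[OF scaled_lik_limit]) (auto simp: scaled_lik_nonneg)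

text \<open>For \<open>t = 0\<close> the mesh is 0, but then all grid points coincide and no change
  is recorded, so the mesh never enters as a factor.\<close>

lemma path_scale_pos:
  assumes t: "0 \<le> t"
  shows "0 < change_scale (t / real (Suc N)) (path_word t N \<omega>) (Suc N)"
proof (cases "t = 0")
  case True
  then have "path_word t N \<omega> l = Z 0 \<omega>" if "l \<le> Suc N" for l
    using that by (simp add: path_word_def unif_grid_def)
  then show ?thesis by (subst change_scale_const) auto
next
  case False
  then show ?thesis using t by (intro change_scale_pos) simp
qed

lemma path_lik_measurable:
  assumes t: "0 \<le> t"
  shows "path_lik t \<in> borel_measurable P"
  by (rule borel_measurable_LIMSEQ_real[OF scaled_lik_limit[OF _ t]])
    (assumption | rule word_fun_measurable[OF t refl word_event_events[OF t]])+

text \<open>The function \<epsilon>/(\<epsilon> + x) is bounded and continuous on x \<ge> 0 and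
  equals 1 at 0, so its mean dominates the probability of zero likelihood and passes to the limit. A
  word's probability is its scale times its scaled likelihood, so it contributes at most \<epsilon>
  times its scale.\<close>

lemma scaled_lik_integral_bound:
  assumes t: "0 \<le> t" and \<epsilon>: "0 < \<epsilon>"
  shows "(\<integral>\<omega>. \<epsilon> / (\<epsilon> + scaled_lik t N (path_word t N \<omega>)) \<partial>P) \<le> \<epsilon> * (real J * exp (real J * t))"
proof -
  let ?h = "t / real (Suc N)"
  have h: "0 \<le> ?h" using t by simp
  have "(\<integral>\<omega>. \<epsilon> / (\<epsilon> + scaled_lik t N (path_word t N \<omega>)) \<partial>P)
    = (\<integral>\<omega>. \<epsilon> / (\<epsilon> + scaled_lik t N (path_word t N \<omega>)) * indicator (space P) \<omega> \<partial>P)"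
    by (intro Bochner_Integration.integral_cong) auto
  also have "\<dots> = (\<Sum>w\<in>words N. \<epsilon> / (\<epsilon> + scaled_lik t N w) * prob (word_event t N w \<inter> space P))"
    by (rule word_integral[OF t, of _ "\<lambda>w. \<epsilon> / (\<epsilon> + scaled_lik t N w)"]) simp
  also have "\<dots> \<le> (\<Sum>w\<in>words N. \<epsilon> * change_scale ?h w (Suc N))"
  proof (rule sum_mono)
    fix w :: "nat \<Rightarrow> nat" assume w: "w \<in> words N"
    let ?c = "change_scale ?h w (Suc N)"
    have W: "word_event t N w \<inter> space P = word_event t N w" unfolding word_event_def by blast
    show "\<epsilon> / (\<epsilon> + scaled_lik t N w) * prob (word_event t N w \<inter> space P) \<le> \<epsilon> * ?c"
    proof (cases "word_event t N w = {}")
      case True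
      then show ?thesis using \<epsilon> change_scale_nonneg[OF h, of w "Suc N"] by simp
    next
      case False
      \<comment> \<open>A nonempty word event is realised by an actual path, which makes the scale
        positive even for \<open>t = 0\<close>.\<close>
      then obtain \<omega> where "\<omega> \<in> word_event t N w" by blast
      then have "w = path_word t N \<omega>" using word_event_iff[of \<omega> w N t] w by (auto simp: word_event_def)
      then have c: "0 < ?c" using path_scale_pos[OF t] by simp
      have pos: "0 < \<epsilon> + scaled_lik t N w" using \<epsilon> scaled_lik_nonneg[OF t] by (simp add: add_pos_nonneg)
      have "prob (word_event t N w) = ?c * scaled_lik t N w" using c by (simp add: scaled_lik_def)
      also have "\<dots> \<le> ?c * (\<epsilon> + scaled_lik t N w)" using c \<epsilon> by (intro mult_left_mono) auto
      finally have "\<epsilon> * prob (word_event t N w) \<le> \<epsilon> * (?c * (\<epsilon> + scaled_lik t N w))"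
        using \<epsilon> by (intro mult_left_mono) auto
      then show ?thesis unfolding W using pos by (simp add: pos_divide_le_eq mult.assoc)
    qed
  qed
  also have "\<dots> = \<epsilon> * (\<Sum>w\<in>words N. change_scale ?h w (Suc N))" by (simp only: sum_distrib_left)
  also have "\<dots> \<le> \<epsilon> * (real J * (1 + real J * ?h) ^ Suc N)"
    unfolding words_def using \<epsilon> by (intro mult_left_mono sum_change_scale h) auto
  also have "\<dots> \<le> \<epsilon> * (real J * exp (real J * t))"
  proof (intro mult_left_mono)
    have "0 \<le> real J * ?h" using h by (intro mult_nonneg_nonneg) auto
    then have "(1 + real J * ?h) ^ Suc N \<le> exp (real J * ?h) ^ Suc N"
      using exp_ge_add_one_self[of "real J * ?h"] by (intro power_mono) linarith+
    also have "\<dots> = exp (real (Suc N) * (real J * ?h))" by (simp only: exp_of_nat_mult)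
    also have "real (Suc N) * (real J * ?h) = real J * t" by (simp del: of_nat_Suc)
    finally show "(1 + real J * ?h) ^ Suc N \<le> exp (real J * t)" .
  qed (use \<epsilon> in auto)
  finally show ?thesis .
qed

lemma AE_path_lik_nonzero:
  assumes t: "0 \<le> t"
  shows "AE \<omega> in P. path_lik t \<omega> \<noteq> 0"
proof -
  note [measurable] = path_lik_measurable[OF t]
  let ?Z = "{\<omega>\<in>space P. path_lik t \<omega> = 0}"
  define C where "C = real J * exp (real J * t)"
  have ev: "?Z \<in> events" by measurable
  have le: "prob ?Z \<le> \<epsilon> * C" if \<epsilon>: "0 < \<epsilon>" for \<epsilon>
  proof -
    let ?f = "\<lambda>x. \<epsilon> / (\<epsilon> + x) :: real"
    have f: "0 \<le> ?f x" "?f x \<le> 1" if "0 \<le> x" for x using \<epsilon> that by auto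
    have m: "(\<lambda>\<omega>. ?f (scaled_lik t N (path_word t N \<omega>))) \<in> borel_measurable P" for N
      by (rule word_fun_measurable[OF t refl word_event_events[OF t], of "\<lambda>w. ?f (scaled_lik t N w)"])
    have "(\<lambda>N. \<integral>\<omega>. ?f (scaled_lik t N (path_word t N \<omega>)) \<partial>P) \<longlonglongrightarrow> (\<integral>\<omega>. ?f (path_lik t \<omega>) \<partial>P)"
    proof (rule integral_dominated_convergence[where w = "\<lambda>_. 1"])
      show "AE \<omega> in P. (\<lambda>N. ?f (scaled_lik t N (path_word t N \<omega>))) \<longlonglongrightarrow> ?f (path_lik t \<omega>)"
      proof (rule AE_I2)
        fix \<omega> assume \<omega>: "\<omega> \<in> space P"
        have "\<epsilon> + path_lik t \<omega> \<noteq> 0" using path_lik_nonneg[OF \<omega> t] \<epsilon> by linarith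
        then show "(\<lambda>N. ?f (scaled_lik t N (path_word t N \<omega>))) \<longlonglongrightarrow> ?f (path_lik t \<omega>)"
          by (intro tendsto_intros scaled_lik_limit \<omega> t)
      qed
      show "AE \<omega> in P. norm (?f (scaled_lik t N (path_word t N \<omega>))) \<le> 1" for N
        using f[OF scaled_lik_nonneg[OF t]] by (intro AE_I2) (simp only: real_norm_def abs_of_nonneg)
    qed (use m in auto)
    moreover have "(\<integral>\<omega>. ?f (scaled_lik t N (path_word t N \<omega>)) \<partial>P) \<le> \<epsilon> * C" for N
      unfolding C_def by (rule scaled_lik_integral_bound[OF t \<epsilon>])
    ultimately have 1: "(\<integral>\<omega>. ?f (path_lik t \<omega>) \<partial>P) \<le> \<epsilon> * C"
      by (intro LIMSEQ_le_const2) auto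
    have "prob ?Z = (\<integral>\<omega>. indicator ?Z \<omega> \<partial>P)" using ev by simp
    also have "\<dots> \<le> (\<integral>\<omega>. ?f (path_lik t \<omega>) \<partial>P)"
    proof (rule integral_mono)
      show "integrable P (indicator ?Z :: 'w \<Rightarrow> real)" using ev by (simp add: emeasure_eq_measure)
      show "integrable P (\<lambda>\<omega>. ?f (path_lik t \<omega>))"
      proof (rule integrable_const_bound[where B = 1])
        show "AE \<omega> in P. norm (?f (path_lik t \<omega>)) \<le> 1"
          using f path_lik_nonneg[OF _ t] by (intro AE_I2) (simp only: real_norm_def abs_of_nonneg)
      qed measurable
      fix \<omega> assume "\<omega> \<in> space P"
      then show "indicator ?Z \<omega> \<le> ?f (path_lik t \<omega>)"
        using f(1)[OF path_lik_nonneg[OF _ t]] \<epsilon> by (auto simp: indicator_def)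
    qed
    finally show ?thesis using 1 by simp
  qed
  have C0: "0 \<le> C" by (simp add: C_def)
  have "prob ?Z \<le> 0 + e" if e: "0 < e" for e :: real
  proof -
    \<comment> \<open>The estimate at \<epsilon> = e / (C + 1), a quotient that is defined even if
      \<open>C\<close> is 0.\<close>
    have "prob ?Z \<le> e / (C + 1) * C" using e C0 by (intro le) auto
    also have "\<dots> \<le> e" using e C0 by (simp add: pos_divide_le_eq)
    finally show ?thesis by simp
  qed
  then have "prob ?Z \<le> 0" by (rule field_le_epsilon)
  then have "prob ?Z = 0" by (simp add: measure_le_0_iff)
  then show ?thesis using prob_Collect_eq_0[OF ev] by simp
qed

section \<open>From elementary conditioning to the conditional expectation\<close>

text \<open>The elementary conditional probability of \<open>B\<close> given a word, with default 0
  for words of probability 0.\<close>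

definition stay_ratio :: "real \<Rightarrow> nat \<Rightarrow> 'w set \<Rightarrow> (nat \<Rightarrow> nat) \<Rightarrow> real" where
  "stay_ratio t N B w = prob (word_event t N w \<inter> B) / prob (word_event t N w)"

lemma stay_ratio_bounds:
  assumes "0 \<le> t"
  shows "0 \<le> stay_ratio t N B w" "stay_ratio t N B w \<le> 1"
proof -
  have "prob (word_event t N w \<inter> B) \<le> prob (word_event t N w)"
    using word_event_events[OF assms] by (intro finite_measure_mono) auto
  then show "stay_ratio t N B w \<le> 1"
    unfolding stay_ratio_def by (simp add: divide_le_eq_1 order_less_le)
qed (simp add: stay_ratio_def)

text \<open>The scale divides numerator and denominator alike and cancels, so the unscaled ratio
  inherits the limit of the scaled rows wherever the limiting mass is not 0.\<close>

lemma stay_ratio_limit: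
  assumes \<omega>: "\<omega> \<in> space P" and t: "0 \<le> t" "t \<le> r" "r \<le> s" and st: "st \<in> S" and nz: "path_lik t \<omega> \<noteq> 0"
  shows "(\<lambda>N. stay_ratio t N (stay_event r s st) (path_word t N \<omega>)) \<longlonglongrightarrow>
    (\<Sum>k\<in>S. bk.path_state init (\<lambda>u. Z u \<omega>) t k * future t r s st k) / path_lik t \<omega>"
proof -
  define c where "c N = change_scale (t / real (Suc N)) (path_word t N \<omega>) (Suc N)" for N
  have c: "c N \<noteq> 0" for N
    unfolding c_def by (rule less_imp_neq[OF path_scale_pos[OF t(1)], THEN not_sym])
  have "(\<lambda>N. (\<Sum>k\<in>S. word_row t N (path_word t N \<omega>) k / c N * future t r s st k)
      / (\<Sum>k\<in>S. word_row t N (path_word t N \<omega>) k / c N)) \<longlonglongrightarrow>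
    (\<Sum>k\<in>S. bk.path_state init (\<lambda>u. Z u \<omega>) t k * future t r s st k) / path_lik t \<omega>"
    unfolding path_lik_def
    by (intro tendsto_intros path_row_limit[OF \<omega> t(1), folded c_def] nz[unfolded path_lik_def])
  moreover have "(\<Sum>k\<in>S. word_row t N (path_word t N \<omega>) k / c N * future t r s st k)
      / (\<Sum>k\<in>S. word_row t N (path_word t N \<omega>) k / c N) = stay_ratio t N (stay_event r s st) (path_word t N \<omega>)" for N
  proof -
    have "(\<Sum>k\<in>S. word_row t N (path_word t N \<omega>) k / c N * future t r s st k)
      = prob (word_event t N (path_word t N \<omega>) \<inter> stay_event r s st) / c N"
      unfolding word_stay_prob[OF t st] sum_divide_distrib by simp
    moreover have "(\<Sum>k\<in>S. word_row t N (path_word t N \<omega>) k / c N) = prob (word_event t N (path_word t N \<omega>)) / c N"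
      unfolding word_prob[OF t(1)] sum_divide_distrib by simp
    ultimately show ?thesis using c[of N] by (simp add: stay_ratio_def)
  qed
  ultimately show ?thesis by simp
qed

definition cylinder :: "real set \<Rightarrow> (real \<Rightarrow> nat set) \<Rightarrow> 'w set" where
  "cylinder U C = {\<omega>\<in>space P. \<forall>v\<in>U. Z v \<omega> \<in> C v}"

lemma cylinder_events: "finite U \<Longrightarrow> U \<subseteq> {0..t} \<Longrightarrow> cylinder U C \<in> events"
  unfolding cylinder_def by (intro sets.sets_Collect_finite_All Z_event) auto

text \<open>For each grid this is elementary conditioning on a finite partition, tested against a
  function of the word that imitates the cylinder with its times rounded up. Both integrands are
  bounded by 1 and converge, so the grids need not be nested.\<close>

lemma cylinder_integral:
  assumes t: "0 \<le> t" and U: "finite U" "U \<subseteq> {0..t}" and B: "B \<in> events" and g: "g \<in> borel_measurable P"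
    and lim: "AE \<omega> in P. (\<lambda>N. stay_ratio t N B (path_word t N \<omega>)) \<longlonglongrightarrow> g \<omega>"
  shows "(\<integral>\<omega>. indicator (cylinder U C) \<omega> * indicator B \<omega> \<partial>P) = (\<integral>\<omega>. indicator (cylinder U C) \<omega> * g \<omega> \<partial>P)"
proof -
  let ?A = "cylinder U C"
  define inC :: "nat \<Rightarrow> (nat \<Rightarrow> nat) \<Rightarrow> real" where
    "inC N w = of_bool (\<forall>v\<in>U. w (grid_index 0 t N v) \<in> C v)" for N w
  have [measurable]: "?A \<in> events" by (rule cylinder_events[OF U])
  note [measurable] = B g
  have wm: "(\<lambda>\<omega>. \<phi> (path_word t N \<omega>) :: real) \<in> borel_measurable P" for \<phi> N
    by (rule word_fun_measurable[OF t refl word_event_events[OF t]])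
  have inC_ev: "\<forall>\<^sub>F N in sequentially. inC N (path_word t N \<omega>) = indicator ?A \<omega>" if \<omega>: "\<omega> \<in> space P" for \<omega>
  proof -
    have "\<forall>\<^sub>F N in sequentially. \<forall>v\<in>U. Z (unif_grid 0 t N (grid_index 0 t N v)) \<omega> = Z v \<omega>"
      using U step_path_grid_index[OF Z_step_path[OF \<omega>], of 0 _ t]
      by (intro eventually_ball_finite) auto
    then show ?thesis
    proof eventually_elim
      case (elim N)
      have "path_word t N \<omega> (grid_index 0 t N v) = Z v \<omega>" if "v \<in> U" for v
        using elim that U grid_index_bounds(1)[of v 0 t N] by (auto simp: path_word_def)
      then show ?case using \<omega> by (auto simp: inC_def cylinder_def indicator_def)
    qed
  qed
  have eq: "(\<integral>\<omega>. inC N (path_word t N \<omega>) * indicator B \<omega> \<partial>P)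
      = (\<integral>\<omega>. inC N (path_word t N \<omega>) * stay_ratio t N B (path_word t N \<omega>) \<partial>P)" for N
  proof -
    have "(\<integral>\<omega>. inC N (path_word t N \<omega>) * stay_ratio t N B (path_word t N \<omega>) \<partial>P)
      = (\<integral>\<omega>. (\<lambda>w. inC N w * stay_ratio t N B w) (path_word t N \<omega>) * indicator (space P) \<omega> \<partial>P)"
      by (intro Bochner_Integration.integral_cong) auto
    also have "\<dots> = (\<Sum>w\<in>words N. (inC N w * stay_ratio t N B w) * prob (word_event t N w \<inter> space P))"
      by (rule word_integral[OF t]) simp
    also have "\<dots> = (\<Sum>w\<in>words N. inC N w * prob (word_event t N w \<inter> B))"
    proof (intro sum.cong refl)
      fix w
      have W: "word_event t N w \<inter> space P = word_event t N w" unfolding word_event_def by blast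
      have "prob (word_event t N w \<inter> B) \<le> prob (word_event t N w)"
        using word_event_events[OF t] by (intro finite_measure_mono) auto
      \<comment> \<open>A word of probability 0 contributes nothing on either side, whatever the
        quotient.\<close>
      then show "(inC N w * stay_ratio t N B w) * prob (word_event t N w \<inter> space P) = inC N w * prob (word_event t N w \<inter> B)"
        unfolding W by (cases "prob (word_event t N w) = 0") (auto simp: stay_ratio_def measure_le_0_iff)
    qed
    also have "\<dots> = (\<integral>\<omega>. inC N (path_word t N \<omega>) * indicator B \<omega> \<partial>P)"
      by (rule word_integral[OF t B, symmetric])
    finally show ?thesis by simp
  qed
  have "(\<lambda>N. \<integral>\<omega>. inC N (path_word t N \<omega>) * indicator B \<omega> \<partial>P) \<longlonglongrightarrow> (\<integral>\<omega>. indicator ?A \<omega> * indicator B \<omega> \<partial>P)"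
  proof (rule integral_dominated_convergence[where w = "\<lambda>_. 1"])
    show "AE \<omega> in P. (\<lambda>N. inC N (path_word t N \<omega>) * indicator B \<omega>) \<longlonglongrightarrow> indicator ?A \<omega> * indicator B \<omega>"
      by (intro AE_I2 tendsto_mult tendsto_const tendsto_eventually inC_ev)
    show "AE \<omega> in P. norm (inC N (path_word t N \<omega>) * indicator B \<omega>) \<le> 1" for N
      by (intro AE_I2) (simp add: inC_def indicator_def)
    show "(\<lambda>\<omega>. inC N (path_word t N \<omega>) * indicator B \<omega>) \<in> borel_measurable P" for N
      using wm B by (intro borel_measurable_times) auto
  qed auto
  moreover have "(\<lambda>N. \<integral>\<omega>. inC N (path_word t N \<omega>) * stay_ratio t N B (path_word t N \<omega>) \<partial>P)
      \<longlonglongrightarrow> (\<integral>\<omega>. indicator ?A \<omega> * g \<omega> \<partial>P)"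
  proof (rule integral_dominated_convergence[where w = "\<lambda>_. 1"])
    show "AE \<omega> in P. (\<lambda>N. inC N (path_word t N \<omega>) * stay_ratio t N B (path_word t N \<omega>)) \<longlonglongrightarrow> indicator ?A \<omega> * g \<omega>"
      using lim AE_space
    proof eventually_elim
      case (elim \<omega>)
      show ?case by (rule tendsto_mult[OF tendsto_eventually[OF inC_ev[OF elim(2)]] elim(1)])
    qed
    show "AE \<omega> in P. norm (inC N (path_word t N \<omega>) * stay_ratio t N B (path_word t N \<omega>)) \<le> 1" for N
      using stay_ratio_bounds[OF t, of N B] by (intro AE_I2) (simp add: inC_def abs_le_iff)
    show "(\<lambda>\<omega>. inC N (path_word t N \<omega>) * stay_ratio t N B (path_word t N \<omega>)) \<in> borel_measurable P" for N
      by (rule wm[of "\<lambda>w. inC N w * stay_ratio t N B w"])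
  qed auto
  ultimately show ?thesis unfolding eq by (rule LIMSEQ_unique)
qed

lemma space_natfilt [simp]: "space (natfilt P Z t) = space P"
  unfolding natfilt_def by (rule space_measure_of) auto

lemma sets_natfilt: "sets (natfilt P Z t) = sigma_sets (space P) {Z u -` {i} \<inter> space P | u i. u \<in> {0..t}}"
  unfolding natfilt_def by (intro sets_measure_of) auto

lemma natfilt_Z_event:
  assumes "v \<in> {0..t}"
  shows "{\<omega>\<in>space P. Z v \<omega> \<in> C} \<in> sets (natfilt P Z t)"
proof -
  have "{\<omega>\<in>space P. Z v \<omega> \<in> C} = (\<Union>i\<in>C. Z v -` {i} \<inter> space P)" by auto
  also have "\<dots> \<in> sets (natfilt P Z t)"
  proof (rule sets.countable_UN'')
    fix i
    show "Z v -` {i} \<inter> space P \<in> sets (natfilt P Z t)"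
      unfolding sets_natfilt using assms by (intro sigma_sets.Basic) blast
  qed (rule countableI_type)
  finally show ?thesis .
qed

lemma natfilt_subalgebra: "subalgebra P (natfilt P Z t)"
  unfolding subalgebra_def
proof (intro conjI)
  show "sets (natfilt P Z t) \<subseteq> events"
    unfolding sets_natfilt
  proof (rule sets.sigma_sets_subset, safe)
    fix u i assume "u \<in> {0..t}"
    then show "Z u -` {i} \<inter> space P \<in> events" by (intro measurable_sets[OF Z_measurable]) auto
  qed
qed simp

lemma natfilt_grid_events:
  assumes "0 \<le> a" "a \<le> b" "b \<le> t"
  shows "{\<omega>\<in>space P. \<forall>l\<le>Suc N. Z (unif_grid a b N l) \<omega> = w l} \<in> sets (natfilt P Z t)"
proof -
  have "{\<omega>\<in>space (natfilt P Z t). \<forall>l\<in>{..Suc N}. Z (unif_grid a b N l) \<omega> \<in> {w l}} \<in> sets (natfilt P Z t)"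
  proof (intro sets.sets_Collect_finite_All)
    fix l assume "l \<in> {..Suc N}"
    then have "unif_grid a b N l \<in> {0..t}" using unif_grid_bounds[OF assms(2), of l N] assms by auto
    from natfilt_Z_event[OF this, of "{w l}"]
    show "{\<omega>\<in>space (natfilt P Z t). Z (unif_grid a b N l) \<omega> \<in> {w l}} \<in> sets (natfilt P Z t)"
      by simp
  qed simp
  then show ?thesis by (simp only: Ball_def atMost_iff singleton_iff space_natfilt)
qed

text \<open>Dynkin's theorem for the cylinders, which are stable under intersection. The cylinder
  over no times is the whole space and supplies the total integral 0 used for complements.\<close>

lemma natfilt_induct:
  assumes h: "integrable P (h :: 'w \<Rightarrow> real)"
    and cyl: "\<And>U C. finite U \<Longrightarrow> U \<subseteq> {0..t} \<Longrightarrow> (LINT \<omega>:cylinder U C|P. h \<omega>) = 0"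
    and A: "A \<in> sets (natfilt P Z t)"
  shows "(LINT \<omega>:A|P. h \<omega>) = 0"
proof -
  let ?G = "{cylinder U C | U C. finite U \<and> U \<subseteq> {0..t}}"
  have G_ev: "?G \<subseteq> events" using cylinder_events by blast
  have ev: "sigma_sets (space P) ?G \<subseteq> events" by (rule sets.sigma_sets_subset[OF G_ev])
  have "Int_stable ?G"
  proof (rule Int_stableI, safe)
    fix U U' and C C' :: "real \<Rightarrow> nat set" assume U: "finite U" "U \<subseteq> {0..t}" "finite U'" "U' \<subseteq> {0..t}"
    \<comment> \<open>Times that occur in one of the two cylinders only are unconstrained by the
      other, hence \<open>UNIV\<close>.\<close>
    let ?C = "\<lambda>v. (if v \<in> U then C v else UNIV) \<inter> (if v \<in> U' then C' v else UNIV)"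
    have "cylinder U C \<inter> cylinder U' C' = cylinder (U \<union> U') ?C"
      by (auto simp: cylinder_def split: if_splits)
    then show "\<exists>V D. cylinder U C \<inter> cylinder U' C' = cylinder V D \<and> finite V \<and> V \<subseteq> {0..t}"
      using U by blast
  qed
  moreover have "?G \<subseteq> Pow (space P)" by (auto simp: cylinder_def)
  moreover have "A \<in> sigma_sets (space P) ?G"
  proof -
    have "{Z u -` {i} \<inter> space P | u i. u \<in> {0..t}} \<subseteq> ?G"
    proof (rule subsetI, clarify)
      fix u i assume "u \<in> {0..t}"
      then show "\<exists>U C. Z u -` {i} \<inter> space P = cylinder U C \<and> finite U \<and> U \<subseteq> {0..t}"
        by (intro exI[of _ "{u}"] exI[of _ "\<lambda>_. {i}"]) (auto simp: cylinder_def)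
    qed
    then show ?thesis using A unfolding sets_natfilt by (meson sigma_sets_mono' subsetD)
  qed
  ultimately show ?thesis
  proof (induction rule: sigma_sets_induct_disjoint)
    case (basic A)
    then show ?case using cyl by blast
  next
    case empty
    then show ?case by (simp add: set_lebesgue_integral_def)
  next
    case (compl A)
    have A: "A \<in> events" using compl(1) ev by blast
    have "cylinder {} (\<lambda>_. UNIV) = space P" by (simp add: cylinder_def)
    then have 0: "(LINT \<omega>:space P|P. h \<omega>) = 0" using cyl[of "{}" "\<lambda>_. UNIV"] by simp
    have "space P = A \<union> (space P - A)" using sets.sets_into_space[OF A] by blast
    moreover have "(LINT \<omega>:A \<union> (space P - A)|P. h \<omega>) = (LINT \<omega>:A|P. h \<omega>) + (LINT \<omega>:space P - A|P. h \<omega>)"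
      using A h by (intro set_integral_Un integrable_imp_set_integrable) auto
    ultimately show ?case using 0 compl(2) by simp
  next
    case (union A)
    have A: "A i \<in> events" for i using union(2) ev by blast
    have "(LINT \<omega>:(\<Union>i. A i)|P. h \<omega>) = (\<Sum>i. (LINT \<omega>:A i|P. h \<omega>))"
      using A union(1) h
      by (intro lebesgue_integral_countable_add)
        (auto simp: disjoint_family_on_def intro!: integrable_imp_set_integrable)
    then show ?case using union(3) by simp
  qed
qed

text \<open>The defining integral identities are exported instead of a statement on
  \<open>real_cond_exp\<close>, because they will be tested on sets intersected with the already
  decided part of the duration event.\<close>

lemma stay_cond_exp:
  assumes t: "0 \<le> t" "t \<le> r" "r \<le> s" and st: "st \<in> S"
  obtains g where "g \<in> borel_measurable (natfilt P Z t)" "integrable P g"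
    "AE \<omega> in P. g \<omega> = (\<Sum>k\<in>S. bk.path_state init (\<lambda>u. Z u \<omega>) t k * future t r s st k) / path_lik t \<omega>"
    "\<And>A. A \<in> sets (natfilt P Z t) \<Longrightarrow> (LINT \<omega>:A|P. indicator (stay_event r s st) \<omega>) = (LINT \<omega>:A|P. g \<omega>)"
proof -
  define B where "B = stay_event r s st"
  have B: "B \<in> events" unfolding B_def using t by (intro stay_event_events) auto
  define R where "R N \<omega> = stay_ratio t N B (path_word t N \<omega>)" for N \<omega>
  \<comment> \<open>A limit of functions of observed words is measurable for the filtration; the
    filter ratio is shown to agree with it almost surely. Clipping bounds \<open>g\<close> also
    where the sequence has no limit.\<close>
  define g where "g \<omega> = max 0 (min 1 (lim (\<lambda>N. R N \<omega>)))" for \<omega>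
  have Rm: "R N \<in> borel_measurable (natfilt P Z t)" for N
    unfolding R_def word_event_def
    by (rule word_fun_measurable[OF t(1) space_natfilt]) (unfold word_event_def, rule natfilt_grid_events, use t in auto)
  have gm: "g \<in> borel_measurable (natfilt P Z t)"
    unfolding g_def[abs_def]
    by (intro borel_measurable_max borel_measurable_min borel_measurable_const borel_measurable_lim_metric Rm)
  then have gP: "g \<in> borel_measurable P" by (rule measurable_from_subalg[OF natfilt_subalgebra])
  have lim: "AE \<omega> in P. (\<lambda>N. R N \<omega>) \<longlonglongrightarrow> g \<omega>
      \<and> g \<omega> = (\<Sum>k\<in>S. bk.path_state init (\<lambda>u. Z u \<omega>) t k * future t r s st k) / path_lik t \<omega>"
    using AE_path_lik_nonzero[OF t(1)] AE_space
  proof eventually_elim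
    case (elim \<omega>)
    let ?L = "(\<Sum>k\<in>S. bk.path_state init (\<lambda>u. Z u \<omega>) t k * future t r s st k) / path_lik t \<omega>"
    have L: "(\<lambda>N. R N \<omega>) \<longlonglongrightarrow> ?L"
      unfolding R_def B_def by (rule stay_ratio_limit) (use elim t st in auto)
    have "0 \<le> ?L" by (rule LIMSEQ_le_const[OF L]) (auto simp: R_def stay_ratio_bounds[OF t(1)])
    moreover have "?L \<le> 1" by (rule LIMSEQ_le_const2[OF L]) (auto simp: R_def stay_ratio_bounds[OF t(1)])
    ultimately have "g \<omega> = ?L" using limI[OF L] by (simp add: g_def)
    then show ?case using L by simp
  qed
  have gi: "integrable P g"
    using gP by (intro integrable_const_bound[where B = 1] AE_I2) (auto simp: g_def)
  have Bi: "integrable P (indicator B :: 'w \<Rightarrow> real)" using B by (simp add: emeasure_eq_measure)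
  show ?thesis
  proof (rule that[OF gm gi])
    show "AE \<omega> in P. g \<omega> = (\<Sum>k\<in>S. bk.path_state init (\<lambda>u. Z u \<omega>) t k * future t r s st k) / path_lik t \<omega>"
      using lim by eventually_elim blast
    fix A assume A: "A \<in> sets (natfilt P Z t)"
    then have AP: "A \<in> events" using natfilt_subalgebra by (auto simp: subalgebra_def)
    have "(LINT \<omega>:A|P. (indicator B \<omega> - g \<omega>)) = 0"
    proof (rule natfilt_induct[OF _ _ A])
      show "integrable P (\<lambda>\<omega>. indicator B \<omega> - g \<omega>)" using Bi gi by simp
      fix U C assume U: "finite U" "U \<subseteq> {0..t}"
      have ce: "cylinder U C \<in> events" by (rule cylinder_events[OF U])
      have "AE \<omega> in P. (\<lambda>N. stay_ratio t N B (path_word t N \<omega>)) \<longlonglongrightarrow> g \<omega>"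
        using lim unfolding R_def by eventually_elim blast
      from cylinder_integral[OF t(1) U B gP this, of C]
      have "(LINT \<omega>:cylinder U C|P. indicator B \<omega>) = (LINT \<omega>:cylinder U C|P. g \<omega>)"
        by (simp add: set_lebesgue_integral_def)
      then show "(LINT \<omega>:cylinder U C|P. (indicator B \<omega> - g \<omega>)) = 0"
        using ce Bi gi by (subst set_integral_diff) (auto intro!: integrable_imp_set_integrable)
    qed
    then show "(LINT \<omega>:A|P. indicator (stay_event r s st) \<omega>) = (LINT \<omega>:A|P. g \<omega>)"
      using AP Bi gi unfolding B_def
      by (subst (asm) set_integral_diff) (auto intro!: integrable_imp_set_integrable)
  qed
qed

end

section \<open>The duration event\<close>

declare jump_time.simps(2) [simp del]

lemma step_path_left_limit:
  assumes f: "step_path f" and v: "0 < v"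
  obtains a c where "0 \<le> a" "a < v" "\<And>x. x \<in> {a..<v} \<Longrightarrow> f x = c"
proof -
  \<comment> \<open>The weak inequality admits \<open>v\<close> itself as a jump time; the constant
    stretch before \<open>v\<close> then starts at the n-th jump time.\<close>
  define n where "n = (LEAST n. ereal v \<le> jump_time f (Suc n))"
  have "\<exists>n. ereal v \<le> jump_time f (Suc n)"
    using jump_time_exceeds[OF f, of v] v by (auto intro: less_imp_le)
  then have n: "ereal v \<le> jump_time f (Suc n)" unfolding n_def by (rule LeastI_ex)
  have lt: "jump_time f n < ereal v"
  proof (cases n)
    case 0
    then show ?thesis using v by (simp add: zero_ereal_def)
  next
    case (Suc m)
    then have "\<not> ereal v \<le> jump_time f (Suc m)"
      using not_less_Least[of m "\<lambda>n. ereal v \<le> jump_time f (Suc n)"] by (simp add: n_def)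
    then show ?thesis using Suc by simp
  qed
  then have J: "jump_time f n = ereal (jtime f n)" "0 \<le> jtime f n"
    using jump_time_cases[OF f, of n] by auto
  show ?thesis
  proof (rule that)
    show "0 \<le> jtime f n" by fact
    show "jtime f n < v" using lt J by simp
    fix x assume x: "x \<in> {jtime f n..<v}"
    then have "ereal x < ereal v" by simp
    then have "ereal x < jump_time f (Suc n)" using n by (rule less_le_trans)
    then show "f x = f (jtime f n)" using x jump_time_Suc_props(2)[OF f J] by simp
  qed
qed

context aggregate_model
begin

definition hold :: "real \<Rightarrow> real \<Rightarrow> 'w set" where
  "hold a b = {\<omega>\<in>space P. \<forall>x\<in>{a..b}. Z x \<omega> = Z b \<omega>}"

lemma holdI: "\<omega> \<in> space P \<Longrightarrow> (\<And>x. x \<in> {a..b} \<Longrightarrow> Z x \<omega> = Z b \<omega>) \<Longrightarrow> \<omega> \<in> hold a b"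
  unfolding hold_def by blast

lemma holdD: "\<omega> \<in> hold a b \<Longrightarrow> a \<le> x \<Longrightarrow> x \<le> b \<Longrightarrow> Z x \<omega> = Z b \<omega>"
  unfolding hold_def by (erule CollectE, erule conjE, erule bspec) simp

definition left_approx :: "real \<Rightarrow> nat \<Rightarrow> real" where
  "left_approx v k = max 0 (v - 1 / real (Suc k))"

text \<open>Constancy on some interval ending at \<open>v\<close>, with the unknown length
  restricted to the countable family \<open>left_approx\<close> so that the event is
  measurable.\<close>

definition no_jump_at :: "real \<Rightarrow> 'w set" where
  "no_jump_at v = (\<Union>k. hold (left_approx v k) v)"

lemma left_approx_bounds: "0 < v \<Longrightarrow> 0 \<le> left_approx v k \<and> left_approx v k < v \<and> v - left_approx v k \<le> 1 / real (Suc k)"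
  by (auto simp: left_approx_def max_def)

lemma left_approx_eventually:
  assumes "a < v"
  shows "\<forall>\<^sub>F k in sequentially. a \<le> left_approx v k"
proof -
  have "\<forall>\<^sub>F k in sequentially. 1 / real (Suc k) < v - a"
    using LIMSEQ_Suc[OF lim_const_over_n[of 1]] assms by (intro order_tendstoD) auto
  then show ?thesis by eventually_elim (auto simp: left_approx_def)
qed

text \<open>Constancy over a continuum of times is reduced to countably many grids, and the common
  value \<open>j\<close> ranges over a countable set.\<close>

lemma hold_natfilt:
  assumes "0 \<le> a" "a \<le> b" "b \<le> t"
  shows "hold a b \<in> sets (natfilt P Z t)"
proof -
  let ?G = "\<lambda>j N. {\<omega>\<in>space P. \<forall>l\<le>Suc N. Z (unif_grid a b N l) \<omega> = (\<lambda>_. j) l}"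
  have "hold a b = (\<Union>j. \<Inter>N. ?G j N)"
  proof (rule subset_antisym; rule subsetI)
    fix \<omega> assume "\<omega> \<in> hold a b"
    then show "\<omega> \<in> (\<Union>j. \<Inter>N. ?G j N)"
      using unif_grid_bounds[OF assms(2)] by (auto simp: hold_def)
  next
    fix \<omega> assume "\<omega> \<in> (\<Union>j. \<Inter>N. ?G j N)"
    then obtain j where \<omega>: "\<omega> \<in> space P" and eq: "\<And>N l. l \<le> Suc N \<Longrightarrow> Z (unif_grid a b N l) \<omega> = j" by auto
    have "\<forall>x\<in>{a..b}. Z x \<omega> = j"
      using step_path_const_iff_grid[OF Z_step_path[OF \<omega>] assms(1), of b j]
    proof
      assume "\<forall>\<^sub>F N in sequentially. \<exists>l\<le>Suc N. Z (unif_grid a b N l) \<omega> \<noteq> j"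
      then show ?thesis using eventually_happens'[OF sequentially_bot] eq by blast
    qed
    then show "\<omega> \<in> hold a b" using \<omega> assms by (auto simp: hold_def)
  qed
  also have "\<dots> \<in> sets (natfilt P Z t)"
    by (intro sets.countable_UN sets.countable_INT image_subsetI UNIV_not_empty natfilt_grid_events[OF assms])
  finally show ?thesis .
qed

lemma hold_events: "0 \<le> a \<Longrightarrow> a \<le> b \<Longrightarrow> hold a b \<in> events"
  using hold_natfilt[of a b b] natfilt_subalgebra[of b] by (auto simp: subalgebra_def)

lemma no_jump_at_natfilt: "0 < v \<Longrightarrow> v \<le> t \<Longrightarrow> no_jump_at v \<in> sets (natfilt P Z t)"
  unfolding no_jump_at_def using left_approx_bounds[of v]
  by (intro sets.countable_UN image_subsetI hold_natfilt) (auto simp only: less_imp_le)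

lemma no_jump_at_events: "0 < v \<Longrightarrow> no_jump_at v \<in> events"
  using no_jump_at_natfilt[of v v] natfilt_subalgebra[of v] by (auto simp: subalgebra_def)

lemma pair_prob:
  assumes av: "0 \<le> a" "a \<le> v" and ik: "i \<in> S" "k \<in> S"
  shows "prob {\<omega>\<in>space P. X a \<omega> = i \<and> X v \<omega> = k} = prob {\<omega>\<in>space P. X a \<omega> = i} * full_kernel J d M a v i k"
proof -
  \<comment> \<open>The model describes laws starting at time 0, so an unconstrained coordinate at 0
    precedes \<open>a\<close> and \<open>v\<close>.\<close>
  define u where "u m = (if m = 0 then 0 else if m = Suc 0 then a else v)" for m :: nat
  define B where "B m = (if m = Suc 0 then {i} else UNIV)" for m :: nat
  have mono: "u m \<le> u (Suc m)" for m using av by (simp add: u_def)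
  have u0: "u 0 = 0" by (simp add: u_def)
  have "{\<omega>\<in>space P. X a \<omega> = i} = {\<omega>\<in>space P. (\<forall>m\<le>Suc 0. X (u m) \<omega> \<in> B m) \<and> X (u (Suc 0)) \<omega> = i}"
    by (auto simp: u_def B_def)
  then have 1: "prob {\<omega>\<in>space P. X a \<omega> = i} = bk.fwd u B init (Suc 0) i"
    using forward_prob[OF u0 mono ik(1), where n = "Suc 0" and B = B] by (simp only:)
  have "{\<omega>\<in>space P. X a \<omega> = i \<and> X v \<omega> = k}
      = {\<omega>\<in>space P. (\<forall>m\<le>Suc (Suc 0). X (u m) \<omega> \<in> B m) \<and> X (u (Suc (Suc 0))) \<omega> = k}"
    by (auto simp: u_def B_def le_Suc_eq)
  then have "prob {\<omega>\<in>space P. X a \<omega> = i \<and> X v \<omega> = k} = bk.fwd u B init (Suc (Suc 0)) k"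
    using forward_prob[OF u0 mono ik(2), where n = "Suc (Suc 0)" and B = B] by (simp only:)
  also have "\<dots> = (\<Sum>c\<in>S. bk.fwd u B init (Suc 0) c * full_kernel J d M a v c k)"
    by (simp only: bk.fwd.simps(2)[of u B init "Suc 0"]) (simp add: u_def B_def del: bk.fwd.simps)
  also have "\<dots> = (\<Sum>c\<in>S. if c = i then bk.fwd u B init (Suc 0) i * full_kernel J d M a v i k else 0)"
    by (intro sum.cong refl) (auto simp: bk.fwd_supp B_def simp del: bk.fwd.simps)
  also have "\<dots> = prob {\<omega>\<in>space P. X a \<omega> = i} * full_kernel J d M a v i k"
    using ik(1) unfolding 1 by simp
  finally show ?thesis .
qed

text \<open>A union bound over pairs of distinct states, each with an off-diagonal transition entry
  of order v - a.\<close>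

lemma change_prob_bound:
  obtains C where "0 \<le> C" "\<And>a v. 0 \<le> a \<Longrightarrow> a \<le> v \<Longrightarrow> v \<le> H \<Longrightarrow> prob {\<omega>\<in>space P. X a \<omega> \<noteq> X v \<omega>} \<le> C * (v - a)"
proof -
  obtain C where C: "C \<ge> 0"
    "\<And>a x i k. 0 \<le> a \<Longrightarrow> a \<le> x \<Longrightarrow> x \<le> H \<Longrightarrow> i \<in> S \<Longrightarrow> k \<in> S \<Longrightarrow> \<bar>full_kernel J d M a x i k - of_bool (i = k)\<bar> \<le> C * (x - a)"
    by (rule fund_sol_near_id[of S _ "full_kernel J d M" H, OF bk.A bk.p]; blast)
  let ?I = "{(i, k) \<in> S \<times> S. i \<noteq> k}"
  have finI: "finite ?I" by (rule finite_subset[of _ "S \<times> S"]) auto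
  show ?thesis
  proof (rule that)
    show "0 \<le> real (card ?I) * C" using C by simp
    fix a v assume av: "0 \<le> a" "a \<le> v" "v \<le> H"
    let ?E = "\<lambda>q. {\<omega>\<in>space P. X a \<omega> = fst q \<and> X v \<omega> = snd q}"
    have ev: "?E q \<in> events" for q
    proof -
      have "?E q = {\<omega>\<in>space P. X a \<omega> \<in> {fst q}} \<inter> {\<omega>\<in>space P. X v \<omega> \<in> {snd q}}" by auto
      also have "\<dots> \<in> events" using av by (intro sets.Int X_event) auto
      finally show ?thesis .
    qed
    have "{\<omega>\<in>space P. X a \<omega> \<noteq> X v \<omega>} \<subseteq> (\<Union>q\<in>?I. ?E q)"
    proof
      fix \<omega> assume "\<omega> \<in> {\<omega>\<in>space P. X a \<omega> \<noteq> X v \<omega>}"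
      then show "\<omega> \<in> (\<Union>q\<in>?I. ?E q)"
        using X_in[of \<omega> a] X_in[of \<omega> v] av by (intro UN_I[of "(X a \<omega>, X v \<omega>)"]) auto
    qed
    then have "prob {\<omega>\<in>space P. X a \<omega> \<noteq> X v \<omega>} \<le> prob (\<Union>q\<in>?I. ?E q)"
      using finI ev by (intro finite_measure_mono sets.finite_UN) auto
    also have "\<dots> \<le> (\<Sum>q\<in>?I. prob (?E q))"
      using finI ev by (intro finite_measure_subadditive_finite) auto
    also have "\<dots> \<le> (\<Sum>q\<in>?I. C * (v - a))"
    proof (rule sum_mono)
      fix q assume q: "q \<in> ?I"
      then obtain i k where q: "q = (i, k)" and ik: "i \<in> S" "k \<in> S" "i \<noteq> k" by blast
      have "full_kernel J d M a v i k \<le> C * (v - a)"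
        using C(2)[OF av ik(1,2)] ik(3) by simp
      then have "prob {\<omega>\<in>space P. X a \<omega> = i} * full_kernel J d M a v i k \<le> prob {\<omega>\<in>space P. X a \<omega> = i} * (C * (v - a))"
        by (intro mult_left_mono) auto
      also have "\<dots> \<le> 1 * (C * (v - a))"
        using C(1) av by (intro mult_right_mono) auto
      finally show "prob (?E q) \<le> C * (v - a)"
        using pair_prob[OF av(1,2) ik(1,2)] by (simp add: q)
    qed
    finally show "prob {\<omega>\<in>space P. X a \<omega> \<noteq> X v \<omega>} \<le> real (card ?I) * C * (v - a)"
      by (simp add: mult.assoc)
  qed
qed

lemma X_ne_event:
  assumes "0 \<le> a" "0 \<le> v"
  shows "{\<omega>\<in>space P. X a \<omega> \<noteq> X v \<omega>} \<in> events"
proof -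
  have "{\<omega>\<in>space P. X a \<omega> \<noteq> X v \<omega>} = (\<Union>i\<in>S. {\<omega>\<in>space P. X a \<omega> \<in> {i}} \<inter> {\<omega>\<in>space P. X v \<omega> \<in> - {i}})"
    using X_in[of _ a] assms by auto
  also have "\<dots> \<in> events" using assms by (intro sets.finite_UN sets.Int X_event) auto
  finally show ?thesis .
qed

text \<open>Along \<open>left_approx\<close> the probability of differing from \<open>X v\<close>
  tends to 0, so almost surely the value at \<open>v\<close> recurs at arbitrarily late
  approximations. The macrostate is constant just before \<open>v\<close>, so one late recurrence
  forces its left limit to be \<open>Z v\<close>.\<close>

lemma AE_no_jump_at:
  assumes v: "0 < v"
  shows "AE \<omega> in P. \<omega> \<in> no_jump_at v"
proof -
  let ?a = "left_approx v"
  let ?L = "\<lambda>k. {\<omega>\<in>space P. X (?a k) \<omega> \<noteq> X v \<omega>}"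
  note a = left_approx_bounds[OF v]
  obtain C where C: "0 \<le> C" "\<And>a w. 0 \<le> a \<Longrightarrow> a \<le> w \<Longrightarrow> w \<le> v \<Longrightarrow> prob {\<omega>\<in>space P. X a \<omega> \<noteq> X w \<omega>} \<le> C * (w - a)"
    using change_prob_bound by blast
  have L: "?L k \<in> events" for k using a[of k] v by (intro X_ne_event) auto
  have "AE \<omega> in P. \<exists>k\<ge>n. X (?a k) \<omega> = X v \<omega>" for n
  proof -
    let ?N = "\<Inter>k\<in>{n..}. ?L k"
    have N: "?N \<in> events" using L by (intro sets.countable_INT') auto
    have "prob ?N \<le> C * (1 / real (Suc k))" if "n \<le> k" for k
    proof -
      have "prob ?N \<le> prob (?L k)" using L that by (intro finite_measure_mono) auto
      also have "\<dots> \<le> C * (v - ?a k)" using a[of k] by (intro C) auto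
      also have "\<dots> \<le> C * (1 / real (Suc k))" using a[of k] C(1) by (intro mult_left_mono) auto
      finally show ?thesis .
    qed
    moreover have "(\<lambda>k. C * (1 / real (Suc k))) \<longlonglongrightarrow> C * 0"
      by (intro tendsto_mult tendsto_const LIMSEQ_Suc[OF lim_const_over_n])
    ultimately have "prob ?N \<le> C * 0" by (intro LIMSEQ_le_const) auto
    then have "prob ?N = 0" by (simp add: measure_le_0_iff)
    then have "?N \<in> null_sets P" using N by (simp add: null_sets_def emeasure_eq_measure)
    then show ?thesis by (rule AE_I') auto
  qed
  then have "AE \<omega> in P. \<forall>n. \<exists>k\<ge>n. X (?a k) \<omega> = X v \<omega>" by (simp add: AE_all_countable)
  then show ?thesis
    using AE_space
  proof eventually_elim
    case (elim \<omega>)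
    obtain a0 c where a0: "0 \<le> a0" "a0 < v" "\<And>x. x \<in> {a0..<v} \<Longrightarrow> Z x \<omega> = c"
      using step_path_left_limit[OF Z_step_path[OF elim(2)] v] by blast
    obtain K where K: "\<And>k. K \<le> k \<Longrightarrow> a0 \<le> ?a k"
      using left_approx_eventually[OF a0(2)] unfolding eventually_sequentially by blast
    obtain k where k: "K \<le> k" "X (?a k) \<omega> = X v \<omega>" using elim(1) by blast
    have "Z (?a k) \<omega> = Z v \<omega>" using k(2) by (simp add: macro_def)
    then have c: "c = Z v \<omega>" using a0(3)[of "?a k"] K[OF k(1)] a[of k] by auto
    have "Z x \<omega> = Z v \<omega>" if "x \<in> {?a k..v}" for x
      using that a0(3)[of x] K[OF k(1)] c by (cases "x = v") auto
    then have "\<omega> \<in> hold (?a k) v" by (rule holdI[OF elim(2)])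
    then show ?case unfolding no_jump_at_def by blast
  qed
qed

text \<open>The supremum exceeds \<open>z\<close> only if constancy reaches strictly before
  \<open>s - z\<close>; holding on \<open>{s - z..s}\<close> alone yields a duration of at least
  \<open>z\<close>, hence the second condition.\<close>

lemma duration_iff:
  assumes \<omega>: "\<omega> \<in> space P" and z: "0 \<le> z" "z < s"
  shows "duration Z s \<omega> > z \<longleftrightarrow> \<omega> \<in> hold (s - z) s \<and> \<omega> \<in> no_jump_at (s - z)"
proof -
  let ?D = "{x\<in>{0..s}. \<forall>y\<in>{s-x..s}. Z y \<omega> = Z s \<omega>}"
  let ?v = "s - z"
  have v: "0 < ?v" using z by simp
  have "0 \<in> ?D" using z by auto
  then have ne: "?D \<noteq> {}" by blast
  have bdd: "bdd_above ?D" by (rule bdd_aboveI[of _ s]) auto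
  have "duration Z s \<omega> > z \<longleftrightarrow> (\<exists>x\<in>?D. z < x)"
    unfolding duration_def by (rule less_cSup_iff[OF ne bdd])
  also have "\<dots> \<longleftrightarrow> \<omega> \<in> hold ?v s \<and> \<omega> \<in> no_jump_at ?v"
  proof
    assume "\<exists>x\<in>?D. z < x"
    then obtain x where x: "x \<in> ?D" "z < x" by blast
    have h: "\<And>y. y \<in> {s-x..s} \<Longrightarrow> Z y \<omega> = Z s \<omega>" using x by blast
    have lt: "s - x < ?v" using x(2) by simp
    obtain k where k: "s - x \<le> left_approx ?v k"
      using eventually_happens'[OF sequentially_bot left_approx_eventually[OF lt]] by blast
    have "Z y \<omega> = Z ?v \<omega>" if "y \<in> {left_approx ?v k..?v}" for y
    proof -
      have "y \<in> {s-x..s}" "?v \<in> {s-x..s}"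
        using that k lt z unfolding atLeastAtMost_iff by linarith+
      from h[OF this(1)] h[OF this(2)] show ?thesis by (rule trans[OF _ sym])
    qed
    then have "\<omega> \<in> hold (left_approx ?v k) ?v" by (rule holdI[OF \<omega>])
    moreover have "Z y \<omega> = Z s \<omega>" if "y \<in> {?v..s}" for y
    proof -
      have "y \<in> {s-x..s}" using that lt unfolding atLeastAtMost_iff by linarith
      then show ?thesis by (rule h)
    qed
    then have "\<omega> \<in> hold ?v s" by (rule holdI[OF \<omega>])
    ultimately show "\<omega> \<in> hold ?v s \<and> \<omega> \<in> no_jump_at ?v" unfolding no_jump_at_def by blast
  next
    assume *: "\<omega> \<in> hold ?v s \<and> \<omega> \<in> no_jump_at ?v"
    then obtain k where k: "\<omega> \<in> hold (left_approx ?v k) ?v" unfolding no_jump_at_def by blast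
    let ?x = "s - left_approx ?v k"
    have "Z y \<omega> = Z s \<omega>" if "y \<in> {left_approx ?v k..s}" for y
    proof (cases "y \<le> ?v")
      case True
      then have "Z y \<omega> = Z ?v \<omega>" using holdD[OF k, of y] that by simp
      also have "\<dots> = Z s \<omega>" using holdD[of \<omega> ?v s ?v] * z by simp
      finally show ?thesis .
    next
      case False
      then show ?thesis using holdD[of \<omega> ?v s y] * that by simp
    qed
    moreover have "s - ?x = left_approx ?v k" by simp
    moreover have "?x \<in> {0..s}" using left_approx_bounds[OF v, of k] z by simp
    ultimately have "?x \<in> ?D" by (simp only: mem_Collect_eq) blast
    moreover have "z < ?x" using left_approx_bounds[OF v, of k] by auto
    ultimately show "\<exists>x\<in>?D. z < x" by blast
  qed
  finally show ?thesis .
qed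

text \<open>This produces the case distinction t_n < s - z in \<open>ptilde\<close>. If the last
  jump up to \<open>t\<close> were at or after \<open>v\<close>, the value before that jump would
  still occur inside the interval of constancy.\<close>

lemma hold_iff_jtime:
  assumes \<omega>: "\<omega> \<in> space P" and v: "0 < v" "v \<le> t"
  defines "f \<equiv> (\<lambda>u. Z u \<omega>)"
  shows "\<omega> \<in> hold v t \<inter> no_jump_at v \<longleftrightarrow> jtime f (jump_count f t) < v"
proof -
  have f: "step_path f" unfolding f_def by (rule Z_step_path[OF \<omega>])
  have t: "0 \<le> t" using v by simp
  define n where "n = jump_count f t"
  note n = jump_count_bounds[OF f t, folded n_def]
  have const: "f x = f t" if "jtime f n \<le> x" "x \<le> t" for x
  proof -
    have "ereal x < jump_time f (Suc n)" using n(2) that by (meson ereal_less_eq(3) le_less_trans)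
    from jump_time_Suc_props(2)[OF f n(3,4) that(1) this] show ?thesis
      using jump_count_value[OF f t] by (simp add: n_def)
  qed
  show ?thesis
    unfolding n_def[symmetric]
  proof
    assume lt: "jtime f n < v"
    obtain k where k: "jtime f n \<le> left_approx v k"
      using eventually_happens'[OF sequentially_bot left_approx_eventually[OF lt]] by blast
    have "\<omega> \<in> hold (left_approx v k) v"
    proof (rule holdI[OF \<omega>])
      fix x assume "x \<in> {left_approx v k..v}"
      then have "f x = f t" "f v = f t" using k lt v by (auto intro: const)
      then show "Z x \<omega> = Z v \<omega>" by (simp add: f_def)
    qed
    moreover have "\<omega> \<in> hold v t"
    proof (rule holdI[OF \<omega>])
      fix x assume "x \<in> {v..t}"
      then have "f x = f t" using lt by (intro const) auto
      then show "Z x \<omega> = Z t \<omega>" by (simp add: f_def)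
    qed
    ultimately show "\<omega> \<in> hold v t \<inter> no_jump_at v" unfolding no_jump_at_def by blast
  next
    assume *: "\<omega> \<in> hold v t \<inter> no_jump_at v"
    then obtain k where k: "\<omega> \<in> hold (left_approx v k) v" unfolding no_jump_at_def by blast
    let ?a = "left_approx v k"
    have eq: "f x = f t" if "x \<in> {?a..t}" for x
    proof (cases "x \<le> v")
      case True
      then have "f x = f v" using holdD[OF k, of x] that by (simp add: f_def)
      also have "\<dots> = f t" using holdD[of \<omega> v t v] * v by (simp add: f_def)
      finally show ?thesis .
    next
      case False
      then show ?thesis using holdD[of \<omega> v t x] * that by (simp add: f_def)
    qed
    show "jtime f n < v"
    proof (rule ccontr)
      assume "\<not> ?thesis"
      then have ge: "v \<le> jtime f n" by simp
      then have "n \<noteq> 0" using v by (intro notI) (simp add: jtime_def)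
      then obtain m where m: "n = Suc m" by (cases n) auto
      have Jm: "jump_time f m < jump_time f n"
        using n(3) by (intro jump_time_finite_less[OF f]) (auto simp: m)
      then have J: "jump_time f m = ereal (jtime f m)" "0 \<le> jtime f m"
        using jump_time_cases[OF f, of m] by auto
      \<comment> \<open>A point after the previous jump, before the last one, and inside the
        interval of constancy: the path would have its old and its present value there.\<close>
      define x where "x = max (jtime f m) ?a"
      have x: "jtime f m \<le> x" "x < jtime f n" "?a \<le> x"
        using Jm J n(3) ge left_approx_bounds[OF v(1), of k] by (auto simp: x_def)
      have "ereal x < jump_time f (Suc m)" using x(2) n(3) by (simp only: m) simp
      from jump_time_Suc_props(2)[OF f J x(1) this] have "f x = f (jtime f m)" .
      moreover have "f (jtime f n) \<noteq> f (jtime f m)"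
        using n(3) unfolding m by (rule jump_time_Suc_props(3)[OF f J])
      moreover have "f x = f t" "f (jtime f n) = f t" using x n(5) by (auto intro!: eq)
      ultimately show False by simp
    qed
  qed
qed

text \<open>The model gives the initial law only, while the path formula starts \<open>alpha\<close>
  in macrostate 0.\<close>

lemma AE_Z0: "AE \<omega> in P. Z 0 \<omega> = 0"
proof -
  have "AE \<omega> in P. \<forall>k\<in>S. fst k \<noteq> 0 \<longrightarrow> X 0 \<omega> \<noteq> k"
  proof (rule AE_finite_allI)
    fix k assume k: "k \<in> S"
    have "prob {\<omega>\<in>space P. X 0 \<omega> = k} = init k"
      using fdd[of "\<lambda>_. 0" 0 "\<lambda>_. k"] k by simp
    moreover have "{\<omega>\<in>space P. X 0 \<omega> = k} \<in> events" using X_event[of 0 "{k}"] by simp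
    ultimately have "fst k \<noteq> 0 \<Longrightarrow> AE \<omega> in P. \<not> X 0 \<omega> = k"
      using prob_Collect_eq_0[of "\<lambda>\<omega>. X 0 \<omega> = k"] by (simp add: init_dist_def)
    then show "AE \<omega> in P. fst k \<noteq> 0 \<longrightarrow> X 0 \<omega> \<noteq> k" by (cases "fst k = 0") auto
  qed simp
  then show ?thesis
    using AE_space
  proof eventually_elim
    case (elim \<omega>)
    then show ?case using X_in[of \<omega> 0] by (auto simp: macro_def)
  qed
qed

section \<open>Assembly of the conditional law\<close>

lemma jump_interval_sum:
  assumes f: "step_path f" and t: "0 \<le> t"
  shows "(\<Sum>n. indicator {jump_time f n ..< jump_time f (Suc n)} (ereal t) * F n) = (F (jump_count f t) :: real)"
proof -
  have "indicator {jump_time f n ..< jump_time f (Suc n)} (ereal t) * F n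
      = (if n = jump_count f t then F n else 0)" for n
  proof (cases "n = jump_count f t")
    case True
    then show ?thesis using jump_count_bounds(1,2)[OF f t] by simp
  next
    case False
    then have "ereal t \<notin> {jump_time f n ..< jump_time f (Suc n)}"
      using jump_count_eqI[OF f, of n t] by auto
    then show ?thesis using False by simp
  qed
  then show ?thesis using sums_unique[OF sums_single[of "jump_count f t" F]] by simp
qed

lemma pbar_ae:
  assumes t: "0 \<le> t" "t \<le> s" and z: "0 \<le> z" and st: "st \<in> S"
  shows "AE \<omega> in P. pbar P X st t s z \<omega> =
    (\<Sum>n. indicator {jump_time (\<lambda>u. Z u \<omega>) n ..< jump_time (\<lambda>u. Z u \<omega>) (Suc n)} (ereal t)
       * ptilde J d M pi0 t s z st (jump_seq (\<lambda>u. Z u \<omega>) n))"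
proof -
  let ?F = "natfilt P Z t" and ?v = "s - z"
  let ?Bd = "{\<omega>\<in>space P. X s \<omega> = st \<and> duration Z s \<omega> > z}"
  let ?n = "\<lambda>\<omega>. jump_count (\<lambda>u. Z u \<omega>) t"
  let ?L = "\<lambda>\<omega>. (\<Sum>k\<in>S. bk.path_state init (\<lambda>u. Z u \<omega>) t k * future t (max ?v t) s st k) / path_lik t \<omega>"
  interpret fs: finite_measure_subalgebra P ?F
    using natfilt_subalgebra by unfold_locales
  have rhs: "(\<Sum>n. indicator {jump_time (\<lambda>u. Z u \<omega>) n ..< jump_time (\<lambda>u. Z u \<omega>) (Suc n)} (ereal t)
       * ptilde J d M pi0 t s z st (jump_seq (\<lambda>u. Z u \<omega>) n))
    = (if ?v \<le> jtime (\<lambda>u. Z u \<omega>) (?n \<omega>) then 0 else ?L \<omega>)"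
    if \<omega>: "\<omega> \<in> space P" and 0: "Z 0 \<omega> = 0" for \<omega>
    unfolding jump_interval_sum[OF Z_step_path[OF \<omega>] t(1)] path_lik_def
    by (rule ptilde_path[OF pi0_carrier Z_step_path[OF \<omega>]]) (use 0 t z st Z_less[OF \<omega>] in auto)
  show ?thesis
  proof (cases "0 < ?v")
    \<comment> \<open>A duration never exceeds \<open>s\<close>, so for s - z \<le> 0 the event is
      empty; the last jump time is nonnegative, so the formula gives 0 as well.\<close>
    case False
    have Bd: "?Bd = {}"
    proof (rule equals0I)
      fix \<omega> assume "\<omega> \<in> ?Bd"
      then have "z < duration Z s \<omega>" by simp
      also have "duration Z s \<omega> \<le> s"
        unfolding duration_def using t by (intro cSup_least) (auto intro!: exI[of _ 0])
      finally show "False" using False by simp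
    qed
    have "AE \<omega> in P. pbar P X st t s z \<omega> = 0"
      unfolding pbar_def Bd by (rule fs.real_cond_exp_charact) auto
    then show ?thesis
      using AE_Z0 AE_space
    proof eventually_elim
      case (elim \<omega>)
      have "?v \<le> jtime (\<lambda>u. Z u \<omega>) (?n \<omega>)"
        using jump_count_bounds(4)[OF Z_step_path[OF elim(3)] t(1)] False by linarith
      then show ?case using elim(1) rhs[OF elim(3,2)] by simp
    qed
  next
    case v: True
    let ?r = "max ?v t"
    have r: "t \<le> ?r" "?r \<le> s" using t z by auto
    obtain g where g: "g \<in> borel_measurable ?F" "integrable P g" "AE \<omega> in P. g \<omega> = ?L \<omega>"
      "\<And>A. A \<in> sets ?F \<Longrightarrow> (LINT \<omega>:A|P. indicator (stay_event ?r s st) \<omega>) = (LINT \<omega>:A|P. g \<omega>)"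
      using stay_cond_exp[OF t(1) r st] by blast
    \<comment> \<open>The part of the event decided at time \<open>t\<close>: constancy from just
      before \<open>s - z\<close> up to \<open>t\<close>, or no restriction if \<open>s - z\<close>
      lies after \<open>t\<close>. In both cases it amounts to t_n < s - z.\<close>
    define C where "C = (if ?v \<le> t then hold ?v t \<inter> no_jump_at ?v else space P)"
    have C: "C \<in> sets ?F"
      using hold_natfilt[of ?v t t] no_jump_at_natfilt[OF v, of t] v sets.top[of ?F] by (auto simp: C_def)
    have CP: "C \<in> events" using C natfilt_subalgebra by (auto simp: subalgebra_def)
    have E: "stay_event ?r s st \<in> events" using t r by (intro stay_event_events) auto
    have Bd: "?Bd = {\<omega>\<in>space P. X s \<omega> \<in> {st}} \<inter> (hold ?v s \<inter> no_jump_at ?v)"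
      using duration_iff[OF _ z] v by auto
    have Bd_ev: "?Bd \<in> events"
      unfolding Bd using t z v by (intro sets.Int X_event hold_events no_jump_at_events) auto
    have C_iff: "\<omega> \<in> C \<longleftrightarrow> jtime (\<lambda>u. Z u \<omega>) (?n \<omega>) < ?v" if \<omega>: "\<omega> \<in> space P" for \<omega>
    proof (cases "?v \<le> t")
      case True
      then show ?thesis using hold_iff_jtime[OF \<omega> v True] by (simp add: C_def)
    next
      case False
      then show ?thesis using jump_count_bounds(5)[OF Z_step_path[OF \<omega>] t(1)] \<omega> by (simp add: C_def)
    qed
    \<comment> \<open>Excluding a jump at exactly \<open>s - z\<close> makes the two events agree.
      For s - z \<le> t the hold up to \<open>s\<close> is split at \<open>t\<close> into its
      observed and its future part.\<close>
    have split: "AE \<omega> in P. indicator ?Bd \<omega> = (indicator (C \<inter> stay_event ?r s st) \<omega> :: real)"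
      using AE_no_jump_at[OF v] AE_space
    proof eventually_elim
      case (elim \<omega>)
      have "\<omega> \<in> ?Bd \<longleftrightarrow> \<omega> \<in> C \<inter> stay_event ?r s st"
      proof (cases "?v \<le> t")
        case True
        show ?thesis
        proof
          assume *: "\<omega> \<in> ?Bd"
          then have h: "\<omega> \<in> hold ?v s" and X: "X s \<omega> = st" unfolding Bd by auto
          have "\<omega> \<in> hold ?v t"
          proof (rule holdI[OF elim(2)])
            fix x assume "x \<in> {?v..t}"
            then show "Z x \<omega> = Z t \<omega>" using holdD[OF h, of x] holdD[OF h, of t] True t by simp
          qed
          moreover have "Z x \<omega> = fst st" if "x \<in> {t..s}" for x
            using holdD[OF h, of x] True that X by (simp add: macro_def)
          ultimately show "\<omega> \<in> C \<inter> stay_event ?r s st"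
            using True elim X by (simp add: C_def stay_event_def max_def)
        next
          assume *: "\<omega> \<in> C \<inter> stay_event ?r s st"
          then have h: "\<omega> \<in> hold ?v t" and X: "X s \<omega> = st" and e: "\<And>x. t \<le> x \<Longrightarrow> x \<le> s \<Longrightarrow> Z x \<omega> = fst st"
            using True by (auto simp: C_def stay_event_def max_def split: if_splits)
          have "\<omega> \<in> hold ?v s"
          proof (rule holdI[OF elim(2)])
            fix x assume "x \<in> {?v..s}"
            then show "Z x \<omega> = Z s \<omega>"
              using holdD[OF h, of x] e[of x] e[of t] e[of s] t by (cases "x \<le> t") simp_all
          qed
          then show "\<omega> \<in> ?Bd" unfolding Bd using elim X by simp
        qed
      next
        case False
        show ?thesis
        proof
          assume *: "\<omega> \<in> ?Bd"
          then have h: "\<omega> \<in> hold ?v s" and X: "X s \<omega> = st" unfolding Bd by auto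
          have "Z x \<omega> = fst st" if "x \<in> {?v..s}" for x
            using holdD[OF h, of x] that X by (simp add: macro_def)
          then show "\<omega> \<in> C \<inter> stay_event ?r s st"
            using False elim(2) X by (simp add: C_def stay_event_def max_def)
        next
          assume *: "\<omega> \<in> C \<inter> stay_event ?r s st"
          then have X: "X s \<omega> = st" and e: "\<And>x. ?v \<le> x \<Longrightarrow> x \<le> s \<Longrightarrow> Z x \<omega> = fst st"
            using False by (auto simp: stay_event_def max_def split: if_splits)
          have "\<omega> \<in> hold ?v s"
          proof (rule holdI[OF elim(2)])
            fix x assume "x \<in> {?v..s}"
            then show "Z x \<omega> = Z s \<omega>" using e[of x] e[of s] z by simp
          qed
          then show "\<omega> \<in> ?Bd" unfolding Bd using elim X by simp
        qed
      qed
      then show ?case by (simp only: indicator_def)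
    qed
    \<comment> \<open>The decided factor is taken out by testing \<open>g\<close> on A \<inter> C,
      again a set of the filtration, instead of A.\<close>
    have "AE \<omega> in P. real_cond_exp P ?F (indicator ?Bd) \<omega> = indicator C \<omega> * g \<omega>"
    proof (rule fs.real_cond_exp_charact)
      fix A assume A: "A \<in> sets ?F"
      then have AC: "A \<inter> C \<in> sets ?F" using C by auto
      have AP: "A \<in> events" using A natfilt_subalgebra by (auto simp: subalgebra_def)
      have "(LINT \<omega>:A|P. indicator ?Bd \<omega>) = (LINT \<omega>:A|P. (indicator (C \<inter> stay_event ?r s st) \<omega> :: real))"
        unfolding set_lebesgue_integral_def
      proof (rule integral_cong_AE)
        show "AE \<omega> in P. indicat_real A \<omega> *\<^sub>R indicat_real ?Bd \<omega> = indicat_real A \<omega> *\<^sub>R indicat_real (C \<inter> stay_event ?r s st) \<omega>"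
          using split by eventually_elim simp
      qed (use AP Bd_ev CP E in auto)
      also have "\<dots> = (LINT \<omega>:A \<inter> C|P. indicator (stay_event ?r s st) \<omega>)"
        by (simp add: set_lebesgue_integral_def indicator_inter_arith mult.assoc)
      also have "\<dots> = (LINT \<omega>:A \<inter> C|P. g \<omega>)" by (rule g(4)[OF AC])
      also have "\<dots> = (LINT \<omega>:A|P. indicator C \<omega> * g \<omega>)"
        by (simp add: set_lebesgue_integral_def indicator_inter_arith mult.assoc)
      finally show "(LINT \<omega>:A|P. indicator ?Bd \<omega>) = (LINT \<omega>:A|P. indicator C \<omega> * g \<omega>)" .
    next
      show "integrable P (indicat_real ?Bd)" using Bd_ev by (simp add: emeasure_eq_measure)
      show "integrable P (\<lambda>\<omega>. indicator C \<omega> * g \<omega>)"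
        using integrable_mult_indicator[OF CP g(2)] by simp
      show "(\<lambda>\<omega>. indicator C \<omega> * g \<omega>) \<in> borel_measurable ?F"
        using C g(1) by (intro borel_measurable_times borel_measurable_indicator)
    qed
    then show ?thesis
      using g(3) AE_Z0 AE_space
    proof eventually_elim
      case (elim \<omega>)
      then show ?case
        using C_iff[OF elim(4)] rhs[OF elim(4,3)] by (simp add: pbar_def not_le[symmetric])
    qed
  qed
qed

end

text \<open>A conditional expectation is determined up to null sets, so the first claim holds almost
  surely; the reduced formula is pure matrix algebra and holds for every realization.\<close>

theorem theorem5p1:
  fixes P :: "'w measure" and J :: nat and d :: "nat \<Rightarrow> nat"
    and M :: "real \<Rightarrow> real mat" and pi0 :: "real mat"
    and X :: "real \<Rightarrow> 'w \<Rightarrow> nat \<times> nat"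
    and t s z :: real and st :: "nat \<times> nat"
  assumes model: "aggregate_markov P J d M pi0 X"
    and ts: "0 \<le> t" "t \<le> s" and z: "0 \<le> z"
    and st: "st \<in> stE J d"
  shows "(AE \<omega> in P. pbar P X st t s z \<omega> =
            (\<Sum>n. indicator {jump_time (\<lambda>u. macro X u \<omega>) n ..< jump_time (\<lambda>u. macro X u \<omega>) (Suc n)} (ereal t)
                  * ptilde J d M pi0 t s z st (jump_seq (\<lambda>u. macro X u \<omega>) n)))
       \<and> (\<forall>sn. realization J t sn \<and> fst (last sn) < s - z \<and> s - z \<le> t \<longrightarrow>
            ptilde J d M pi0 t s z st sn =
              (if snd (last sn) = fst st then 1 else 0) *
              ((alpha d M pi0 sn * prodint (d (snd (last sn))) (\<lambda>x. blk d (M x) (snd (last sn)) (snd (last sn))) (fst (last sn)) s) $$ (0, snd st)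
               / (alpha d M pi0 sn * prodint (d (snd (last sn))) (\<lambda>x. blk d (M x) (snd (last sn)) (snd (last sn))) (fst (last sn)) t * ones (d (snd (last sn)))) $$ (0,0)))"
proof -
  interpret aggregate_model P J d M pi0 X by unfold_locales (rule model)
  show ?thesis
    using pbar_ae[OF ts z st] ptilde_reduced[OF pi0_carrier _ st ts(2), of _ z]
    by (auto simp: diag_prodint_def)
qed

end
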